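(* Let $X=\{P_1,\dots,P_r\}$ be a set of $r$ distinct points of $\mathbb P^n_{\mathbf k}$, not contained in a hyperplane, let $s$ be the socle degree of $R/I(X)$; fix homogeneous coordinates $P_i=[a_{0,i},\dots,a_{n,i}]$ and let $L_i=a_{0,i}y_0+\cdots+a_{n,i}y_n$ be the associated linear forms. Let $z=b_0x_0+\cdots+b_nx_n$ be a linear form in $R$ with $z(P_i):=b_0a_{0,i}+\cdots+b_na_{n,i}\ne0$ for all $i=1,\dots,r$. The following conditions are equivalent: (1) $X$ is arithmetically Gorenstein; (2) there exists a polynomial $F=\sum_{i=1}^r\frac{\alpha_i}{z(P_i)}L_i^{s}$ with $\alpha_1,\dots,\alpha_r\in\mathbf k$ such that (a) $\sum_{i=1}^r\alpha_iL_i^{s-1}=0$, and (b) $\dim_{\mathbf k}\langle F\rangle\ge r$. If this is the case, then $\alpha_1,\dots,\alpha_r$ all lie in $\mathbf k^*$ and are uniquely determined up to multiplication by a common scalar in $\mathbf k^*$; moreover, setting $F_t=\frac{1}{(t+s-1)!}\sum_{i=1}^r\frac{\alpha_i}{z(P_i)^t}L_i^{t+s-1}$ for $t\ge1$, one has $I(X)^\perp=\langle F_t;\ t\ge1\rangle$, in particular $F_1=\frac1{s!}F$, and the family $\{F_t;\ t\ge1\}$ is $G$-admissible with respect to $z$.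
   Context: $\mathbf k$ is an algebraically closed field of characteristic zero, $n\ge1$, $R=\mathbf k[x_0,\dots,x_n]$ (standard graded) and $\Gamma=\mathbf k[y_0,\dots,y_n]$. $R$ acts on $\Gamma$ by differentiation: $f\circ g=f(\partial_{y_0},\dots,\partial_{y_n})(g)$, making $\Gamma$ an $R$-module. For elements $G_j\in\Gamma$, $\langle G_j\rangle$ denotes the $R$-submodule of $\Gamma$ they generate. For an ideal $I\subset R$, $I^\perp=\{G\in\Gamma: I\circ G=0\}$; for an $R$-submodule $W$ of $\Gamma$, $\operatorname{Ann}_R(W)=\{g\in R: g\circ G=0\ \forall G\in W\}$. $I(X)\subset R$ is the homogeneous ideal of all forms vanishing on $X$. $X$ is arithmetically Gorenstein if $R/I(X)$ is a Gorenstein ring. With $\mathrm{HF}_X(t)=\dim_{\mathbf k}(R/I(X))_t$, the socle degree $s$ of $R/I(X)$ is the largest $t$ with $\mathrm{HF}_X(t)-\mathrm{HF}_X(t-1)\ne0$, equivalently the least $t$ with $\mathrm{HF}_X(t)=r$. A family $\{F_t\}_{t\ge1}$ in $\Gamma$ is $G$-admissible with respect to a linear form $z\in R$ if: (1) $z\circ F_t=F_{t-1}$ for $t>1$ and $z\circ F_1=0$; (2) $\operatorname{Ann}_R(\langle F_t\rangle)\circ F_{t+1}=\langle F_1\rangle$ for all $t\ge1$. *)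

theory Defs
  imports
    "HOL-Library.Poly_Mapping"
    "HOL-Library.Cardinality"
    "HOL-Algebra.Algebraic_Closure_Type"
begin

section \<open>Gorenstein rings\<close>

text \<open>
  The localization of a commutative ring \<open>A\<close> at a prime ideal \<open>P\<close>. The fraction \<open>x/s\<close> is the
  class of all pairs \<open>(y, t)\<close> with \<open>u (x t - y s) = 0\<close> for some \<open>u \<notin> P\<close>. In the operations the
  unions run over representatives; all sets in such a union coincide.
\<close>

definition fraction :: "('a, 'm) ring_scheme \<Rightarrow> 'a set \<Rightarrow> 'a \<Rightarrow> 'a \<Rightarrow> ('a \<times> 'a) set" where
  "fraction A P x s = {(y, t). y \<in> carrier A \<and> t \<in> carrier A - P \<and>
     (\<exists>u \<in> carrier A - P. u \<otimes>\<^bsub>A\<^esub> (x \<otimes>\<^bsub>A\<^esub> t \<ominus>\<^bsub>A\<^esub> y \<otimes>\<^bsub>A\<^esub> s) = \<zero>\<^bsub>A\<^esub>)}"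

definition localization :: "('a, 'm) ring_scheme \<Rightarrow> 'a set \<Rightarrow> ('a \<times> 'a) set ring" where
  "localization A P = \<lparr>
     carrier = {fraction A P x s | x s. x \<in> carrier A \<and> s \<in> carrier A - P},
     monoid.mult = (\<lambda>p q. \<Union>(x, s) \<in> p. \<Union>(y, t) \<in> q. fraction A P (x \<otimes>\<^bsub>A\<^esub> y) (s \<otimes>\<^bsub>A\<^esub> t)),
     one = fraction A P \<one>\<^bsub>A\<^esub> \<one>\<^bsub>A\<^esub>,
     ring.zero = fraction A P \<zero>\<^bsub>A\<^esub> \<one>\<^bsub>A\<^esub>,
     add = (\<lambda>p q. \<Union>(x, s) \<in> p. \<Union>(y, t) \<in> q.
       fraction A P (x \<otimes>\<^bsub>A\<^esub> t \<oplus>\<^bsub>A\<^esub> y \<otimes>\<^bsub>A\<^esub> s) (s \<otimes>\<^bsub>A\<^esub> t)) \<rparr>"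

lemma fraction_iff:
  assumes A: "cring A" and P: "primeideal P A"
    and x: "x \<in> carrier A" "s \<in> carrier A - P" and y: "y \<in> carrier A" "t \<in> carrier A - P"
  shows "(y, t) \<in> fraction A P x s \<longleftrightarrow> (\<exists>u \<in> carrier A - P. u \<otimes>\<^bsub>A\<^esub> (x \<otimes>\<^bsub>A\<^esub> t) = u \<otimes>\<^bsub>A\<^esub> (y \<otimes>\<^bsub>A\<^esub> s))"
proof -
  interpret cring A by (rule A)
  have "u \<otimes>\<^bsub>A\<^esub> (x \<otimes>\<^bsub>A\<^esub> t \<ominus>\<^bsub>A\<^esub> y \<otimes>\<^bsub>A\<^esub> s) = \<zero>\<^bsub>A\<^esub> \<longleftrightarrow> u \<otimes>\<^bsub>A\<^esub> (x \<otimes>\<^bsub>A\<^esub> t) = u \<otimes>\<^bsub>A\<^esub> (y \<otimes>\<^bsub>A\<^esub> s)" if "u \<in> carrier A" for u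
  proof -
    have "u \<otimes>\<^bsub>A\<^esub> (x \<otimes>\<^bsub>A\<^esub> t \<ominus>\<^bsub>A\<^esub> y \<otimes>\<^bsub>A\<^esub> s) = u \<otimes>\<^bsub>A\<^esub> (x \<otimes>\<^bsub>A\<^esub> t) \<ominus>\<^bsub>A\<^esub> u \<otimes>\<^bsub>A\<^esub> (y \<otimes>\<^bsub>A\<^esub> s)"
      using x y that by (simp add: minus_eq r_distr r_minus)
    then show ?thesis
      using x y that r_right_minus_eq[of "u \<otimes>\<^bsub>A\<^esub> (x \<otimes>\<^bsub>A\<^esub> t)" "u \<otimes>\<^bsub>A\<^esub> (y \<otimes>\<^bsub>A\<^esub> s)"] by simp
  qed
  then show ?thesis
    using y unfolding fraction_def by auto
qed

lemma fraction_cong: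
  assumes A: "cring A" and P: "primeideal P A"
    and x: "x \<in> carrier A" "s \<in> carrier A - P"
    and y: "(y, t) \<in> fraction A P x s"
  shows "fraction A P y t = fraction A P x s"
proof -
  interpret cring A by (rule A)
  interpret P: primeideal P A by (rule P)
  have S: "u \<otimes>\<^bsub>A\<^esub> v \<in> carrier A - P" if "u \<in> carrier A - P" "v \<in> carrier A - P" for u v
    using that P.I_prime[of u v] by auto
  have trans: "(w, q) \<in> fraction A P x s"
    if h: "x \<in> carrier A" "s \<in> carrier A - P" "(y, t) \<in> fraction A P x s"
      "(w, q) \<in> fraction A P y t" for x s y t w q
  proof -
    have c: "y \<in> carrier A" "t \<in> carrier A - P" "w \<in> carrier A" "q \<in> carrier A - P"
      using h unfolding fraction_def by auto
    obtain u where u: "u \<in> carrier A - P" "u \<otimes>\<^bsub>A\<^esub> (x \<otimes>\<^bsub>A\<^esub> t) = u \<otimes>\<^bsub>A\<^esub> (y \<otimes>\<^bsub>A\<^esub> s)"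
      using h(3) fraction_iff[OF A P h(1,2) c(1,2)] by auto
    obtain v where v: "v \<in> carrier A - P" "v \<otimes>\<^bsub>A\<^esub> (y \<otimes>\<^bsub>A\<^esub> q) = v \<otimes>\<^bsub>A\<^esub> (w \<otimes>\<^bsub>A\<^esub> t)"
      using h(4) fraction_iff[OF A P c] by auto
    note cs = c(1,3) h(1) c(2,4)[THEN DiffD1] u(1)[THEN DiffD1] v(1)[THEN DiffD1] h(2)[THEN DiffD1]
    have "(u \<otimes>\<^bsub>A\<^esub> v \<otimes>\<^bsub>A\<^esub> t) \<otimes>\<^bsub>A\<^esub> (x \<otimes>\<^bsub>A\<^esub> q) = (u \<otimes>\<^bsub>A\<^esub> (x \<otimes>\<^bsub>A\<^esub> t)) \<otimes>\<^bsub>A\<^esub> (v \<otimes>\<^bsub>A\<^esub> q)"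
      using cs by (simp add: m_ac)
    also have "\<dots> = (u \<otimes>\<^bsub>A\<^esub> s) \<otimes>\<^bsub>A\<^esub> (v \<otimes>\<^bsub>A\<^esub> (y \<otimes>\<^bsub>A\<^esub> q))"
      unfolding u(2) using cs by (simp add: m_ac)
    also have "\<dots> = (u \<otimes>\<^bsub>A\<^esub> v \<otimes>\<^bsub>A\<^esub> t) \<otimes>\<^bsub>A\<^esub> (w \<otimes>\<^bsub>A\<^esub> s)"
      unfolding v(2) using cs by (simp add: m_ac)
    finally show ?thesis
      using S[OF S[OF u(1) v(1)] c(2)] fraction_iff[OF A P h(1,2) c(3,4)] by blast
  qed
  have c: "y \<in> carrier A" "t \<in> carrier A - P" using y unfolding fraction_def by auto
  obtain u where u: "u \<in> carrier A - P" "u \<otimes>\<^bsub>A\<^esub> (x \<otimes>\<^bsub>A\<^esub> t) = u \<otimes>\<^bsub>A\<^esub> (y \<otimes>\<^bsub>A\<^esub> s)"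
    using y fraction_iff[OF A P x c] by auto
  then have "(x, s) \<in> fraction A P y t"
    using fraction_iff[OF A P c x] by metis
  then show ?thesis
    using trans[OF x y] trans[OF c, of x s] by auto
qed

lemma fraction_self:
  assumes A: "cring A" and P: "primeideal P A" and x: "x \<in> carrier A" "s \<in> carrier A - P"
  shows "(x, s) \<in> fraction A P x s"
proof -
  interpret P: primeideal P A by (rule P)
  have "\<exists>u. u \<in> carrier A - P"
    using x by blast
  then show ?thesis
    using fraction_iff[OF A P x x] by blast
qed

lemma UN_pairs_const:
  assumes "(x, s) \<in> p" "(y, t) \<in> q"
    and "\<And>x' s' y' t'. (x', s') \<in> p \<Longrightarrow> (y', t') \<in> q \<Longrightarrow> f x' s' y' t' = C"
  shows "(\<Union>(x', s')\<in>p. \<Union>(y', t')\<in>q. f x' s' y' t') = C"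
proof
  show "(\<Union>(x', s')\<in>p. \<Union>(y', t')\<in>q. f x' s' y' t') \<subseteq> C"
    using assms(3) by blast
  show "C \<subseteq> (\<Union>(x', s')\<in>p. \<Union>(y', t')\<in>q. f x' s' y' t')"
    using assms(1,2) assms(3)[OF assms(1,2)] by blast
qed

lemma localization_mult:
  assumes A: "cring A" and P: "primeideal P A"
    and x: "x \<in> carrier A" "s \<in> carrier A - P" and y: "y \<in> carrier A" "t \<in> carrier A - P"
  shows "fraction A P x s \<otimes>\<^bsub>localization A P\<^esub> fraction A P y t =
    fraction A P (x \<otimes>\<^bsub>A\<^esub> y) (s \<otimes>\<^bsub>A\<^esub> t)"
proof -
  interpret cring A by (rule A)
  interpret P: primeideal P A by (rule P)
  have S: "u \<otimes>\<^bsub>A\<^esub> v \<in> carrier A - P" if "u \<in> carrier A - P" "v \<in> carrier A - P" for u v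
    using that P.I_prime[of u v] by auto
  have "fraction A P (x' \<otimes>\<^bsub>A\<^esub> y') (s' \<otimes>\<^bsub>A\<^esub> t') = fraction A P (x \<otimes>\<^bsub>A\<^esub> y) (s \<otimes>\<^bsub>A\<^esub> t)"
    if x': "(x', s') \<in> fraction A P x s" and y': "(y', t') \<in> fraction A P y t" for x' s' y' t'
  proof -
    have c: "x' \<in> carrier A" "s' \<in> carrier A - P" "y' \<in> carrier A" "t' \<in> carrier A - P"
      using x' y' unfolding fraction_def by auto
    obtain u where u: "u \<in> carrier A - P" "u \<otimes>\<^bsub>A\<^esub> (x \<otimes>\<^bsub>A\<^esub> s') = u \<otimes>\<^bsub>A\<^esub> (x' \<otimes>\<^bsub>A\<^esub> s)"
      using x' fraction_iff[OF A P x c(1,2)] by auto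
    obtain v where v: "v \<in> carrier A - P" "v \<otimes>\<^bsub>A\<^esub> (y \<otimes>\<^bsub>A\<^esub> t') = v \<otimes>\<^bsub>A\<^esub> (y' \<otimes>\<^bsub>A\<^esub> t)"
      using y' fraction_iff[OF A P y c(3,4)] by auto
    note cs = c(1,3) x(1) y(1) c(2,4)[THEN DiffD1] u(1)[THEN DiffD1] v(1)[THEN DiffD1]
      x(2)[THEN DiffD1] y(2)[THEN DiffD1]
    have "(u \<otimes>\<^bsub>A\<^esub> v) \<otimes>\<^bsub>A\<^esub> ((x \<otimes>\<^bsub>A\<^esub> y) \<otimes>\<^bsub>A\<^esub> (s' \<otimes>\<^bsub>A\<^esub> t')) = (u \<otimes>\<^bsub>A\<^esub> (x \<otimes>\<^bsub>A\<^esub> s')) \<otimes>\<^bsub>A\<^esub> (v \<otimes>\<^bsub>A\<^esub> (y \<otimes>\<^bsub>A\<^esub> t'))"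
      using cs by (simp add: m_ac)
    also have "\<dots> = (u \<otimes>\<^bsub>A\<^esub> v) \<otimes>\<^bsub>A\<^esub> ((x' \<otimes>\<^bsub>A\<^esub> y') \<otimes>\<^bsub>A\<^esub> (s \<otimes>\<^bsub>A\<^esub> t))"
      unfolding u(2) v(2) using cs by (simp add: m_ac)
    finally have "(u \<otimes>\<^bsub>A\<^esub> v) \<otimes>\<^bsub>A\<^esub> ((x \<otimes>\<^bsub>A\<^esub> y) \<otimes>\<^bsub>A\<^esub> (s' \<otimes>\<^bsub>A\<^esub> t')) = (u \<otimes>\<^bsub>A\<^esub> v) \<otimes>\<^bsub>A\<^esub> ((x' \<otimes>\<^bsub>A\<^esub> y') \<otimes>\<^bsub>A\<^esub> (s \<otimes>\<^bsub>A\<^esub> t))" .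
    then have "(x' \<otimes>\<^bsub>A\<^esub> y', s' \<otimes>\<^bsub>A\<^esub> t') \<in> fraction A P (x \<otimes>\<^bsub>A\<^esub> y) (s \<otimes>\<^bsub>A\<^esub> t)"
      using S[OF u(1) v(1)] S[OF c(2,4)] S[OF x(2) y(2)] cs
      by (subst fraction_iff[OF A P]) auto
    then show ?thesis
      using S[OF x(2) y(2)] cs by (intro fraction_cong[OF A P]) auto
  qed
  then show ?thesis
    unfolding localization_def
    by (simp add: UN_pairs_const[OF fraction_self[OF A P x] fraction_self[OF A P y]])
qed

lemma localization_add:
  assumes A: "cring A" and P: "primeideal P A"
    and x: "x \<in> carrier A" "s \<in> carrier A - P" and y: "y \<in> carrier A" "t \<in> carrier A - P"
  shows "fraction A P x s \<oplus>\<^bsub>localization A P\<^esub> fraction A P y t =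
    fraction A P (x \<otimes>\<^bsub>A\<^esub> t \<oplus>\<^bsub>A\<^esub> y \<otimes>\<^bsub>A\<^esub> s) (s \<otimes>\<^bsub>A\<^esub> t)"
proof -
  interpret cring A by (rule A)
  interpret P: primeideal P A by (rule P)
  have S: "u \<otimes>\<^bsub>A\<^esub> v \<in> carrier A - P" if "u \<in> carrier A - P" "v \<in> carrier A - P" for u v
    using that P.I_prime[of u v] by auto
  have "fraction A P (x' \<otimes>\<^bsub>A\<^esub> t' \<oplus>\<^bsub>A\<^esub> y' \<otimes>\<^bsub>A\<^esub> s') (s' \<otimes>\<^bsub>A\<^esub> t') = fraction A P (x \<otimes>\<^bsub>A\<^esub> t \<oplus>\<^bsub>A\<^esub> y \<otimes>\<^bsub>A\<^esub> s) (s \<otimes>\<^bsub>A\<^esub> t)"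
    if x': "(x', s') \<in> fraction A P x s" and y': "(y', t') \<in> fraction A P y t" for x' s' y' t'
  proof -
    have c: "x' \<in> carrier A" "s' \<in> carrier A - P" "y' \<in> carrier A" "t' \<in> carrier A - P"
      using x' y' unfolding fraction_def by auto
    obtain u where u: "u \<in> carrier A - P" "u \<otimes>\<^bsub>A\<^esub> (x \<otimes>\<^bsub>A\<^esub> s') = u \<otimes>\<^bsub>A\<^esub> (x' \<otimes>\<^bsub>A\<^esub> s)"
      using x' fraction_iff[OF A P x c(1,2)] by auto
    obtain v where v: "v \<in> carrier A - P" "v \<otimes>\<^bsub>A\<^esub> (y \<otimes>\<^bsub>A\<^esub> t') = v \<otimes>\<^bsub>A\<^esub> (y' \<otimes>\<^bsub>A\<^esub> t)"
      using y' fraction_iff[OF A P y c(3,4)] by auto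
    note cs = c(1,3) x(1) y(1) c(2,4)[THEN DiffD1] u(1)[THEN DiffD1] v(1)[THEN DiffD1]
      x(2)[THEN DiffD1] y(2)[THEN DiffD1]
    have "(u \<otimes>\<^bsub>A\<^esub> v) \<otimes>\<^bsub>A\<^esub> ((x \<otimes>\<^bsub>A\<^esub> t \<oplus>\<^bsub>A\<^esub> y \<otimes>\<^bsub>A\<^esub> s) \<otimes>\<^bsub>A\<^esub> (s' \<otimes>\<^bsub>A\<^esub> t')) =
        (u \<otimes>\<^bsub>A\<^esub> (x \<otimes>\<^bsub>A\<^esub> s')) \<otimes>\<^bsub>A\<^esub> (v \<otimes>\<^bsub>A\<^esub> t \<otimes>\<^bsub>A\<^esub> t') \<oplus>\<^bsub>A\<^esub> (v \<otimes>\<^bsub>A\<^esub> (y \<otimes>\<^bsub>A\<^esub> t')) \<otimes>\<^bsub>A\<^esub> (u \<otimes>\<^bsub>A\<^esub> s \<otimes>\<^bsub>A\<^esub> s')"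
      using cs by (simp add: l_distr r_distr m_ac)
    also have "\<dots> = (u \<otimes>\<^bsub>A\<^esub> v) \<otimes>\<^bsub>A\<^esub> ((x' \<otimes>\<^bsub>A\<^esub> t' \<oplus>\<^bsub>A\<^esub> y' \<otimes>\<^bsub>A\<^esub> s') \<otimes>\<^bsub>A\<^esub> (s \<otimes>\<^bsub>A\<^esub> t))"
      unfolding u(2) v(2) using cs by (simp add: l_distr r_distr m_ac)
    finally have "(u \<otimes>\<^bsub>A\<^esub> v) \<otimes>\<^bsub>A\<^esub> ((x \<otimes>\<^bsub>A\<^esub> t \<oplus>\<^bsub>A\<^esub> y \<otimes>\<^bsub>A\<^esub> s) \<otimes>\<^bsub>A\<^esub> (s' \<otimes>\<^bsub>A\<^esub> t')) =
        (u \<otimes>\<^bsub>A\<^esub> v) \<otimes>\<^bsub>A\<^esub> ((x' \<otimes>\<^bsub>A\<^esub> t' \<oplus>\<^bsub>A\<^esub> y' \<otimes>\<^bsub>A\<^esub> s') \<otimes>\<^bsub>A\<^esub> (s \<otimes>\<^bsub>A\<^esub> t))" .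
    then have "(x' \<otimes>\<^bsub>A\<^esub> t' \<oplus>\<^bsub>A\<^esub> y' \<otimes>\<^bsub>A\<^esub> s', s' \<otimes>\<^bsub>A\<^esub> t') \<in> fraction A P (x \<otimes>\<^bsub>A\<^esub> t \<oplus>\<^bsub>A\<^esub> y \<otimes>\<^bsub>A\<^esub> s) (s \<otimes>\<^bsub>A\<^esub> t)"
      using S[OF u(1) v(1)] S[OF c(2,4)] S[OF x(2) y(2)] cs
      by (subst fraction_iff[OF A P]) auto
    then show ?thesis
      using S[OF x(2) y(2)] cs by (intro fraction_cong[OF A P]) auto
  qed
  then show ?thesis
    unfolding localization_def
    by (simp add: UN_pairs_const[OF fraction_self[OF A P x] fraction_self[OF A P y]])
qed

definition local_ring :: "('a, 'm) ring_scheme \<Rightarrow> bool" where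
  "local_ring A \<longleftrightarrow> cring A \<and> (\<exists>!M. maximalideal M A)"

definition max_ideal :: "('a, 'm) ring_scheme \<Rightarrow> 'a set" where
  "max_ideal A = (THE M. maximalideal M A)"

definition socle :: "('a, 'm) ring_scheme \<Rightarrow> 'a set" where
  "socle A = {x \<in> carrier A. \<forall>y \<in> max_ideal A. x \<otimes>\<^bsub>A\<^esub> y = \<zero>\<^bsub>A\<^esub>}"

definition regular_sequence :: "('a, 'm) ring_scheme \<Rightarrow> 'a list \<Rightarrow> bool" where
  "regular_sequence A xs \<longleftrightarrow> set xs \<subseteq> carrier A \<and> Idl\<^bsub>A\<^esub> (set xs) \<noteq> carrier A \<and>
     (\<forall>i < length xs. \<forall>y \<in> carrier A.
        y \<otimes>\<^bsub>A\<^esub> xs ! i \<in> Idl\<^bsub>A\<^esub> (set (take i xs)) \<longrightarrow> y \<in> Idl\<^bsub>A\<^esub> (set (take i xs)))"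

text \<open>
  A zero-dimensional Noetherian local ring is Gorenstein if its socle is a simple module.
  A Noetherian local ring is Gorenstein if it is Cohen--Macaulay and becomes zero-dimensional
  Gorenstein modulo a maximal regular sequence; that the quotient is zero-dimensional subsumes
  the Cohen--Macaulay property. A Noetherian ring is Gorenstein if its localizations at maximal
  ideals are.
\<close>

definition zero_dim_gorenstein :: "('a, 'm) ring_scheme \<Rightarrow> bool" where
  "zero_dim_gorenstein A \<longleftrightarrow> noetherian_ring A \<and> local_ring A \<and>
     (\<forall>P. primeideal P A \<longrightarrow> P = max_ideal A) \<and>
     socle A \<noteq> {\<zero>\<^bsub>A\<^esub>} \<and>
     (\<forall>J. ideal J A \<and> J \<subseteq> socle A \<longrightarrow> J = {\<zero>\<^bsub>A\<^esub>} \<or> J = socle A)"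

definition gorenstein_local :: "('a, 'm) ring_scheme \<Rightarrow> bool" where
  "gorenstein_local A \<longleftrightarrow> noetherian_ring A \<and> local_ring A \<and>
     (\<exists>xs. regular_sequence A xs \<and> zero_dim_gorenstein (A Quot (Idl\<^bsub>A\<^esub> (set xs))))"

definition gorenstein_ring :: "('a, 'm) ring_scheme \<Rightarrow> bool" where
  "gorenstein_ring A \<longleftrightarrow> noetherian_ring A \<and> cring A \<and>
     (\<forall>M. maximalideal M A \<longrightarrow> gorenstein_local (localization A M))"


section \<open>Polynomials and the action by differentiation\<close>

text \<open>
  Polynomials over \<open>'k\<close> in the variables indexed by a finite type \<open>'v\<close>. The type serves both for
  \<open>R\<close> and for \<open>\<Gamma>\<close>.
\<close>

type_synonym ('v, 'k) mpoly = "('v \<Rightarrow>\<^sub>0 nat) \<Rightarrow>\<^sub>0 'k"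

definition scal :: "'k::comm_ring_1 \<Rightarrow> ('v, 'k) mpoly \<Rightarrow> ('v, 'k) mpoly" where
  "scal c f = Poly_Mapping.map ((*) c) f"

definition linear_form :: "('v::finite \<Rightarrow> 'k::comm_ring_1) \<Rightarrow> ('v, 'k) mpoly" where
  "linear_form c = (\<Sum>v\<in>UNIV. Poly_Mapping.single (Poly_Mapping.single v 1) (c v))"

definition homogeneous :: "nat \<Rightarrow> ('v::finite, 'k::zero) mpoly \<Rightarrow> bool" where
  "homogeneous d f \<longleftrightarrow> (\<forall>m \<in> Poly_Mapping.keys f. (\<Sum>v\<in>UNIV. Poly_Mapping.lookup m v) = d)"

definition eval_at :: "('v::finite, 'k::comm_ring_1) mpoly \<Rightarrow> ('v \<Rightarrow> 'k) \<Rightarrow> 'k" where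
  "eval_at f p = (\<Sum>m \<in> Poly_Mapping.keys f.
     Poly_Mapping.lookup f m * (\<Prod>v\<in>UNIV. p v ^ Poly_Mapping.lookup m v))"

text \<open>
  The operator \<open>\<Prod>\<^sub>v \<partial>\<^sub>v\<^bsup>m v\<^esup>\<close>: it sends \<open>y\<^bsup>k\<^esup>\<close> to
  \<open>\<Prod>\<^sub>v k\<^sub>v (k\<^sub>v - 1) \<cdots> (k\<^sub>v - m\<^sub>v + 1)\<close> times \<open>y\<^bsup>k - m\<^esup>\<close>. The subtraction is the truncated one of
  the natural numbers, so that the coefficient vanishes unless \<open>m \<le> k\<close>.
\<close>

definition diff_coeff :: "('v::finite \<Rightarrow>\<^sub>0 nat) \<Rightarrow> ('v \<Rightarrow>\<^sub>0 nat) \<Rightarrow> nat" where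
  "diff_coeff m k = (\<Prod>v\<in>UNIV. \<Prod>j<Poly_Mapping.lookup m v. Poly_Mapping.lookup k v - j)"

definition diff_monom :: "('v::finite \<Rightarrow>\<^sub>0 nat) \<Rightarrow> ('v, 'k::comm_ring_1) mpoly \<Rightarrow> ('v, 'k) mpoly" where
  "diff_monom m g = (\<Sum>k \<in> Poly_Mapping.keys g.
     Poly_Mapping.single (k - m) (of_nat (diff_coeff m k) * Poly_Mapping.lookup g k))"

definition diff_act ::
  "('v::finite, 'k::comm_ring_1) mpoly \<Rightarrow> ('v, 'k) mpoly \<Rightarrow> ('v, 'k) mpoly" (infixr \<open>\<diamondop>\<close> 75) where
  "f \<diamondop> g = (\<Sum>m \<in> Poly_Mapping.keys f. scal (Poly_Mapping.lookup f m) (diff_monom m g))"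

lemma lookup_scal: "Poly_Mapping.lookup (scal c f) m = c * Poly_Mapping.lookup f m"
  unfolding scal_def by (simp add: Poly_Mapping.map.rep_eq when_def)

lemma vector_space_scal: "vector_space (scal :: 'k::field \<Rightarrow> ('v, 'k) mpoly \<Rightarrow> _)"
  by unfold_locales (auto intro!: poly_mapping_eqI simp: lookup_scal lookup_add algebra_simps)

lemma module_mult: "Modules.module ((*) :: 'a::comm_ring_1 \<Rightarrow> _)"
  by unfold_locales (auto simp: algebra_simps)

lemma diff_coeff_eq_0:
  assumes "\<not> Poly_Mapping.lookup m v \<le> Poly_Mapping.lookup k v"
  shows "diff_coeff m k = 0"
proof -
  have "(\<Prod>j<Poly_Mapping.lookup m v. Poly_Mapping.lookup k v - j) = 0"
    using assms by (intro prod_zero bexI[of _ "Poly_Mapping.lookup k v"]) auto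
  then show ?thesis
    unfolding diff_coeff_def by (intro prod_zero) auto
qed

lemma lookup_diff_monom:
  "Poly_Mapping.lookup (diff_monom m g) k =
     of_nat (diff_coeff m (k + m)) * Poly_Mapping.lookup g (k + m)"
proof -
  have "Poly_Mapping.lookup (diff_monom m g) k =
    (\<Sum>l \<in> Poly_Mapping.keys g.
      (of_nat (diff_coeff m l) * Poly_Mapping.lookup g l when l - m = k))"
    unfolding diff_monom_def by (simp add: lookup_sum lookup_single)
  also have "\<dots> = (\<Sum>l \<in> Poly_Mapping.keys g.
      if l = k + m then of_nat (diff_coeff m (k + m)) * Poly_Mapping.lookup g (k + m) else 0)"
  proof (rule sum.cong[OF refl])
    fix l
    show "(of_nat (diff_coeff m l) * Poly_Mapping.lookup g l when l - m = k) =
      (if l = k + m then of_nat (diff_coeff m (k + m)) * Poly_Mapping.lookup g (k + m) else 0)"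
    proof (cases "\<forall>v. Poly_Mapping.lookup m v \<le> Poly_Mapping.lookup l v")
      case True
      then have "l - m = k \<longleftrightarrow> l = k + m"
        by (auto simp: poly_mapping_eq_iff fun_eq_iff lookup_minus lookup_add)
          (metis le_add_diff_inverse2)
      then show ?thesis by simp
    next
      case False
      then obtain v where v: "\<not> Poly_Mapping.lookup m v \<le> Poly_Mapping.lookup l v" by blast
      then have "l \<noteq> k + m" by (auto simp: lookup_add)
      then show ?thesis using diff_coeff_eq_0[OF v] by simp
    qed
  qed
  also have "\<dots> = of_nat (diff_coeff m (k + m)) * Poly_Mapping.lookup g (k + m)"
    by (simp add: sum.delta in_keys_iff)
  finally show ?thesis .
qed

lemma diff_monom_variable:
  fixes g :: "('v::finite, 'k::comm_ring_1) mpoly"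
  shows "diff_monom (Poly_Mapping.single v 1) g = (\<Sum>k \<in> Poly_Mapping.keys g.
    Poly_Mapping.single (k - Poly_Mapping.single v 1)
      (of_nat (Poly_Mapping.lookup k v) * Poly_Mapping.lookup g k))"
proof -
  have "diff_coeff (Poly_Mapping.single v 1) k = Poly_Mapping.lookup k v"
    for k :: "'v \<Rightarrow>\<^sub>0 nat"
  proof -
    have "diff_coeff (Poly_Mapping.single v 1) k =
        (\<Prod>w\<in>UNIV. if w = v then Poly_Mapping.lookup k v else 1)"
      unfolding diff_coeff_def by (intro prod.cong) (auto simp: lookup_single when_def)
    then show ?thesis by simp
  qed
  then show ?thesis unfolding diff_monom_def by simp
qed

lemma diff_coeff_add:
  "diff_coeff (l + m) (k + (l + m)) = diff_coeff l (k + l) * diff_coeff m (k + l + m)"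
proof -
  have "(\<Prod>j<p + q. (r + (p + q)) - j) = (\<Prod>j<p. (r + p) - j) * (\<Prod>j<q. (r + p + q) - j)"
    for p q r :: nat
  proof -
    have "(\<Prod>j<p + q. h j) = (\<Prod>j<q. h j) * (\<Prod>j<p. h (q + j))" for h :: "nat \<Rightarrow> nat"
      by (induction p) (simp_all add: algebra_simps)
    then show ?thesis by (simp add: algebra_simps)
  qed
  then show ?thesis
    unfolding diff_coeff_def by (simp add: lookup_add prod.distrib)
qed

lemma diff_monom_add: "diff_monom (l + m) g = diff_monom l (diff_monom m g)"
  by (rule poly_mapping_eqI)
    (simp add: lookup_diff_monom diff_coeff_add algebra_simps)

lemma lookup_diff_act:
  "Poly_Mapping.lookup (f \<diamondop> g) k = (\<Sum>m \<in> Poly_Mapping.keys f. Poly_Mapping.lookup f m *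
     (of_nat (diff_coeff m (k + m)) * Poly_Mapping.lookup g (k + m)))"
  unfolding diff_act_def by (simp add: lookup_sum lookup_scal lookup_diff_monom)

lemma diff_act_add_left: "(f + f') \<diamondop> g = f \<diamondop> g + f' \<diamondop> g"
  unfolding diff_act_def
  by (rule setsum_keys_plus_distrib)
    (auto intro!: poly_mapping_eqI simp: lookup_scal lookup_add algebra_simps)

lemma diff_act_add_right: "f \<diamondop> (g + g') = f \<diamondop> g + f \<diamondop> g'"
  by (rule poly_mapping_eqI)
    (simp add: lookup_diff_act lookup_add algebra_simps sum.distrib)

lemma diff_act_0_left: "0 \<diamondop> g = 0"
  by (simp add: diff_act_def)

lemma diff_act_0_right: "f \<diamondop> 0 = 0"
  by (rule poly_mapping_eqI) (simp add: lookup_diff_act)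

lemma diff_act_sum_left: "(\<Sum>i\<in>S. f i) \<diamondop> g = (\<Sum>i\<in>S. f i \<diamondop> g)"
  by (induction S rule: infinite_finite_induct) (simp_all add: diff_act_0_left diff_act_add_left)

lemma diff_act_sum_right: "f \<diamondop> (\<Sum>i\<in>S. g i) = (\<Sum>i\<in>S. f \<diamondop> g i)"
  by (induction S rule: infinite_finite_induct) (simp_all add: diff_act_0_right diff_act_add_right)

lemma diff_act_single: "Poly_Mapping.single m c \<diamondop> g = scal c (diff_monom m g)"
  by (cases "c = 0") (auto intro!: poly_mapping_eqI simp: diff_act_def lookup_scal)

lemma mpoly_eq_sum_single:
  "f = (\<Sum>m \<in> Poly_Mapping.keys f. Poly_Mapping.single m (Poly_Mapping.lookup f m))"
  by (rule poly_mapping_eqI)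
    (simp add: lookup_sum lookup_single when_def sum.delta in_keys_iff)

lemma diff_act_mult: "(f * f') \<diamondop> g = f \<diamondop> (f' \<diamondop> g)"
proof -
  have *: "(Poly_Mapping.single l c * Poly_Mapping.single m d) \<diamondop> g =
      Poly_Mapping.single l c \<diamondop> (Poly_Mapping.single m d \<diamondop> g)" for l m c d
    by (rule poly_mapping_eqI)
      (simp add: mult_single diff_act_single diff_monom_add lookup_scal lookup_diff_monom
        algebra_simps)
  let ?s = "\<lambda>f m. Poly_Mapping.single m (Poly_Mapping.lookup f m)"
  have "(f * f') \<diamondop> g =
      ((\<Sum>m \<in> Poly_Mapping.keys f. ?s f m) * (\<Sum>m \<in> Poly_Mapping.keys f'. ?s f' m)) \<diamondop> g"
    by (simp only: mpoly_eq_sum_single[symmetric])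
  also have "\<dots> = (\<Sum>l \<in> Poly_Mapping.keys f. \<Sum>m \<in> Poly_Mapping.keys f'.
      ?s f l \<diamondop> (?s f' m \<diamondop> g))"
    by (simp add: sum_product diff_act_sum_left *)
  also have "\<dots> = (\<Sum>l \<in> Poly_Mapping.keys f. ?s f l) \<diamondop>
      ((\<Sum>m \<in> Poly_Mapping.keys f'. ?s f' m) \<diamondop> g)"
    by (simp add: diff_act_sum_left diff_act_sum_right) (rule sum.swap)
  also have "\<dots> = f \<diamondop> (f' \<diamondop> g)"
    by (simp only: mpoly_eq_sum_single[symmetric])
  finally show ?thesis .
qed

lemma diff_act_one: "1 \<diamondop> g = g"
  by (rule poly_mapping_eqI)
    (simp add: lookup_diff_act diff_coeff_def)

lemma module_diff_act:
  "Modules.module ((\<diamondop>) :: ('v::finite, 'k::comm_ring_1) mpoly \<Rightarrow> _)"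
  by unfold_locales (simp_all add: diff_act_add_left diff_act_add_right diff_act_mult diff_act_one)

abbreviation ideal_gen :: "('v, 'k::comm_ring_1) mpoly set \<Rightarrow> ('v, 'k) mpoly set" where
  "ideal_gen \<equiv> Modules.module.span (*)"

abbreviation submod :: "('v::finite, 'k::comm_ring_1) mpoly set \<Rightarrow> ('v, 'k) mpoly set" where
  "submod \<equiv> Modules.module.span (\<diamondop>)"

abbreviation kdim :: "('v, 'k::field) mpoly set \<Rightarrow> nat" where
  "kdim \<equiv> vector_space.dim scal"

definition perp :: "('v::finite, 'k::comm_ring_1) mpoly set \<Rightarrow> ('v, 'k) mpoly set" where
  "perp I = {G. \<forall>f \<in> I. f \<diamondop> G = 0}"

definition Ann :: "('v::finite, 'k::comm_ring_1) mpoly set \<Rightarrow> ('v, 'k) mpoly set" where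
  "Ann W = {g. \<forall>G \<in> W. g \<diamondop> G = 0}"

definition G_admissible ::
  "('v::finite, 'k::comm_ring_1) mpoly \<Rightarrow> (nat \<Rightarrow> ('v, 'k) mpoly) \<Rightarrow> bool" where
  "G_admissible z F \<longleftrightarrow>
     (\<forall>t>1. z \<diamondop> F t = F (t - 1)) \<and> z \<diamondop> F 1 = 0 \<and>
     (\<forall>t\<ge>1. {g \<diamondop> F (t + 1) | g. g \<in> Ann (submod {F t})} = submod {F 1})"


section \<open>Sets of points in projective space\<close>

text \<open>
  The point \<open>[p]\<close> is the set of all its vectors of homogeneous coordinates; this is a point of
  projective space only if \<open>p \<noteq> 0\<close>.
\<close>

definition proj_point :: "('v \<Rightarrow> 'k::field) \<Rightarrow> ('v \<Rightarrow> 'k) set" where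
  "proj_point p = {\<lambda>v. c * p v | c. c \<noteq> 0}"

definition vanishes_on ::
  "('v::finite, 'k::field) mpoly \<Rightarrow> ('v \<Rightarrow> 'k) set set \<Rightarrow> bool" where
  "vanishes_on f pts \<longleftrightarrow> (\<forall>P \<in> pts. \<forall>p \<in> P. eval_at f p = 0)"

definition in_hyperplane :: "('v::finite \<Rightarrow> 'k::field) set set \<Rightarrow> bool" where
  "in_hyperplane pts \<longleftrightarrow> (\<exists>c. c \<noteq> (\<lambda>_. 0) \<and> vanishes_on (linear_form c) pts)"

definition vanishing_ideal ::
  "('v::finite \<Rightarrow> 'k::field) set set \<Rightarrow> ('v, 'k) mpoly set" where
  "vanishing_ideal pts = ideal_gen {f. (\<exists>d. homogeneous d f) \<and> vanishes_on f pts}"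

definition arith_gorenstein :: "('v::finite \<Rightarrow> 'k::field) set set \<Rightarrow> bool" where
  "arith_gorenstein pts \<longleftrightarrow>
     gorenstein_ring ((ring_of_type_algebra :: ('v, 'k) mpoly ring) Quot vanishing_ideal pts)"

text \<open>
  \<open>dim (R/I)\<^sub>t = dim R\<^sub>t - dim I\<^sub>t\<close>, both being finite. The first difference uses \<open>HF (-1) = 0\<close>.
\<close>

definition HF :: "('v::finite \<Rightarrow> 'k::field) set set \<Rightarrow> nat \<Rightarrow> int" where
  "HF pts t = int (kdim {f::('v, 'k) mpoly. homogeneous t f})
          - int (kdim {f \<in> vanishing_ideal pts. homogeneous t f})"

definition HF_diff :: "('v::finite \<Rightarrow> 'k::field) set set \<Rightarrow> nat \<Rightarrow> int" where
  "HF_diff pts t = HF pts t - (if t = 0 then 0 else HF pts (t - 1))"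

definition socle_degree :: "('v::finite \<Rightarrow> 'k::field) set set \<Rightarrow> nat" where
  "socle_degree pts = (GREATEST t. HF_diff pts t \<noteq> 0)"

end

theory Submission
  imports Defs "HOL-Library.Function_Algebras"
begin

text \<open>
  Scale the coordinates so that \<open>z(P\<^sub>i) = 1\<close>. The values on \<open>X\<close> of the forms of degree \<open>t\<close> then form an
  increasing filtration \<open>V\<^sub>0 \<subseteq> V\<^sub>1 \<subseteq> \<dots>\<close> of \<open>k\<^sup>r\<close> with \<open>dim V\<^sub>t = HF\<^sub>X(t)\<close>, and \<open>s\<close> is the first index
  with \<open>V\<^sub>s = k\<^sup>r\<close>. The Artinian reduction \<open>R/Q\<close> with \<open>Q = I(X) + (z)\<close> is the associated graded space, so
  it has dimension \<open>r\<close> and top degree \<open>s\<close>.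

  A linear combination \<open>F\<close> of the \<open>L\<^sub>i\<^sup>s\<close> is a functional on \<open>k\<^sup>r\<close>. Condition (a) says that it vanishes on
  \<open>V\<^sub>s\<^sub>-\<^sub>1\<close>, equivalently that \<open>Q\<close> annihilates \<open>F\<close>, and then (b) says that the annihilator of \<open>F\<close> is exactly
  \<open>Q\<close>. Since differentiation pairs \<open>R\<close> and \<open>\<Gamma>\<close> perfectly, such an \<open>F\<close> exists if and only if the socle
  of \<open>R/Q\<close> is one-dimensional; the remaining assertions follow from \<open>Ann F\<^sub>t = I(X) + (z\<^sup>t)\<close>.

  For the Gorenstein property, every maximal ideal of \<open>R/I(X)\<close> belongs to a point of one of the \<open>r\<close>
  lines of the cone over \<open>X\<close>. Away from the vertex the local ring is a discrete valuation ring. At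
  the vertex it has depth one, and for non-zero-divisors \<open>x\<close>, \<open>y\<close> of the maximal ideal \<open>m\<close> the relation
  \<open>a y = x b\<close> identifies \<open>(x : m)/(x)\<close> with \<open>(y : m)/(y)\<close>, so that the regular sequence may be taken to
  be \<open>z\<close>.
\<close>

section \<open>Restriction of polynomials to lines, and divided powers of linear forms\<close>

text \<open>The scaling \<open>z(P_i) = 1\<close> makes multiplication by \<open>z\<close> raise
  degrees without changing values. It also explains \<open>F_t\<close>: if \<open>M_i\<close> is the
  linear form of the scaled point, then \<open>L_i = z(P_i) M_i\<close>, and the summand of
  \<open>F_t\<close> is \<open>w_i M_i^(t+s-1) / (t+s-1)!\<close> with
  \<open>w_i = alpha_i z(P_i)^(s-1)\<close>, the same for all \<open>t\<close>. So the whole family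
  comes from one functional \<open>w\<close> on \<open>k^r\<close>: the constant term of
  \<open>f\<close> applied to \<open>F_t\<close> is the sum of the \<open>w_i f_d(P_i)\<close>,
  where \<open>f_d\<close> is the component of degree \<open>d = t+s-1\<close>.

  The obstacle is that the definition of Gorenstein speaks of localizations at all maximal ideals
  and of an unspecified regular sequence, none of it graded. Hence \<open>I(X)\<close>,
  \<open>Q\<close> and the socle of \<open>R/Q\<close> are handled through arbitrary polynomials as
  representatives, and the order of vanishing at the vertex takes the place of the degree.
  Denominators at the vertex can be removed modulo \<open>Q\<close>, because all polynomials of
  order greater than \<open>s\<close> lie in \<open>Q\<close>.\<close>

abbreviation (input) lookup where "lookup \<equiv> Poly_Mapping.lookup"
abbreviation (input) keys where "keys \<equiv> Poly_Mapping.keys"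
abbreviation (input) single where "single \<equiv> Poly_Mapping.single"

definition total_deg :: "('v::finite \<Rightarrow>\<^sub>0 nat) \<Rightarrow> nat" where
  "total_deg m = (\<Sum>v\<in>UNIV. lookup m v)"

definition monom_val :: "('v::finite \<Rightarrow> 'k::comm_ring_1) \<Rightarrow> ('v \<Rightarrow>\<^sub>0 nat) \<Rightarrow> 'k" where
  "monom_val p m = (\<Prod>v\<in>UNIV. p v ^ lookup m v)"

text \<open>
  \<open>line p f\<close> is the univariate polynomial \<open>f(t p)\<close>; its coefficient of \<open>t\<^sup>d\<close> is the value at \<open>p\<close> of the
  component of \<open>f\<close> of degree \<open>d\<close>.
\<close>

definition line :: "('v::finite \<Rightarrow> 'k::comm_ring_1) \<Rightarrow> ('v, 'k) mpoly \<Rightarrow> 'k poly" where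
  "line p f = (\<Sum>m\<in>keys f. monom (lookup f m * monom_val p m) (total_deg m))"

definition const :: "'k::comm_ring_1 \<Rightarrow> ('v, 'k) mpoly" where
  "const c = single 0 c"

lemma total_deg_add: "total_deg (m + m') = total_deg m + total_deg m'"
  by (simp add: total_deg_def lookup_add sum.distrib)

lemma total_deg_0 [simp]: "total_deg 0 = 0"
  by (simp add: total_deg_def)

lemma total_deg_single [simp]: "total_deg (single v n) = n"
  by (simp add: total_deg_def lookup_single when_def)

lemma total_deg_eq_0_iff: "total_deg m = 0 \<longleftrightarrow> m = 0"
  by (auto simp: total_deg_def intro!: poly_mapping_eqI)

lemma monom_val_add: "monom_val p (m + m') = monom_val p m * monom_val p m'"
  by (simp add: monom_val_def lookup_add prod.distrib power_add)

lemma monom_val_0 [simp]: "monom_val p 0 = 1"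
  by (simp add: monom_val_def)

lemma monom_val_single [simp]: "monom_val p (single v n) = p v ^ n"
proof -
  have "monom_val p (single v n) = (\<Prod>w\<in>UNIV. if w = v then p v ^ n else 1)"
    unfolding monom_val_def by (intro prod.cong) (auto simp: lookup_single when_def)
  then show ?thesis by simp
qed

lemma scal_eq_const_mult: "scal c f = const c * f"
  unfolding scal_def const_def by (rule mult_map_scale_conv_mult)

lemma scal_simps [simp]: "scal c 0 = 0" "scal 0 f = 0" "scal 1 f = f"
  "scal c (scal d f) = scal (c * d) f"
  by (auto intro!: poly_mapping_eqI simp: lookup_scal algebra_simps)

lemma scal_add_right: "scal c (f + g) = scal c f + scal c g"
  and scal_add_left: "scal (c + d) f = scal c f + scal d f"
  by (auto intro!: poly_mapping_eqI simp: lookup_scal lookup_add algebra_simps)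

lemma scal_sum_right: "scal c (sum f S) = (\<Sum>i\<in>S. scal c (f i))"
  by (induction S rule: infinite_finite_induct) (simp_all add: scal_add_right)

lemma scal_sum_left: "scal (sum c S) f = (\<Sum>i\<in>S. scal (c i) f)"
  by (induction S rule: infinite_finite_induct) (simp_all add: scal_add_left)

lemma scal_mult_left: "scal c f * g = scal c (f * g)"
  and scal_mult_right: "f * scal c g = scal c (f * g)"
  by (simp_all add: scal_eq_const_mult mult_ac)

lemma line_0 [simp]: "line p 0 = 0"
  by (simp add: line_def)

lemma line_single: "line p (single m c) = monom (c * monom_val p m) (total_deg m)"
  by (cases "c = 0") (simp_all add: line_def)

lemma line_add: "line p (f + g) = line p f + line p g"
  unfolding line_def
  by (rule setsum_keys_plus_distrib) (auto simp: algebra_simps add_monom)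

lemma line_uminus: "line p (- f) = - line p f"
  using line_add[of p f "- f"] by (simp add: eq_neg_iff_add_eq_0 add.commute)

lemma line_diff: "line p (f - g) = line p f - line p g"
  using line_add[of p f "- g"] by (simp add: line_uminus)

lemma line_sum: "line p (\<Sum>i\<in>S. f i) = (\<Sum>i\<in>S. line p (f i))"
  by (induction S rule: infinite_finite_induct) (simp_all add: line_add)

lemma line_1 [simp]: "line p 1 = 1"
  by (simp add: line_single flip: single_one)

lemma line_mult: "line p (f * g) = line p f * line p g"
proof -
  let ?s = "\<lambda>f m. single m (lookup f m)"
  have "line p (f * g) = line p ((\<Sum>m \<in> keys f. ?s f m) * (\<Sum>m \<in> keys g. ?s g m))"
    by (simp only: mpoly_eq_sum_single[symmetric])
  also have "\<dots> = (\<Sum>l \<in> keys f. \<Sum>m \<in> keys g. line p (?s f l) * line p (?s g m))"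
    by (simp add: sum_product line_sum mult_single line_single mult_monom monom_val_add
        total_deg_add algebra_simps)
  also have "\<dots> = line p (\<Sum>m \<in> keys f. ?s f m) * line p (\<Sum>m \<in> keys g. ?s g m)"
    by (simp add: line_sum sum_product)
  also have "\<dots> = line p f * line p g"
    by (simp only: mpoly_eq_sum_single[symmetric])
  finally show ?thesis .
qed

lemma line_power: "line p (f ^ n) = line p f ^ n"
  by (induction n) (simp_all add: line_mult)

lemma line_prod: "line p (\<Prod>i\<in>S. f i) = (\<Prod>i\<in>S. line p (f i))"
  by (induction S rule: infinite_finite_induct) (simp_all add: line_mult)

lemma line_const: "line p (const c) = [:c:]"
  by (simp add: const_def line_single monom_0)

lemma line_scal: "line p (scal c f) = smult c (line p f)"
  by (simp add: scal_eq_const_mult line_mult line_const)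

lemma line_linear_form: "line p (linear_form c) = monom (\<Sum>v\<in>UNIV. c v * p v) 1"
  by (simp add: linear_form_def line_sum line_single monom_sum)

lemma poly_line: "poly (line p f) c = eval_at f (\<lambda>v. c * p v)"
  unfolding line_def eval_at_def
  by (simp add: poly_sum poly_monom monom_val_def power_mult_distrib prod.distrib total_deg_def
      power_sum mult_ac)

lemma coeff_line: "coeff (line p f) d = (\<Sum>m\<in>{m\<in>keys f. total_deg m = d}. lookup f m * monom_val p m)"
proof -
  have "coeff (line p f) d = (\<Sum>m\<in>keys f. if total_deg m = d then lookup f m * monom_val p m else 0)"
    by (simp add: line_def coeff_sum)
  then show ?thesis by (simp add: sum.inter_filter)
qed

lemma coeff_line_0: "coeff (line p f) 0 = lookup f 0"
proof -
  have "{m\<in>keys f. total_deg m = 0} = (if lookup f 0 = 0 then {} else {0})"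
    by (auto simp: total_deg_eq_0_iff in_keys_iff)
  then show ?thesis by (simp add: coeff_line)
qed

section \<open>Homogeneous components\<close>

definition hom_part :: "nat \<Rightarrow> ('v::finite, 'k::comm_ring_1) mpoly \<Rightarrow> ('v, 'k) mpoly" where
  "hom_part d f = (\<Sum>m\<in>{m\<in>keys f. total_deg m = d}. single m (lookup f m))"

lemma lookup_hom_part: "lookup (hom_part d f) m = (lookup f m when total_deg m = d)"
  by (auto simp: hom_part_def lookup_sum lookup_single when_def in_keys_iff)

lemma hom_part_0 [simp]: "hom_part d 0 = 0"
  and hom_part_add: "hom_part d (f + g) = hom_part d f + hom_part d g"
  and hom_part_scal: "hom_part d (scal c f) = scal c (hom_part d f)"
  by (auto intro!: poly_mapping_eqI simp: lookup_hom_part lookup_add lookup_scal when_def)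

lemma homogeneous_iff: "homogeneous d f \<longleftrightarrow> (\<forall>m\<in>keys f. total_deg m = d)"
  by (simp add: homogeneous_def total_deg_def)

lemma homogeneous_hom_part: "homogeneous d (hom_part d f)"
  by (auto simp: homogeneous_iff lookup_hom_part in_keys_iff)

lemma line_homogeneous: 
  assumes "homogeneous d f"
  shows "line p f = monom (coeff (line p f) d) d"
  using assms by (auto simp: line_def homogeneous_iff coeff_sum monom_sum intro!: sum.cong)

lemma line_hom_part: "line p (hom_part d f) = monom (coeff (line p f) d) d"
  by (simp add: hom_part_def line_sum line_single coeff_line monom_sum)

lemma sum_hom_part: 
  assumes "\<forall>m\<in>keys f. total_deg m \<le> N"
  shows "(\<Sum>d\<le>N. hom_part d f) = f"
  using assms by (intro poly_mapping_eqI) (auto simp: lookup_sum lookup_hom_part when_def in_keys_iff)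

lemma total_deg_bounded: "\<exists>N. \<forall>m\<in>keys f. total_deg m \<le> N"
  by (rule exI[of _ "Max (total_deg ` keys f)"]) auto

lemma coeff_line_beyond:
  assumes "\<forall>m\<in>keys f. total_deg m \<le> N" "d > N"
  shows "coeff (line p f) d = 0"
proof -
  have "{m\<in>keys f. total_deg m = d} = {}" using assms by auto
  then show ?thesis by (simp only: coeff_line sum.empty)
qed

section \<open>Divided powers and the differentiation pairing\<close>

text \<open>The factor \<open>1 / fact N\<close> removes all multinomial coefficients from the
  action by differentiation; it is the origin of the factorials in \<open>F_t\<close>.\<close>

definition divpow :: "('v::finite \<Rightarrow> 'k::field_char_0) \<Rightarrow> nat \<Rightarrow> ('v, 'k) mpoly" where
  "divpow p N = scal (1 / fact N) (linear_form p ^ N)"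

text \<open>The case distinction guards against truncated subtraction: if \<open>v\<close> does not
  occur in \<open>k\<close>, then \<open>k - single v 1\<close> is \<open>k\<close> itself and no
  predecessor of it.\<close>

lemma lookup_linear_form_mult:
  fixes g :: "('v::finite, 'k::comm_ring_1) mpoly"
  shows
  "lookup (linear_form p * g) k =
     (\<Sum>v\<in>UNIV. if lookup k v = 0 then 0 else p v * lookup g (k - single v 1))"
proof -
  have "lookup (single (single v 1) (p v) * g) k =
      (if lookup k v = 0 then 0 else p v * lookup g (k - single v 1))" for v
  proof -
    have "single (single v 1) (p v) * g =
        (\<Sum>m\<in>keys g. single (single v 1 + m) (p v * lookup g m))"
      by (subst (1) mpoly_eq_sum_single[of g]) (simp add: sum_distrib_left mult_single)
    then have *: "lookup (single (single v 1) (p v) * g) k =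
        (\<Sum>m\<in>keys g. (p v * lookup g m when single v 1 + m = k))"
      by (simp add: lookup_sum lookup_single)
    show ?thesis
    proof (cases "lookup k v = 0")
      case True
      then have "single v 1 + m \<noteq> k" for m :: "'v \<Rightarrow>\<^sub>0 nat" by (auto simp: lookup_add)
      then show ?thesis using True unfolding * by simp
    next
      case False
      then have "single v 1 + m = k \<longleftrightarrow> m = k - single v 1" for m
        by (auto simp: poly_mapping_eq_iff fun_eq_iff lookup_minus lookup_add lookup_single when_def)
      then show ?thesis using False unfolding *
        by (simp add: when_def in_keys_iff)
    qed
  qed
  then show ?thesis
    by (simp add: linear_form_def sum_distrib_right lookup_sum)
qed

lemma divpow_Suc: "divpow p (Suc N) = scal (1 / of_nat (Suc N)) (linear_form p * divpow p N)"
  unfolding divpow_def by (simp add: scal_mult_right)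

text \<open>The multinomial theorem in the form \<open>p^k / k!\<close>. In the induction step the
  variable \<open>v\<close> contributes \<open>lookup k v\<close> times the expected value, and
  these factors add up to \<open>total_deg k = Suc N\<close>, which cancels the new
  denominator.\<close>

lemma lookup_divpow:
  fixes p :: "'v::finite \<Rightarrow> 'k::field_char_0"
  shows
  "lookup (divpow p N) k = (if total_deg k = N then monom_val p k / (\<Prod>v\<in>UNIV. fact (lookup k v)) else 0)"
proof (induction N arbitrary: k)
  case 0
  show ?case by (auto simp: divpow_def lookup_one when_def total_deg_eq_0_iff)
next
  case (Suc N)
  let ?P = "\<lambda>k. (\<Prod>v\<in>UNIV. fact (lookup k v)) :: 'k"
  have step: "(if lookup k v = 0 then 0 else p v * lookup (divpow p N) (k - single v 1)) =
    (if total_deg k = Suc N then of_nat (lookup k v) * (monom_val p k / ?P k) else 0)" for v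
  proof (cases "lookup k v = 0")
    case False
    define m where "m = k - single v 1"
    have k: "k = m + single v 1"
      using False by (auto simp: m_def poly_mapping_eq_iff fun_eq_iff lookup_minus lookup_add lookup_single when_def)
    have "?P k = (\<Prod>w\<in>UNIV. fact (lookup m w) * (if w = v then of_nat (lookup k v) else 1))"
      by (intro prod.cong) (auto simp: k lookup_add lookup_single when_def)
    then have P: "?P k = ?P m * of_nat (lookup k v)"
      by (simp add: prod.distrib)
    have "total_deg k = Suc (total_deg m)" "monom_val p k = monom_val p m * p v"
      by (simp_all add: k total_deg_add monom_val_add)
    then show ?thesis
      unfolding m_def[symmetric] using False by (simp add: Suc.IH P)
  qed simp
  have "lookup (divpow p (Suc N)) k = 1 / of_nat (Suc N) *
      (\<Sum>v\<in>UNIV. if total_deg k = Suc N then of_nat (lookup k v) * (monom_val p k / ?P k) else 0)"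
    unfolding divpow_Suc lookup_scal lookup_linear_form_mult step ..
  also have "(\<Sum>v\<in>UNIV. if total_deg k = Suc N then of_nat (lookup k v) * (monom_val p k / ?P k) else 0)
     = (if total_deg k = Suc N then of_nat (total_deg k) * (monom_val p k / ?P k) else 0)"
    unfolding total_deg_def of_nat_sum sum_distrib_right by simp
  also have "1 / of_nat (Suc N) * \<dots> = (if total_deg k = Suc N then monom_val p k / ?P k else 0)"
    by (simp del: of_nat_Suc)
  finally show ?case .
qed

text \<open>The falling factorial \<open>(k+m)! / k!\<close>, multiplied out so as to stay within
  the natural numbers.\<close>

lemma diff_coeff_fact: "diff_coeff m (k + m) * (\<Prod>v\<in>UNIV. fact (lookup k v)) = (\<Prod>v\<in>UNIV. fact (lookup (k + m) v))"
proof -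
  have "(\<Prod>j<m. k + m - j) * fact k = (fact (k + m) :: nat)" for k m :: nat
  proof (induction m)
    case (Suc m)
    have "(\<Prod>j<Suc m. k + Suc m - j) = (k + Suc m) * (\<Prod>j<m. k + m - j)"
      by (subst prod.lessThan_Suc_shift) simp
    then have "(\<Prod>j<Suc m. k + Suc m - j) * fact k = (k + Suc m) * ((\<Prod>j<m. k + m - j) * fact k)"
      by (simp only: mult.assoc)
    then show ?case unfolding Suc by simp
  qed simp
  then show ?thesis
    by (simp add: diff_coeff_def lookup_add flip: prod.distrib)
qed

lemma diff_coeff_self_pos: "diff_coeff m m \<noteq> 0"
  using diff_coeff_fact[of m 0] by (auto simp: prod_zero_iff)

text \<open>The falling factorial cancels against the factorials of the divided power; what remains
  of the monomial is its value at \<open>p\<close> and a shift of the exponent.\<close>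

lemma diff_monom_divpow:
  fixes p :: "'v::finite \<Rightarrow> 'k::field_char_0"
  shows
  "diff_monom m (divpow p N) = (if total_deg m \<le> N then scal (monom_val p m) (divpow p (N - total_deg m)) else 0)"
proof (rule poly_mapping_eqI)
  fix k
  let ?P = "\<lambda>k. (\<Prod>v\<in>UNIV. fact (lookup k v)) :: 'k"
  have "?P (k + m) = of_nat (diff_coeff m (k + m)) * ?P k"
    using arg_cong[OF diff_coeff_fact[of m k], of "of_nat :: nat \<Rightarrow> 'k"] by (simp add: of_nat_prod)
  moreover have "?P (k + m) \<noteq> 0" by (simp add: prod_zero_iff)
  ultimately have "of_nat (diff_coeff m (k + m)) / ?P (k + m) = 1 / ?P k"
    by (metis mult_cancel_left1 nonzero_divide_mult_cancel_left mult_zero_left)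
  then have "of_nat (diff_coeff m (k + m)) * (monom_val p (k + m) / ?P (k + m)) = monom_val p m * (monom_val p k / ?P k)"
    by (simp add: monom_val_add field_simps)
  then show "lookup (diff_monom m (divpow p N)) k =
      lookup (if total_deg m \<le> N then scal (monom_val p m) (divpow p (N - total_deg m)) else 0) k"
    by (auto simp: lookup_diff_monom lookup_divpow lookup_scal total_deg_add)
qed

text \<open>Sorting the monomials of \<open>f\<close> by degree shows that \<open>f\<close> acts on
  the divided powers of one linear form only through its restriction to the line.\<close>

lemma diff_act_divpow:
  "f \<diamondop> divpow p N = (\<Sum>d\<le>N. scal (coeff (line p f) d) (divpow p (N - d)))"
proof -
  have "f \<diamondop> divpow p N = (\<Sum>m\<in>keys f. \<Sum>d\<le>N. if total_deg m = d then scal (lookup f m * monom_val p m) (divpow p (N - d)) else 0)"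
    unfolding diff_act_def by (intro sum.cong) (auto simp: diff_monom_divpow)
  also have "\<dots> = (\<Sum>d\<le>N. \<Sum>m\<in>keys f. if total_deg m = d then scal (lookup f m * monom_val p m) (divpow p (N - d)) else 0)"
    by (rule sum.swap)
  also have "\<dots> = (\<Sum>d\<le>N. scal (coeff (line p f) d) (divpow p (N - d)))"
    by (intro sum.cong refl) (simp add: coeff_line scal_sum_left sum.inter_filter if_distrib[of "\<lambda>c. scal c _"] cong: if_cong)
  finally show ?thesis .
qed

lemma lookup_divpow_0: "lookup (divpow p N) 0 = (if N = 0 then 1 else 0)"
  by (simp add: lookup_divpow)

lemma lookup_0_diff_act_divpow: "lookup (f \<diamondop> divpow p N) 0 = coeff (line p f) N"
proof -
  have "lookup (f \<diamondop> divpow p N) 0 = (\<Sum>d\<le>N. if d = N then coeff (line p f) N else 0)"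
    unfolding diff_act_divpow lookup_sum lookup_scal lookup_divpow_0 by (intro sum.cong) auto
  then show ?thesis by simp
qed

lemma lookup_0_diff_act_single: "lookup (single m 1 \<diamondop> G) 0 = of_nat (diff_coeff m m) * lookup G m"
  by (simp add: diff_act_single lookup_scal lookup_diff_monom)

text \<open>Pairing with the monomial \<open>m\<close> gives \<open>m!\<close> times the coefficient
  of \<open>m\<close>, and \<open>m!\<close> is invertible in characteristic zero. Identities in the
  inverse system are proved below by comparing such pairings.\<close>

lemma diff_pairing_nondegenerate:
  fixes G :: "('v::finite, 'k::field_char_0) mpoly"
  assumes "\<And>f. lookup (f \<diamondop> G) 0 = 0"
  shows "G = 0"
proof (rule poly_mapping_eqI)
  fix m show "lookup G m = lookup 0 m"
    using assms[of "single m 1"] diff_coeff_self_pos[of m] by (simp add: lookup_0_diff_act_single)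
qed

lemma diff_act_scal_right: "f \<diamondop> scal c g = scal c (f \<diamondop> g)"
  by (rule poly_mapping_eqI) (simp add: lookup_diff_act lookup_scal sum_distrib_left mult_ac)

lemma diff_act_const: "const c \<diamondop> g = scal c g"
  by (rule poly_mapping_eqI) (simp add: const_def diff_act_single lookup_scal lookup_diff_monom diff_coeff_def)

lemma diff_act_scal_left: "scal c f \<diamondop> g = scal c (f \<diamondop> g)"
  by (simp add: scal_eq_const_mult[of c f] diff_act_mult diff_act_const)

lemma diff_act_diff_left: "(f - g) \<diamondop> h = f \<diamondop> h - g \<diamondop> h"
  using diff_act_add_left[of "f - g" g h] by simp

lemma diff_act_commute: "f \<diamondop> (g \<diamondop> h) = g \<diamondop> (f \<diamondop> h)"
  by (metis diff_act_mult mult.commute)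

lemma linear_form_scale: "linear_form (\<lambda>v. c * p v) = scal c (linear_form p)"
  by (rule poly_mapping_eqI) (simp add: linear_form_def lookup_scal lookup_sum lookup_single sum_distrib_left mult_when)

lemma scal_power: "scal c f ^ n = scal (c ^ n) (f ^ n)"
  by (induction n) (simp_all add: scal_mult_left scal_mult_right mult.commute)

text \<open>Meant for \<open>a \<diamondop> F\<close> with \<open>a\<close> in the socle of
  \<open>R/Q\<close>, which every variable annihilates.\<close>

lemma eq_const_of_diff_eq_0:
  fixes G :: "('v::finite, 'k::field_char_0) mpoly"
  assumes "\<And>v. single (single v 1) 1 \<diamondop> G = 0"
  shows "G = const (lookup G 0)"
proof (rule poly_mapping_eqI)
  fix m
  show "lookup G m = lookup (const (lookup G 0)) m"
  proof (cases "m = 0")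
    case False
    then obtain v where v: "lookup m v \<noteq> 0" by (metis poly_mapping_eqI lookup_zero)
    define k where "k = m - single v 1"
    have m: "m = k + single v 1"
      using v by (auto simp: k_def poly_mapping_eq_iff fun_eq_iff lookup_minus lookup_add lookup_single when_def)
    have "diff_coeff (single v 1) m * (\<Prod>v\<in>UNIV. fact (lookup k v)) = (\<Prod>v\<in>UNIV. fact (lookup m v))"
      unfolding m by (rule diff_coeff_fact)
    then have "diff_coeff (single v 1) m \<noteq> 0"
      by (intro notI) simp
    moreover have "lookup (single (single v 1) 1 \<diamondop> G) k = 0" by (simp only: assms lookup_zero)
    ultimately have "lookup G m = 0" 
      by (simp add: diff_act_single lookup_diff_monom m[simplified, symmetric])
    then show ?thesis using False by (simp add: const_def lookup_single)
  qed (simp add: const_def)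
qed

section \<open>Linear algebra\<close>

context vector_space
begin

text \<open>Independence of a family rather than of a set. A repetition would leave fewer than
  \<open>card D\<close> distinct vectors; conversely it gives a nontrivial relation with the two
  coefficients \<open>1\<close> and \<open>- 1\<close>.\<close>

lemma dim_image_ge_card_iff:
  assumes D: "finite D"
  shows "card D \<le> dim (g ` D) \<longleftrightarrow> (\<forall>u. (\<Sum>d\<in>D. u d *s g d) = 0 \<longrightarrow> (\<forall>d\<in>D. u d = 0))"
proof
  assume "card D \<le> dim (g ` D)"
  obtain B where B: "B \<subseteq> g ` D" "independent B" "g ` D \<subseteq> span B" "card B = dim (g ` D)"
    by (rule basis_exists)
  have "card B \<le> card (g ` D)" "card (g ` D) \<le> card D"
    using card_mono[OF _ B(1)] D by (simp_all add: card_image_le)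
  then have c: "card (g ` D) = card D" "card B = card (g ` D)"
    using B \<open>card D \<le> dim (g ` D)\<close> by auto
  then have inj: "inj_on g D" and "B = g ` D"
    using D B(1) card_subset_eq[of "g ` D" B] by (simp_all add: eq_card_imp_inj_on)
  then have ind: "independent (g ` D)" using B by simp
  show "\<forall>u. (\<Sum>d\<in>D. u d *s g d) = 0 \<longrightarrow> (\<forall>d\<in>D. u d = 0)"
  proof (intro allI impI ballI)
    fix u d assume u: "(\<Sum>d\<in>D. u d *s g d) = 0" and d: "d \<in> D"
    let ?u = "\<lambda>x. u (the_inv_into D g x)"
    have "(\<Sum>x\<in>g ` D. ?u x *s x) = (\<Sum>d\<in>D. u d *s g d)"
      using inj by (simp add: sum.reindex the_inv_into_f_f)
    then have "?u (g d) = 0"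
      using independentD[OF ind, of "g ` D" ?u "g d"] u D d by simp
    then show "u d = 0" using inj d by (simp add: the_inv_into_f_f)
  qed
next
  assume ind: "\<forall>u. (\<Sum>d\<in>D. u d *s g d) = 0 \<longrightarrow> (\<forall>d\<in>D. u d = 0)"
  have inj: "inj_on g D"
  proof (rule inj_onI, rule ccontr)
    fix x y assume xy: "x \<in> D" "y \<in> D" "g x = g y" "x \<noteq> y"
    let ?u = "\<lambda>d. if d = x then 1 else if d = y then - 1 else 0"
    have "(\<Sum>d\<in>D. ?u d *s g d) = (\<Sum>d\<in>D. (if d = x then g x else 0) + (if d = y then - g y else 0))"
      using xy by (intro sum.cong) auto
    also have "\<dots> = 0" using xy D by (simp add: sum.distrib)
    finally show False using ind[rule_format, of ?u x] xy by simp
  qed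
  have "independent (g ` D)"
  proof (rule independent_if_scalars_zero)
    fix f x assume f: "(\<Sum>x\<in>g ` D. f x *s x) = 0" and x: "x \<in> g ` D"
    then have "(\<Sum>d\<in>D. f (g d) *s g d) = 0" using inj by (simp add: sum.reindex)
    then show "f x = 0" using ind[rule_format, of "\<lambda>d. f (g d)"] x by auto
  qed (use D in simp)
  then show "card D \<le> dim (g ` D)"
    using dim_eq_card_independent[of "g ` D"] inj by (simp add: card_image)
qed

text \<open>Extend a basis of \<open>V N\<close> to one of \<open>V (Suc N)\<close>. Such a basis
  stands in for a basis of the associated graded space, which is never formed.\<close>

lemma flag_adapted_basis:
  assumes "\<And>t. subspace (V t)" "\<And>t. V t \<subseteq> V (Suc t)"
  shows "\<exists>D. D \<subseteq> V N \<and> independent D \<and> (\<forall>t\<le>N. V t \<subseteq> span (D \<inter> V t))"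
proof (induction N)
  case 0
  obtain B where "B \<subseteq> V 0" "independent B" "V 0 \<subseteq> span B" by (rule basis_exists)
  then show ?case by (intro exI[of _ B]) (auto simp: Int_absorb2)
next
  case (Suc N)
  then obtain D where D: "D \<subseteq> V N" "independent D" "\<And>t. t \<le> N \<Longrightarrow> V t \<subseteq> span (D \<inter> V t)" by blast
  then have "D \<subseteq> V (Suc N)" using assms(2) by blast
  then obtain B where B: "D \<subseteq> B" "B \<subseteq> V (Suc N)" "independent B" "V (Suc N) \<subseteq> span B"
    using D(2) by (rule maximal_independent_subset_extend)
  have "V t \<subseteq> span (B \<inter> V t)" if "t \<le> Suc N" for t
  proof (cases "t = Suc N")
    case False
    then show ?thesis using that D(3)[of t] span_mono[of "D \<inter> V t" "B \<inter> V t"] B(1) by force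
  qed (use B in \<open>simp add: Int_absorb2\<close>)
  then show ?case using B by blast
qed

text \<open>The ambient space may be infinite-dimensional; the finite set \<open>W\<close> supplies
  the finiteness that makes dimensions comparable.\<close>

lemma subspace_dim_eq:
  assumes "subspace S" "S \<subseteq> T" "T \<subseteq> span W" "finite W" "dim S = dim T"
  shows "S = T"
proof -
  obtain B where B: "B \<subseteq> S" "independent B" "S \<subseteq> span B" "card B = dim S" by (rule basis_exists)
  obtain B' where B': "B \<subseteq> B'" "B' \<subseteq> T" "independent B'" "T \<subseteq> span B'"
    using B assms(2) by (metis maximal_independent_subset_extend subset_trans)
  have "finite B'" using independent_span_bound[OF assms(4) B'(3)] B'(2) assms(3) by blast
  moreover have "card B' = card B" using B' B assms(5) basis_card_eq_dim by metis
  ultimately have "B' = B" using B'(1) by (metis card_subset_eq)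
  then show ?thesis using B'(4) B(1,3) assms(1,2) span_minimal by blast
qed

end

text \<open>Rank and nullity of the restriction to a finite-dimensional subspace: extend a basis of
  the kernel; the map is injective on the span of the added vectors.\<close>

lemma (in Vector_Spaces.linear) dim_image_kernel:
  assumes S: "vs1.subspace S" and W: "S \<subseteq> vs1.span W" "finite W"
  shows "vs2.dim (f ` S) + vs1.dim {x \<in> S. f x = 0} = vs1.dim S"
proof -
  define K where "K = {x \<in> S. f x = 0}"
  have K: "vs1.subspace K"
    unfolding K_def using vs1.subspace_inter[OF S subspace_kernel] by (simp add: Int_def)
  obtain B0 where B0: "B0 \<subseteq> K" "vs1.independent B0" "K \<subseteq> vs1.span B0" "card B0 = vs1.dim K"
    by (rule vs1.basis_exists)
  have "B0 \<subseteq> S" using B0 by (auto simp: K_def)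
  then obtain B where B: "B0 \<subseteq> B" "B \<subseteq> S" "vs1.independent B" "S \<subseteq> vs1.span B"
    using B0(2) by (rule vs1.maximal_independent_subset_extend)
  have fin: "finite B" using vs1.independent_span_bound[OF W(2) B(3)] B(2) W(1) by blast
  have SB: "S = vs1.span B" using B S by (simp add: vs1.span_subspace)
  have KB: "K = vs1.span B0" using B0 K by (simp add: vs1.span_subspace)
  let ?C = "B - B0"
  have inj: "inj_on f (vs1.span ?C)"
  proof (subst inj_on_iff_eq_0[OF vs1.subspace_span], intro ballI impI)
    fix x assume x: "x \<in> vs1.span ?C" "f x = 0"
    have "x \<in> S" using x(1) vs1.span_mono[of ?C B] SB by blast
    then have "x \<in> vs1.span B0" using x by (simp add: K_def flip: KB)
    then obtain u where u: "x = (\<Sum>v\<in>B0. u v *a v)"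
      using vs1.span_finite[of B0] fin B(1) finite_subset by blast
    obtain w where w: "x = (\<Sum>v\<in>?C. w v *a v)"
      using x(1) vs1.span_finite[of ?C] fin by auto
    \<comment> \<open>An element of both spans has two expansions, over \<open>B0\<close> and over
      its complement; their difference is one relation on the independent set
      \<open>B\<close>.\<close>
    let ?h = "\<lambda>v. if v \<in> B0 then - u v else w v"
    have "(\<Sum>v\<in>B. ?h v *a v) = (\<Sum>v\<in>?C. ?h v *a v) + (\<Sum>v\<in>B0. ?h v *a v)"
      using fin B(1) by (simp add: sum.subset_diff)
    also have "(\<Sum>v\<in>?C. ?h v *a v) = x" unfolding w by (intro sum.cong) auto
    also have "(\<Sum>v\<in>B0. ?h v *a v) = - x" unfolding u by (simp add: sum_negf)
    finally have "(\<Sum>v\<in>B. ?h v *a v) = 0" by simp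
    then have "\<And>v. v \<in> B \<Longrightarrow> ?h v = 0"
      using vs1.independentD[OF B(3) fin subset_refl, of ?h] by blast
    then have "w v = 0" if "v \<in> ?C" for v using that by (metis DiffD1 DiffD2)
    then show "x = 0" unfolding w by simp
  qed
  have ind: "vs2.independent (f ` ?C)"
    using inj vs1.independent_mono[OF B(3), of ?C] by (intro independent_injective_image) auto
  have "f ` S = vs2.span (f ` B)" by (simp add: SB span_image)
  also have "\<dots> = vs2.span (f ` ?C)"
  proof (rule antisym)
    show "vs2.span (f ` B) \<subseteq> vs2.span (f ` ?C)"
    proof (rule vs2.span_minimal[OF _ vs2.subspace_span])
      show "f ` B \<subseteq> vs2.span (f ` ?C)"
        using B0(1) by (auto simp: K_def vs2.span_base vs2.span_zero) 
          (metis (mono_tags, lifting) K_def B0(1) DiffI imageI mem_Collect_eq subset_iff vs2.span_base vs2.span_zero)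
    qed
  qed (simp add: image_mono vs2.span_mono)
  finally have "vs2.dim (f ` S) = card (f ` ?C)"
    using ind by (simp add: vs2.dim_eq_card_independent)
  also have "\<dots> = card ?C"
    using inj_on_subset[OF inj vs1.span_superset] by (rule card_image)
  also have "\<dots> = card B - card B0" using fin B(1) by (simp add: card_Diff_subset finite_subset)
  finally have "vs2.dim (f ` S) = card B - card B0" .
  moreover have "card B = vs1.dim S" using B by (simp add: vs1.basis_card_eq_dim)
  moreover have "card B0 \<le> card B" using fin B(1) by (rule card_mono)
  ultimately show ?thesis using B0(4) by (simp add: K_def)
qed

text \<open>Induction on \<open>S\<close>: either some vector sees \<open>\<phi> j\<close> but none
  of the functionals in \<open>S\<close>, and subtracting the right multiple of
  \<open>\<phi> j\<close> from \<open>\<mu>\<close> reduces to \<open>S\<close>, or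
  \<open>\<phi> j\<close> vanishes on their common kernel and can be left out.\<close>

lemma functional_in_span:
  fixes \<phi> :: "'i \<Rightarrow> 'a::ab_group_add \<Rightarrow> 'k::field" and \<mu> :: "'a \<Rightarrow> 'k" and sc :: "'k \<Rightarrow> 'a \<Rightarrow> 'a"
  assumes "finite S"
    and "\<And>x y. \<mu> (x - y) = \<mu> x - \<mu> y" "\<And>c x. \<mu> (sc c x) = c * \<mu> x"
    and "\<And>i x y. \<phi> i (x - y) = \<phi> i x - \<phi> i y" "\<And>i c x. \<phi> i (sc c x) = c * \<phi> i x"
    and "\<And>x. (\<forall>i\<in>S. \<phi> i x = 0) \<Longrightarrow> \<mu> x = 0"
  shows "\<exists>c. \<forall>x. \<mu> x = (\<Sum>i\<in>S. c i * \<phi> i x)"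
  using assms
proof (induction S arbitrary: \<mu> rule: finite_induct)
  case empty
  then show ?case by simp
next
  case (insert j S)
  show ?case
  proof (cases "\<exists>u. (\<forall>i\<in>S. \<phi> i u = 0) \<and> \<phi> j u \<noteq> 0")
    case True
    then obtain u where u: "\<forall>i\<in>S. \<phi> i u = 0" "\<phi> j u \<noteq> 0" by blast
    let ?q = "\<mu> u / \<phi> j u"
    have "\<exists>c. \<forall>x. \<mu> x - ?q * \<phi> j x = (\<Sum>i\<in>S. c i * \<phi> i x)"
    proof (rule insert.IH)
      fix x assume x: "\<forall>i\<in>S. \<phi> i x = 0"
      \<comment> \<open>Subtracting a multiple of \<open>u\<close> corrects the value of
        \<open>\<phi> j\<close> to 0 and keeps \<open>x\<close> in the kernels of the functionals in
        \<open>S\<close>.\<close>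
      have "\<mu> (x - sc (\<phi> j x / \<phi> j u) u) = 0"
        using u x by (intro insert.prems(5)) (simp add: insert.prems)
      then show "\<mu> x - ?q * \<phi> j x = 0" by (simp add: insert.prems)
    qed (simp_all add: insert.prems algebra_simps)
    then obtain c where c: "\<And>x. \<mu> x - ?q * \<phi> j x = (\<Sum>i\<in>S. c i * \<phi> i x)" by blast
    show ?thesis
    proof (intro exI allI)
      fix x
      have "(\<Sum>i\<in>S. (c(j := ?q)) i * \<phi> i x) = (\<Sum>i\<in>S. c i * \<phi> i x)"
        using insert.hyps(2) by (intro sum.cong) auto
      then show "\<mu> x = (\<Sum>i\<in>insert j S. (c(j := ?q)) i * \<phi> i x)"
        using insert.hyps c[of x] by (simp add: algebra_simps)
    qed
  next
    case False
    then have "\<exists>c. \<forall>x. \<mu> x = (\<Sum>i\<in>S. c i * \<phi> i x)"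
      by (intro insert.IH insert.prems) auto
    then obtain c where c: "\<And>x. \<mu> x = (\<Sum>i\<in>S. c i * \<phi> i x)" by blast
    show ?thesis
    proof (intro exI allI)
      fix x
      have "(\<Sum>i\<in>S. (c(j := 0)) i * \<phi> i x) = (\<Sum>i\<in>S. c i * \<phi> i x)"
        using insert.hyps(2) by (intro sum.cong) auto
      then show "\<mu> x = (\<Sum>i\<in>insert j S. (c(j := 0)) i * \<phi> i x)"
        using insert.hyps c[of x] by simp
    qed
  qed
qed

section \<open>The filtration of the functions on a finite set of points\<close>

lemma vector_space_fun: "vector_space (\<lambda>(c::'k::field) (u::'i \<Rightarrow> 'k) i. c * u i)"
  by unfold_locales (auto simp: algebra_simps fun_eq_iff)

lemma sum_fun_apply: "(\<Sum>i\<in>S. f i) x = (\<Sum>i\<in>S. f i x)"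
  by (induction S rule: infinite_finite_induct) simp_all

text \<open>The chart \<open>z = 1\<close> contains exactly one representative of each point off the
  hyperplane \<open>z = 0\<close>, so distinct points become distinct vectors.\<close>

locale points =
  fixes p :: "nat \<Rightarrow> 'v::finite \<Rightarrow> 'k::field_char_0" and b :: "'v \<Rightarrow> 'k" and r :: nat
  assumes on_chart: "i \<in> {1..r} \<Longrightarrow> (\<Sum>v\<in>UNIV. b v * p i v) = 1"
    and inj_p: "inj_on p {1..r}"
begin

abbreviation z :: "('v, 'k) mpoly" where "z \<equiv> linear_form b"

abbreviation rest :: "nat \<Rightarrow> ('v, 'k) mpoly \<Rightarrow> 'k poly" where "rest i \<equiv> line (p i)"

text \<open>The polynomials that vanish on the cone over \<open>X\<close>, with no reference to
  forms. Primality arguments and the cancellation of factors take place line by line, in univariate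
  polynomials.\<close>

definition cone_ideal :: "('v, 'k) mpoly set" where
  "cone_ideal = {f. \<forall>i\<in>{1..r}. rest i f = 0}"

text \<open>Extended by 0 off the index range, so that \<open>k^r\<close> is a subspace of the
  functions on the natural numbers.\<close>

definition ev :: "nat \<Rightarrow> ('v, 'k) mpoly \<Rightarrow> nat \<Rightarrow> 'k" where
  "ev t f = (\<lambda>i. if i \<in> {1..r} then coeff (rest i f) t else 0)"

definition V :: "nat \<Rightarrow> (nat \<Rightarrow> 'k) set" where
  "V t = range (ev t)"

text \<open>The convention is that the filtration is 0 in degree -1.\<close>

definition V_pred :: "nat \<Rightarrow> (nat \<Rightarrow> 'k) set" where
  "V_pred t = (case t of 0 \<Rightarrow> {0} | Suc u \<Rightarrow> V u)"

definition full :: "(nat \<Rightarrow> 'k) set" where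
  "full = {u. \<forall>i. i \<notin> {1..r} \<longrightarrow> u i = 0}"

text \<open>The ideal \<open>Q = I(X) + (z)\<close> of the hyperplane section.\<close>

definition section_ideal :: "('v, 'k) mpoly set" where
  "section_ideal = {f. \<exists>h. f - z * h \<in> cone_ideal}"

lemma V_pred_simps [simp]: "V_pred 0 = {0}" "V_pred (Suc t) = V t"
  by (simp_all add: V_pred_def)

lemma rest_z: "i \<in> {1..r} \<Longrightarrow> rest i z = [:0, 1:]"
  by (simp add: line_linear_form on_chart monom_altdef)

lemma coeff_rest_z_mult: "i \<in> {1..r} \<Longrightarrow> coeff (rest i (z * f)) t = (case t of 0 \<Rightarrow> 0 | Suc u \<Rightarrow> coeff (rest i f) u)"
  by (simp add: line_mult rest_z coeff_pCons split: nat.split)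

lemma rest_z_power: "i \<in> {1..r} \<Longrightarrow> rest i (z ^ n) = monom 1 n"
  by (simp add: line_power rest_z monom_altdef)

lemma ev_add: "ev t (f + g) = ev t f + ev t g"
  and ev_diff: "ev t (f - g) = ev t f - ev t g"
  and ev_0 [simp]: "ev t 0 = 0"
  by (auto simp: ev_def line_add line_diff)

lemma ev_scal: "ev t (scal c f) = (\<lambda>i. c * ev t f i)"
  by (auto simp: ev_def line_scal)

lemma ev_sum: "ev t (\<Sum>i\<in>S. f i) = (\<Sum>i\<in>S. ev t (f i))"
  by (induction S rule: infinite_finite_induct) (simp_all add: ev_add)

lemma ev_z_mult: "ev (Suc t) (z * f) = ev t f" "ev 0 (z * f) = 0"
  by (auto simp: ev_def coeff_rest_z_mult)

lemma ev_hom_part: "ev t (hom_part d f) = (if t = d then ev d f else 0)"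
  by (auto simp: ev_def line_hom_part)

lemma cone_ideal_iff: "f \<in> cone_ideal \<longleftrightarrow> (\<forall>t. ev t f = 0)"
  by (auto simp: cone_ideal_def ev_def poly_eq_iff fun_eq_iff)

lemma cone_ideal_0: "0 \<in> cone_ideal"
  and cone_ideal_add: "f \<in> cone_ideal \<Longrightarrow> g \<in> cone_ideal \<Longrightarrow> f + g \<in> cone_ideal"
  and cone_ideal_diff: "f \<in> cone_ideal \<Longrightarrow> g \<in> cone_ideal \<Longrightarrow> f - g \<in> cone_ideal"
  and cone_ideal_mult: "f \<in> cone_ideal \<Longrightarrow> g * f \<in> cone_ideal"
  by (simp_all add: cone_ideal_def line_add line_diff line_mult)

lemma cone_ideal_cancel:
  assumes "g * f \<in> cone_ideal" "\<And>i. i \<in> {1..r} \<Longrightarrow> rest i g \<noteq> 0"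
  shows "f \<in> cone_ideal"
  using assms by (auto simp: cone_ideal_def line_mult)

lemma cone_ideal_cancel_z: "z * f \<in> cone_ideal \<Longrightarrow> f \<in> cone_ideal"
  by (erule cone_ideal_cancel) (simp add: rest_z)

lemma V_mono: "V t \<subseteq> V (Suc t)"
  unfolding V_def by (metis ev_z_mult(1) image_subsetI rangeI)

lemma V_mono': "t \<le> u \<Longrightarrow> V t \<subseteq> V u"
  by (rule lift_Suc_mono_le[of V, OF V_mono])

lemma V_subset_full: "V t \<subseteq> full"
  by (auto simp: V_def full_def ev_def)

sublocale FV: vector_space "\<lambda>(c::'k) (u::nat \<Rightarrow> 'k) i. c * u i"
  by (rule vector_space_fun)

sublocale MV: vector_space "scal :: 'k \<Rightarrow> ('v, 'k) mpoly \<Rightarrow> _"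
  by (rule vector_space_scal)

lemma subspace_V: "FV.subspace (V t)"
proof (rule FV.subspaceI)
  show "0 \<in> V t" unfolding V_def by (rule range_eqI[of _ _ 0]) simp
  show "x + y \<in> V t" if "x \<in> V t" "y \<in> V t" for x y
    using that by (auto simp: V_def simp flip: ev_add)
  show "(\<lambda>i. c * x i) \<in> V t" if "x \<in> V t" for c x
    using that by (auto simp: V_def simp flip: ev_scal)
qed

lemma subspace_V_pred: "FV.subspace (V_pred t)"
  using subspace_V by (cases t) simp_all

lemma subspace_full: "FV.subspace full"
  by (rule FV.subspaceI) (auto simp: full_def)

text \<open>This identifies \<open>R/Q\<close> with the graded space of the filtration: since
  \<open>z\<close> does not change values, a component lies in \<open>Q\<close> as soon as some
  polynomial has the same values one degree lower.\<close>

lemma section_ideal_iff: "f \<in> section_ideal \<longleftrightarrow> (\<forall>t. ev t f \<in> V_pred t)"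
proof
  assume "f \<in> section_ideal"
  then obtain h where h: "f - z * h \<in> cone_ideal" by (auto simp: section_ideal_def)
  show "\<forall>t. ev t f \<in> V_pred t"
  proof
    fix t
    have "ev t f = ev t (z * h)" using h by (simp add: cone_ideal_iff ev_diff)
    then show "ev t f \<in> V_pred t" by (cases t) (auto simp: ev_z_mult V_def)
  qed
next
  assume *: "\<forall>t. ev t f \<in> V_pred t"
  have "\<exists>g. ev (Suc t) f = ev t g" for t using *[rule_format, of "Suc t"] by (auto simp: V_def)
  then obtain g where g: "\<And>t. ev (Suc t) f = ev t (g t)" by metis
  obtain N where N: "\<forall>m\<in>keys f. total_deg m \<le> N" using total_deg_bounded by blast
  \<comment> \<open>Each \<open>g t\<close> is cut down to degree \<open>t\<close>, so that the
    choices for different degrees do not interfere; beyond the degree of \<open>f\<close> nothing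
    has to be matched.\<close>
  define h where "h = (\<Sum>t\<le>N. hom_part t (g t))"
  have "ev t h = (\<Sum>u\<le>N. if t = u then ev t (g t) else 0)" for t
    unfolding h_def by (auto simp: ev_sum ev_hom_part intro!: sum.cong)
  then have h: "ev t h = (if t \<le> N then ev t (g t) else 0)" for t by simp
  have "ev t f = ev t (z * h)" for t
  proof (cases t)
    case 0
    then show ?thesis using *[rule_format, of 0] by (simp add: ev_z_mult)
  next
    case (Suc u)
    have "ev (Suc u) f = 0" if "\<not> u \<le> N"
      using coeff_line_beyond[OF N, of "Suc u"] that by (auto simp: ev_def)
    then show ?thesis using Suc by (auto simp: ev_z_mult h g)
  qed
  then have "f - z * h \<in> cone_ideal" by (simp add: cone_ideal_iff ev_diff)
  then show "f \<in> section_ideal" by (auto simp: section_ideal_def)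
qed

lemma cone_subset_section: "cone_ideal \<subseteq> section_ideal"
proof
  fix f assume "f \<in> cone_ideal"
  then have "f - z * 0 \<in> cone_ideal" by simp
  then show "f \<in> section_ideal" unfolding section_ideal_def by blast
qed

lemma z_mult_in_section: "z * h \<in> section_ideal"
proof -
  have "z * h - z * h \<in> cone_ideal" by (simp add: cone_ideal_0)
  then show ?thesis unfolding section_ideal_def by blast
qed

lemma section_ideal_add: "f \<in> section_ideal \<Longrightarrow> g \<in> section_ideal \<Longrightarrow> f + g \<in> section_ideal"
  and section_ideal_diff: "f \<in> section_ideal \<Longrightarrow> g \<in> section_ideal \<Longrightarrow> f - g \<in> section_ideal"
  by (simp_all add: section_ideal_iff ev_add ev_diff FV.subspace_add FV.subspace_diff subspace_V_pred)

lemma section_ideal_0: "0 \<in> section_ideal"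
  using cone_subset_section cone_ideal_0 by blast

lemma section_ideal_mult: 
  assumes "f \<in> section_ideal"
  shows "g * f \<in> section_ideal"
proof -
  obtain h where "f - z * h \<in> cone_ideal" using assms by (auto simp: section_ideal_def)
  then have "g * (f - z * h) \<in> cone_ideal" by (rule cone_ideal_mult)
  also have "g * (f - z * h) = g * f - z * (g * h)" by (simp add: algebra_simps)
  finally show ?thesis unfolding section_ideal_def by blast
qed

text \<open>A product of \<open>r - 1\<close> linear forms, one for each other point, equal to 1 at
  \<open>P_i\<close> and to 0 at that point.\<close>

lemma separator:
  assumes i: "i \<in> {1..r}"
  obtains e where "rest i e = monom 1 (r - 1)" "\<And>j. j \<in> {1..r} \<Longrightarrow> j \<noteq> i \<Longrightarrow> rest j e = 0"
proof -
  have "\<exists>l. rest i l = monom 1 1 \<and> rest j l = 0" if j: "j \<in> {1..r} - {i}" for j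
  proof -
    have "p i \<noteq> p j" using inj_p i j by (auto dest: inj_onD)
    then obtain v where v: "p i v \<noteq> p j v" by (auto simp: fun_eq_iff)
    \<comment> \<open>The coordinate \<open>x_v\<close>, made to vanish at \<open>P_j\<close> by
      subtracting a multiple of \<open>z\<close>, which is 1 at both points.\<close>
    let ?l = "scal (1 / (p i v - p j v)) (single (single v 1) 1 - scal (p j v) z)"
    have "rest i ?l = monom 1 1" "rest j ?l = 0"
      using v i j by (simp_all add: line_scal line_diff line_single rest_z monom_Suc monom_0 flip: diff_divide_distrib)
    then show ?thesis by blast
  qed
  then obtain l where l: "\<And>j. j \<in> {1..r} - {i} \<Longrightarrow> rest i (l j) = monom 1 1 \<and> rest j (l j) = 0" by metis
  let ?e = "\<Prod>j\<in>{1..r} - {i}. l j"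
  have "rest i ?e = (\<Prod>j\<in>{1..r} - {i}. monom 1 1)"
    unfolding line_prod using l by (intro prod.cong) auto
  then have "rest i ?e = monom 1 (r - 1)" using i by (simp add: monom_altdef)
  moreover have "rest j ?e = 0" if "j \<in> {1..r}" "j \<noteq> i" for j
    unfolding line_prod using l[of j] that by (intro prod_zero) auto
  ultimately show ?thesis using that by blast
qed

text \<open>Interpolation by the separators. This bounds the socle degree, and hence makes it well
  defined.\<close>

lemma V_eq_full_large: "V (r - 1) = full"
proof (rule antisym[OF V_subset_full], rule subsetI)
  fix u assume u: "u \<in> full"
  have "\<exists>e. rest i e = monom 1 (r - 1) \<and> (\<forall>j\<in>{1..r}. j \<noteq> i \<longrightarrow> rest j e = 0)" if "i \<in> {1..r}" for i
    using separator[OF that] by metis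
  then obtain e where e: "\<And>i. i \<in> {1..r} \<Longrightarrow> rest i (e i) = monom 1 (r - 1)"
    "\<And>i j. i \<in> {1..r} \<Longrightarrow> j \<in> {1..r} \<Longrightarrow> j \<noteq> i \<Longrightarrow> rest j (e i) = 0" by metis
  let ?f = "\<Sum>i=1..r. scal (u i) (e i)"
  have "ev (r - 1) ?f j = u j" for j
  proof (cases "j \<in> {1..r}")
    case True
    have "coeff (rest j ?f) (r - 1) = (\<Sum>i=1..r. if i = j then u j else 0)"
      unfolding line_sum coeff_sum using True e by (intro sum.cong) (auto simp: line_scal)
    then show ?thesis using True by (simp add: ev_def)
  qed (use u in \<open>auto simp: ev_def full_def\<close>)
  then have "u = ev (r - 1) ?f" by (simp add: fun_eq_iff)
  then show "u \<in> V (r - 1)" by (auto simp: V_def)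
qed

definition basis_fun :: "nat \<Rightarrow> nat \<Rightarrow> 'k" where "basis_fun i = (\<lambda>j. if j = i then 1 else 0)"

lemma full_eq_span: "full = FV.span (basis_fun ` {1..r})"
proof
  show "FV.span (basis_fun ` {1..r}) \<subseteq> full"
    by (rule FV.span_minimal[OF _ subspace_full]) (auto simp: full_def basis_fun_def)
  show "full \<subseteq> FV.span (basis_fun ` {1..r})"
  proof
    fix u assume u: "u \<in> full"
    have "u = (\<Sum>i\<in>{1..r}. (\<lambda>j. u i * basis_fun i j))"
    proof
      fix j
      have "(\<Sum>i\<in>{1..r}. (\<lambda>j. u i * basis_fun i j)) j = (\<Sum>i\<in>{1..r}. if i = j then u j else 0)"
        unfolding sum_fun_apply by (intro sum.cong) (auto simp: basis_fun_def)
      then show "u j = (\<Sum>i\<in>{1..r}. (\<lambda>j. u i * basis_fun i j)) j"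
        using u by (simp add: full_def)
    qed
    also have "\<dots> \<in> FV.span (basis_fun ` {1..r})"
      by (intro FV.span_sum FV.span_scale FV.span_base) auto
    finally show "u \<in> FV.span (basis_fun ` {1..r})" .
  qed
qed

lemma dim_full: "FV.dim full = r"
proof -
  have "card {1..r} \<le> FV.dim (basis_fun ` {1..r})"
  proof (subst FV.dim_image_ge_card_iff, simp, intro allI impI ballI)
    fix u d assume "(\<Sum>i\<in>{1..r}. (\<lambda>j. u i * basis_fun i j)) = 0" and d: "d \<in> {1..r}"
    then have "(\<Sum>i\<in>{1..r}. (\<lambda>j. u i * basis_fun i j)) d = 0" by simp
    moreover have "(\<Sum>i\<in>{1..r}. (\<lambda>j. u i * basis_fun i j)) d = (\<Sum>i\<in>{1..r}. if i = d then u d else 0)"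
      unfolding sum_fun_apply by (intro sum.cong) (auto simp: basis_fun_def)
    ultimately show "u d = 0" using d by simp
  qed
  moreover have "FV.dim (basis_fun ` {1..r}) \<le> card (basis_fun ` {1..r})"
    by (rule FV.dim_le_card) (auto intro: FV.span_base)
  moreover have "card (basis_fun ` {1..r}) \<le> card {1..r}" by (rule card_image_le) simp
  ultimately show ?thesis by (simp add: full_eq_span)
qed

section \<open>The Hilbert function as the dimension of the filtration\<close>

lemma linear_ev: "Vector_Spaces.linear scal (\<lambda>(c::'k) (u::nat \<Rightarrow> 'k) i. c * u i) (ev t)"
  by unfold_locales (simp_all add: ev_add ev_scal)

lemma finite_total_deg: "finite {m :: 'v \<Rightarrow>\<^sub>0 nat. total_deg m = t}"
proof -
  have "inj_on lookup {m :: 'v \<Rightarrow>\<^sub>0 nat. total_deg m = t}"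
    by (simp add: inj_on_def poly_mapping.lookup_inject)
  moreover have "lookup ` {m :: 'v \<Rightarrow>\<^sub>0 nat. total_deg m = t} \<subseteq> PiE UNIV (\<lambda>_. {..t})"
    by (auto simp: PiE_def total_deg_def intro: member_le_sum)
  then have "finite (lookup ` {m :: 'v \<Rightarrow>\<^sub>0 nat. total_deg m = t})"
    by (rule finite_subset) (simp add: finite_PiE)
  ultimately show ?thesis by (rule finite_imageD[rotated])
qed

text \<open>On the forms of degree \<open>t\<close>, the map \<open>ev t\<close> has image
  \<open>V t\<close>, because passing to the component of degree \<open>t\<close> does not affect
  it, and its kernel is the degree \<open>t\<close> part of \<open>I(X)\<close>.\<close>

lemma dim_homogeneous_diff:
  "int (MV.dim {f::('v, 'k) mpoly. homogeneous t f}) - int (MV.dim {f \<in> cone_ideal. homogeneous t f}) = int (FV.dim (V t))"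
proof -
  interpret E: Vector_Spaces.linear scal "\<lambda>(c::'k) (u::nat \<Rightarrow> 'k) i. c * u i" "ev t" by (rule linear_ev)
  let ?S = "{f::('v, 'k) mpoly. homogeneous t f}"
  have hom: "homogeneous t f \<longleftrightarrow> hom_part t f = f" for f :: "('v, 'k) mpoly"
  proof
    assume "homogeneous t f"
    then show "hom_part t f = f" 
      by (intro poly_mapping_eqI) (auto simp: lookup_hom_part when_def homogeneous_iff in_keys_iff)
  qed (metis homogeneous_hom_part)
  have "MV.subspace ?S"
    by (rule MV.subspaceI) (simp_all add: hom hom_part_add hom_part_scal)
  moreover have "?S \<subseteq> MV.span ((\<lambda>m. single m 1) ` {m. total_deg m = t})"
  proof
    fix f :: "('v, 'k) mpoly" assume f: "f \<in> ?S"
    have "scal (lookup f m) (single m 1) = single m (lookup f m)" for m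
      by (rule poly_mapping_eqI) (simp add: lookup_scal lookup_single when_def)
    then have "f = (\<Sum>m\<in>keys f. scal (lookup f m) (single m 1))"
      using mpoly_eq_sum_single[of f] by simp
    also have "\<dots> \<in> MV.span ((\<lambda>m. single m 1) ` {m. total_deg m = t})"
      using f by (intro MV.span_sum MV.span_scale MV.span_base) (auto simp: homogeneous_iff)
    finally show "f \<in> MV.span ((\<lambda>m. single m 1) ` {m. total_deg m = t})" .
  qed
  ultimately have "FV.dim (ev t ` ?S) + MV.dim {x \<in> ?S. ev t x = 0} = MV.dim ?S"
    using finite_total_deg by (intro E.dim_image_kernel) auto
  moreover have "ev t ` ?S = V t"
    unfolding V_def by (auto simp: image_def) (metis ev_hom_part homogeneous_hom_part)
  moreover have "{x \<in> ?S. ev t x = 0} = {f \<in> cone_ideal. homogeneous t f}"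
    by (auto simp: cone_ideal_iff) (metis ev_hom_part hom)
  ultimately show ?thesis by simp
qed

end

section \<open>Hyperplane section and inverse forms\<close>

text \<open>Positivity of \<open>s\<close> makes \<open>s - 1\<close> a true predecessor; it will
  come from nondegeneracy and the presence of two variables.\<close>

locale points_socle_degree = points p b r for p :: "nat \<Rightarrow> 'v::finite \<Rightarrow> 'k::field_char_0" and b r +
  fixes s :: nat
  assumes s_pos: "s > 0" and V_s: "V s = full" and V_pred_s: "V (s - 1) \<noteq> full"
begin

lemma V_eq_full: "t \<ge> s \<Longrightarrow> V t = full"
  using V_mono'[of s t] V_s V_subset_full[of t] by blast

lemma V_pred_eq_full: "t > s \<Longrightarrow> V_pred t = full"
  by (cases t) (simp_all add: V_eq_full)

section \<open>The socle of \<open>R/Q\<close> in terms of representatives\<close>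

text \<open>A substitute for "all components have degree at least \<open>k\<close>" that only looks
  at the lines of the cone and thus is insensitive to \<open>I(X)\<close>.\<close>

definition ord_ge :: "nat \<Rightarrow> ('v, 'k) mpoly \<Rightarrow> bool" where
  "ord_ge k f \<longleftrightarrow> (\<forall>i\<in>{1..r}. monom 1 k dvd rest i f)"

definition irrelevant :: "('v, 'k) mpoly set" where
  "irrelevant = {f. lookup f 0 = 0}"

text \<open>Representatives of the nonzero elements of the socle of \<open>R/Q\<close>.\<close>

definition socle_reps :: "('v, 'k) mpoly set" where
  "socle_reps = {a. a \<notin> section_ideal \<and> (\<forall>x\<in>irrelevant. x * a \<in> section_ideal)}"

text \<open>Any nonzero socle element generates the socle. As the irrelevant ideal kills the socle,
  a multiplier acts by its constant term, so this means dimension at most one.\<close>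

definition simple_socle :: bool where
  "simple_socle \<longleftrightarrow> (\<forall>a\<in>socle_reps. \<forall>a'\<in>socle_reps. \<exists>g. a' - g * a \<in> section_ideal)"

lemma ord_ge_0: "ord_ge 0 f"
  by (simp add: ord_ge_def)

lemma ord_ge_mult: "ord_ge k f \<Longrightarrow> ord_ge l g \<Longrightarrow> ord_ge (k + l) (f * g)"
  using mult_monom[of "1::'k" k 1 l] by (metis (no_types, lifting) line_mult mult_1 mult_dvd_mono ord_ge_def)

lemma ord_ge_mult_right: "ord_ge k f \<Longrightarrow> ord_ge k (f * g)"
  by (simp add: ord_ge_def line_mult)

lemma ord_ge_power: "ord_ge 1 f \<Longrightarrow> ord_ge k (f ^ k)"
proof (induction k)
  case (Suc k)
  then show ?case using ord_ge_mult[of 1 f k "f ^ k"] by simp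
qed (simp add: ord_ge_0)

lemma ord_ge_irrelevant: "f \<in> irrelevant \<Longrightarrow> ord_ge 1 f"
  by (simp add: ord_ge_def irrelevant_def monom_1_dvd_iff' coeff_line_0)

lemma ord_ge_hom_part: "ord_ge t (hom_part t f)"
  by (simp add: ord_ge_def line_hom_part monom_1_dvd_iff')

text \<open>In degrees up to \<open>s\<close> the values vanish, and above \<open>s\<close> every
  value vector is already attained one degree lower.\<close>

lemma ord_gt_s_in_section: 
  assumes "ord_ge (Suc s) f"
  shows "f \<in> section_ideal"
  unfolding section_ideal_iff
proof
  fix t show "ev t f \<in> V_pred t"
  proof (cases "t \<le> s")
    case True
    then have "ev t f = 0" using assms by (auto simp: ord_ge_def monom_1_dvd_iff' ev_def)
    then show ?thesis using subspace_V_pred[THEN FV.subspace_0] by simp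
  next
    case False
    then show ?thesis using V_subset_full[of t] by (auto simp: V_pred_eq_full V_def)
  qed
qed

text \<open>Multiply \<open>g\<close> by a polynomial of the largest order that keeps the product outside \<open>Q\<close>.\<close>

lemma socle_rep_multiple:
  assumes g: "g \<notin> section_ideal"
  shows "\<exists>h. h * g \<in> socle_reps"
proof -
  let ?P = "\<lambda>k. \<exists>h. ord_ge k h \<and> h * g \<notin> section_ideal"
  have P0: "?P 0" using g by (intro exI[of _ 1]) (simp add: ord_ge_0)
  have bound: "k \<le> s" if k: "?P k" for k
  proof (rule ccontr)
    assume "\<not> k \<le> s"
    obtain h where h: "ord_ge k h" "h * g \<notin> section_ideal" using k by blast
    have "ord_ge (Suc s) h"
      using h(1) \<open>\<not> k \<le> s\<close> by (auto simp: ord_ge_def monom_1_dvd_iff')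
    then have "ord_ge (Suc s) (h * g)" by (rule ord_ge_mult_right)
    then show False using h(2) ord_gt_s_in_section by blast
  qed
  define k where "k = (GREATEST k. ?P k)"
  have "?P k" unfolding k_def using P0 bound by (rule GreatestI_nat)
  then obtain h where h: "ord_ge k h" "h * g \<notin> section_ideal" by blast
  have "x * (h * g) \<in> section_ideal" if "x \<in> irrelevant" for x
  proof (rule ccontr)
    assume "x * (h * g) \<notin> section_ideal"
    moreover have "ord_ge (Suc k) (x * h)" using ord_ge_mult[OF ord_ge_irrelevant[OF that] h(1)] by simp
    ultimately have "?P (Suc k)" by (intro exI[of _ "x * h"]) (simp add: mult.assoc)
    then have "Suc k \<le> k" unfolding k_def using bound by (rule Greatest_le_nat)
    then show False by simp
  qed
  then show ?thesis using h(2) by (auto simp: socle_reps_def)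
qed

lemma const_irrelevant: "f - const (lookup f 0) \<in> irrelevant"
  by (simp add: irrelevant_def const_def lookup_minus)

lemma section_ideal_const_cancel: 
  assumes "const c * f \<in> section_ideal" "c \<noteq> 0"
  shows "f \<in> section_ideal"
proof -
  have "const (1 / c) * (const c * f) = f" using assms(2) by (simp flip: scal_eq_const_mult)
  then show ?thesis using section_ideal_mult[OF assms(1), of "const (1 / c)"] by simp
qed

text \<open>The part of \<open>u\<close> without constant term lies in the irrelevant ideal and
  kills the socle.\<close>

lemma socle_rep_mult_iff: 
  assumes "a \<in> socle_reps \<or> a \<in> section_ideal"
  shows "u * a - const (lookup u 0) * a \<in> section_ideal"
proof -
  have "(u - const (lookup u 0)) * a \<in> section_ideal"
    using assms const_irrelevant[of u] by (auto simp: socle_reps_def section_ideal_mult)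
  then show ?thesis by (simp add: algebra_simps)
qed

text \<open>\<open>R/Q\<close> is already local at the vertex. A nonzero class has a multiple in the
  socle, where \<open>u\<close> acts by its nonzero constant term; hence \<open>u\<close> cannot
  annihilate it.\<close>

lemma section_ideal_saturated:
  assumes "u * f \<in> section_ideal" "lookup u 0 \<noteq> 0"
  shows "f \<in> section_ideal"
proof (rule ccontr)
  assume "f \<notin> section_ideal"
  then obtain h where h: "h * f \<in> socle_reps" using socle_rep_multiple by blast
  have "u * (h * f) \<in> section_ideal" using section_ideal_mult[OF assms(1), of h] by (simp add: mult_ac)
  moreover have "u * (h * f) - const (lookup u 0) * (h * f) \<in> section_ideal"
    using h by (intro socle_rep_mult_iff) simp
  ultimately have "u * (h * f) - (u * (h * f) - const (lookup u 0) * (h * f)) \<in> section_ideal"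
    by (rule section_ideal_diff)
  then have "const (lookup u 0) * (h * f) \<in> section_ideal" by simp
  then have "h * f \<in> section_ideal" using assms(2) by (rule section_ideal_const_cancel)
  then show False using h by (simp add: socle_reps_def)
qed

lemma top_degree_socle_rep:
  assumes "f \<notin> section_ideal" "ord_ge s f"
  shows "f \<in> socle_reps"
proof -
  have "x * f \<in> section_ideal" if "x \<in> irrelevant" for x
    using ord_gt_s_in_section ord_ge_mult[OF ord_ge_irrelevant[OF that] assms(2)] by simp
  then show ?thesis using assms(1) by (simp add: socle_reps_def)
qed

lemma ev_lift: 
  assumes "u \<in> V t"
  obtains f where "homogeneous t f" "ord_ge t f" "ev t f = u" "\<And>t'. t' \<noteq> t \<Longrightarrow> ev t' f = 0"
proof -
  obtain f where f: "ev t f = u" using assms by (auto simp: V_def)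
  show ?thesis
    by (rule that[of "hom_part t f"]) (simp_all add: homogeneous_hom_part ord_ge_hom_part ev_hom_part f)
qed

text \<open>A form of degree \<open>s\<close> whose values are not attained in degree
  \<open>s - 1\<close>; multiplication by the irrelevant ideal pushes it past the top
  degree.\<close>

lemma socle_reps_nonempty: "\<exists>f. f \<in> socle_reps \<and> homogeneous s f"
proof -
  obtain u where u: "u \<in> V s" "u \<notin> V (s - 1)" using V_s V_pred_s V_subset_full[of "s - 1"] by blast
  obtain f where f: "homogeneous s f" "ord_ge s f" "ev s f = u" using ev_lift[OF u(1)] by metis
  have "V_pred s = V (s - 1)" using s_pos by (cases s) simp_all
  then have "ev s f \<notin> V_pred s" using u f by simp
  then have "f \<notin> section_ideal" unfolding section_ideal_iff by blast
  then show ?thesis using f top_degree_socle_rep by blast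
qed

section \<open>Inverse forms and their annihilators\<close>

text \<open>The weights \<open>w\<close> are a functional on \<open>k^r\<close>; the pairing with
  \<open>f\<close> evaluates it on the values of \<open>f\<close> in degree \<open>N\<close>. One
  \<open>w\<close> thus gives a polynomial in every degree.\<close>

definition inv_form :: "(nat \<Rightarrow> 'k) \<Rightarrow> nat \<Rightarrow> ('v, 'k) mpoly" where
  "inv_form w N = (\<Sum>i=1..r. scal (w i) (divpow (p i) N))"

lemma lookup_0_inv_form: "lookup (f \<diamondop> inv_form w N) 0 = (\<Sum>i=1..r. w i * ev N f i)"
  unfolding inv_form_def diff_act_sum_right lookup_sum
  by (intro sum.cong) (auto simp: diff_act_scal_right lookup_scal lookup_0_diff_act_divpow ev_def)

lemma diff_eqI:
  fixes G H :: "('v, 'k) mpoly"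
  assumes "\<And>f. lookup (f \<diamondop> G) 0 = lookup (f \<diamondop> H) 0"
  shows "G = H"
proof -
  have "f \<diamondop> (G - H) = f \<diamondop> G - f \<diamondop> H" for f
    using diff_act_add_right[of f "G - H" H] by simp
  then have "G - H = 0" using assms by (intro diff_pairing_nondegenerate) (simp add: lookup_minus)
  then show ?thesis by simp
qed

lemma inv_form_eq_0_iff: "inv_form w N = 0 \<longleftrightarrow> (\<forall>u\<in>V N. (\<Sum>i=1..r. w i * u i) = 0)"
proof
  assume "inv_form w N = 0"
  then show "\<forall>u\<in>V N. (\<Sum>i=1..r. w i * u i) = 0"
    using lookup_0_inv_form[of _ w N] by (auto simp: V_def diff_act_0_right)
next
  assume "\<forall>u\<in>V N. (\<Sum>i=1..r. w i * u i) = 0"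
  then show "inv_form w N = 0"
    by (intro diff_pairing_nondegenerate) (auto simp: V_def lookup_0_inv_form)
qed

lemma cone_ideal_kills: "f \<in> cone_ideal \<Longrightarrow> f \<diamondop> inv_form w N = 0"
  by (intro diff_pairing_nondegenerate) (simp add: lookup_0_inv_form cone_ideal_mult cone_ideal_iff[THEN iffD1] flip: diff_act_mult)

text \<open>The adjoint of the fact that multiplication by \<open>z\<close> shifts the degree and
  keeps the values.\<close>

lemma z_inv_form: "z \<diamondop> inv_form w (Suc N) = inv_form w N"
proof (rule diff_eqI)
  fix f
  have "lookup (f \<diamondop> z \<diamondop> inv_form w (Suc N)) 0 = lookup ((z * f) \<diamondop> inv_form w (Suc N)) 0"
    by (simp add: mult.commute flip: diff_act_mult)
  then show "lookup (f \<diamondop> z \<diamondop> inv_form w (Suc N)) 0 = lookup (f \<diamondop> inv_form w N) 0"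
    by (simp add: lookup_0_inv_form ev_z_mult)
qed

text \<open>Condition (a) for the rescaled coefficients: the functional \<open>w\<close> vanishes on
  \<open>V (s - 1)\<close>.\<close>

definition balanced :: "(nat \<Rightarrow> 'k) \<Rightarrow> bool" where
  "balanced w \<longleftrightarrow> inv_form w (s - 1) = 0"

lemma z_inv_form_s: "balanced w \<Longrightarrow> z \<diamondop> inv_form w s = 0"
  using z_inv_form[of w "s - 1"] s_pos by (simp add: balanced_def)

lemma section_ideal_kills:
  assumes "balanced w" "f \<in> section_ideal"
  shows "f \<diamondop> inv_form w s = 0"
proof -
  obtain h where h: "f - z * h \<in> cone_ideal" using assms(2) by (auto simp: section_ideal_def)
  have "f \<diamondop> inv_form w s = (f - z * h) \<diamondop> inv_form w s + h \<diamondop> z \<diamondop> inv_form w s"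
    by (simp add: diff_act_diff_left mult.commute flip: diff_act_mult)
  then show ?thesis using cone_ideal_kills[OF h] z_inv_form_s[OF assms(1)] by (simp add: diff_act_0_right)
qed

text \<open>\<open>R/Q\<close> has dimension \<open>r\<close>. Each vector \<open>d\<close> of a
  basis of \<open>k^r\<close> adapted to the filtration is lifted to a polynomial \<open>c d\<close>
  that has values only in degree \<open>\<tau> d\<close>, the first one in which \<open>d\<close> is
  attained.\<close>

lemma basis_mod_section_ideal:
  "\<exists>(D :: (nat \<Rightarrow> 'k) set) c. finite D \<and> card D = r \<and>
    (\<forall>f. \<exists>u. f - (\<Sum>d\<in>D. scal (u d) (c d)) \<in> section_ideal) \<and>
    (\<forall>u. (\<Sum>d\<in>D. scal (u d) (c d)) \<in> section_ideal \<longrightarrow> (\<forall>d\<in>D. u d = 0))"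
proof -
  obtain D where D: "D \<subseteq> V s" "FV.independent D" "\<And>t. t \<le> s \<Longrightarrow> V t \<subseteq> FV.span (D \<inter> V t)"
    using FV.flag_adapted_basis[of V s, OF subspace_V V_mono] by blast
  have sp: "V s \<subseteq> FV.span D" using D(3)[of s] FV.span_mono[of "D \<inter> V s" D] by blast
  have fin: "finite D"
    using FV.independent_span_bound[OF _ D(2), of "basis_fun ` {1..r}"] D(1) V_s full_eq_span by simp
  have card: "card D = r"
    using FV.basis_card_eq_dim[OF D(1) sp D(2)] V_s dim_full by simp
  define \<tau> where "\<tau> d = (LEAST t. d \<in> V t)" for d
  have \<tau>: "d \<in> V t \<longleftrightarrow> \<tau> d \<le> t" if "d \<in> D" for d t
  proof
    show "\<tau> d \<le> t" if "d \<in> V t" unfolding \<tau>_def using that by (rule Least_le)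
    have "d \<in> V (\<tau> d)" unfolding \<tau>_def by (rule LeastI[of "\<lambda>t. d \<in> V t" s]) (use D(1) \<open>d \<in> D\<close> in blast)
    then show "d \<in> V t" if "\<tau> d \<le> t" using V_mono'[OF that] by blast
  qed
  have span_pred: "V_pred t \<subseteq> FV.span {d\<in>D. \<tau> d < t}" if "t \<le> Suc s" for t
  proof (cases t)
    case (Suc u)
    then have "V u \<subseteq> FV.span (D \<inter> V u)" using D(3)[of u] that by simp
    also have "D \<inter> V u = {d\<in>D. \<tau> d < t}" using Suc \<tau> by auto
    finally show ?thesis using Suc by simp
  qed (simp add: FV.span_zero)
  have in_pred: "d \<in> V_pred t" if "d \<in> D" "\<tau> d < t" for d t
    using that \<tau> by (cases t) auto
  have "\<exists>f. ev (\<tau> d) f = d \<and> (\<forall>t. t \<noteq> \<tau> d \<longrightarrow> ev t f = 0)" if "d \<in> D" for d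
  proof -
    have "d \<in> V (\<tau> d)" using \<tau>[OF that] by simp
    then obtain f where "ev (\<tau> d) f = d" "\<And>t. t \<noteq> \<tau> d \<Longrightarrow> ev t f = 0" by (rule ev_lift) blast
    then show ?thesis by blast
  qed
  then obtain c where c: "\<And>d. d \<in> D \<Longrightarrow> ev (\<tau> d) (c d) = d" "\<And>d t. d \<in> D \<Longrightarrow> t \<noteq> \<tau> d \<Longrightarrow> ev t (c d) = 0"
    by metis
  have ev_c: "ev t (\<Sum>d\<in>D. scal (u d) (c d)) = (\<Sum>d\<in>{d\<in>D. \<tau> d = t}. (\<lambda>i. u d * d i))" for t u
  proof -
    have "ev t (\<Sum>d\<in>D. scal (u d) (c d)) = (\<Sum>d\<in>D. if \<tau> d = t then (\<lambda>i. u d * d i) else 0)"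
      unfolding ev_sum ev_scal
    proof (rule sum.cong)
      fix d assume "d \<in> D"
      then show "(\<lambda>i. u d * ev t (c d) i) = (if \<tau> d = t then (\<lambda>i. u d * d i) else 0)"
        using c(1)[of d] c(2)[of d t] by (cases "\<tau> d = t") (simp_all add: fun_eq_iff)
    qed simp
    then show ?thesis using fin by (simp add: sum.inter_filter)
  qed
  have spanning: "\<exists>u. f - (\<Sum>d\<in>D. scal (u d) (c d)) \<in> section_ideal" for f
  proof -
    have "\<forall>t\<in>{..s}. \<exists>\<mu>. ev t f = (\<Sum>d\<in>{d\<in>D. \<tau> d \<le> t}. (\<lambda>i. \<mu> d * d i))"
    proof
      fix t assume "t \<in> {..s}"
      then have that: "t \<le> s" by simp
      have "ev t f \<in> V_pred (Suc t)" by (simp add: V_def)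
      then have "ev t f \<in> FV.span {d\<in>D. \<tau> d \<le> t}" using span_pred[of "Suc t"] that unfolding less_Suc_eq_le by blast
      then show "\<exists>\<mu>. ev t f = (\<Sum>d\<in>{d\<in>D. \<tau> d \<le> t}. (\<lambda>i. \<mu> d * d i))"
        using FV.span_finite[of "{d\<in>D. \<tau> d \<le> t}"] fin by auto
    qed
    from bchoice[OF this] obtain \<mu> where "\<forall>t\<in>{..s}. ev t f = (\<Sum>d\<in>{d\<in>D. \<tau> d \<le> t}. (\<lambda>i. \<mu> t d * d i))" ..
    then have \<mu>: "ev t f = (\<Sum>d\<in>{d\<in>D. \<tau> d \<le> t}. (\<lambda>i. \<mu> t d * d i))" if "t \<le> s" for t
      using that by simp
    \<comment> \<open>In the expansion of \<open>ev t f\<close>, vectors of level below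
      \<open>t\<close> lie in \<open>V_pred t\<close> and do not matter modulo \<open>Q\<close>. So
      \<open>d\<close> receives its coefficient from the expansion in degree \<open>\<tau> d\<close>
      alone.\<close>
    let ?g = "f - (\<Sum>d\<in>D. scal (\<mu> (\<tau> d) d) (c d))"
    have "ev t ?g \<in> V_pred t" for t
    proof (cases "t \<le> s")
      case True
      have split: "{d\<in>D. \<tau> d \<le> t} = {d\<in>D. \<tau> d < t} \<union> {d\<in>D. \<tau> d = t}" by auto
      have "ev t f = (\<Sum>d\<in>{d\<in>D. \<tau> d < t}. (\<lambda>i. \<mu> t d * d i)) + (\<Sum>d\<in>{d\<in>D. \<tau> d = t}. (\<lambda>i. \<mu> t d * d i))"
        unfolding \<mu>[OF True] split
        by (intro sum.union_disjoint) (use fin in auto)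
      moreover have "ev t (\<Sum>d\<in>D. scal (\<mu> (\<tau> d) d) (c d)) = (\<Sum>d\<in>{d\<in>D. \<tau> d = t}. (\<lambda>i. \<mu> t d * d i))"
        unfolding ev_c by (intro sum.cong) auto
      ultimately have "ev t ?g = (\<Sum>d\<in>{d\<in>D. \<tau> d < t}. (\<lambda>i. \<mu> t d * d i))" by (simp add: ev_diff)
      also have "\<dots> \<in> V_pred t"
        by (intro FV.subspace_sum FV.subspace_scale subspace_V_pred) (auto intro: in_pred)
      finally show ?thesis .
    next
      case False
      then show ?thesis using V_subset_full[of t] by (auto simp: V_pred_eq_full V_def)
    qed
    then have "?g \<in> section_ideal" by (simp add: section_ideal_iff)
    then show ?thesis by (rule exI[where P = "\<lambda>u. f - (\<Sum>d\<in>D. scal (u d) (c d)) \<in> section_ideal"])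
  qed
  have independent: "\<forall>d\<in>D. u d = 0" if u: "(\<Sum>d\<in>D. scal (u d) (c d)) \<in> section_ideal" for u
  proof
    fix d0 assume d0: "d0 \<in> D"
    let ?t = "\<tau> d0"
    have "?t \<le> s" using \<tau>[OF d0, of s] D(1) d0 by auto
    have "(\<Sum>d\<in>{d\<in>D. \<tau> d = ?t}. (\<lambda>i. u d * d i)) \<in> V_pred ?t"
      using u by (simp add: section_ideal_iff flip: ev_c)
    then have "(\<Sum>d\<in>{d\<in>D. \<tau> d = ?t}. (\<lambda>i. u d * d i)) \<in> FV.span {d\<in>D. \<tau> d < ?t}"
      using span_pred[of ?t] \<open>?t \<le> s\<close> by (meson le_SucI subsetD)
    then obtain \<mu> where \<mu>: "(\<Sum>d\<in>{d\<in>D. \<tau> d = ?t}. (\<lambda>i. u d * d i)) = (\<Sum>d\<in>{d\<in>D. \<tau> d < ?t}. (\<lambda>i. \<mu> d * d i))"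
      using FV.span_finite[of "{d\<in>D. \<tau> d < ?t}"] fin by auto
    \<comment> \<open>The two expansions involve disjoint parts of \<open>D\<close>, vectors of
      level \<open>?t\<close> and of lower level, so together they are one relation on an
      independent set.\<close>
    let ?h = "\<lambda>d. if \<tau> d = ?t then u d else - \<mu> d"
    have "(\<Sum>d\<in>{d\<in>D. \<tau> d = ?t} \<union> {d\<in>D. \<tau> d < ?t}. (\<lambda>i. ?h d * d i)) =
       (\<Sum>d\<in>{d\<in>D. \<tau> d = ?t}. (\<lambda>i. ?h d * d i)) + (\<Sum>d\<in>{d\<in>D. \<tau> d < ?t}. (\<lambda>i. ?h d * d i))"
      using fin by (intro sum.union_disjoint) auto
    also have "(\<Sum>d\<in>{d\<in>D. \<tau> d = ?t}. (\<lambda>i. ?h d * d i)) = (\<Sum>d\<in>{d\<in>D. \<tau> d = ?t}. (\<lambda>i. u d * d i))"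
      by (intro sum.cong) auto
    also have "(\<Sum>d\<in>{d\<in>D. \<tau> d < ?t}. (\<lambda>i. ?h d * d i)) = - (\<Sum>d\<in>{d\<in>D. \<tau> d < ?t}. (\<lambda>i. \<mu> d * d i))"
      unfolding sum_negf[symmetric] by (intro sum.cong) (auto simp: fun_eq_iff)
    finally have "(\<Sum>d\<in>{d\<in>D. \<tau> d = ?t} \<union> {d\<in>D. \<tau> d < ?t}. (\<lambda>i. ?h d * d i)) = 0"
      unfolding \<mu> by (simp only: right_minus)
    then have "?h d0 = 0"
      by (rule FV.independentD[OF D(2), rotated 2]) (use fin d0 in auto)
    then show "u d0 = 0" by simp
  qed
  show ?thesis using fin card spanning independent by (intro exI[of _ D] exI[of _ c]) simp
qed

lemma submod_singleton: "submod {G} = range (\<lambda>g. g \<diamondop> G)"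
  by (rule Modules.module.span_singleton[OF module_diff_act])

text \<open>\<open>Q\<close> kills the form, so the submodule it generates is a quotient of
  \<open>R/Q\<close>, which has dimension \<open>r\<close>. Dimension at least \<open>r\<close>
  leaves no room for further annihilators.\<close>

lemma dim_ge_iff_annihilator:
  assumes w: "balanced w"
  shows "r \<le> MV.dim (submod {inv_form w s}) \<longleftrightarrow> (\<forall>g. g \<diamondop> inv_form w s = 0 \<longrightarrow> g \<in> section_ideal)"
proof -
  let ?F = "inv_form w s"
  obtain D :: "(nat \<Rightarrow> 'k) set" and c where D: "finite D" "card D = r"
    "\<And>f. \<exists>u. f - (\<Sum>d\<in>D. scal (u d) (c d)) \<in> section_ideal"
    "\<And>u. (\<Sum>d\<in>D. scal (u d) (c d)) \<in> section_ideal \<Longrightarrow> (\<forall>d\<in>D. u d = 0)"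
    using basis_mod_section_ideal by auto
  have act: "(\<Sum>d\<in>D. scal (u d) (c d)) \<diamondop> ?F = (\<Sum>d\<in>D. scal (u d) (c d \<diamondop> ?F))" for u
    by (simp add: diff_act_sum_left diff_act_scal_left)
  have red: "\<exists>u. g - (\<Sum>d\<in>D. scal (u d) (c d)) \<in> section_ideal \<and> g \<diamondop> ?F = (\<Sum>d\<in>D. scal (u d) (c d \<diamondop> ?F))" for g
  proof -
    obtain u where u: "g - (\<Sum>d\<in>D. scal (u d) (c d)) \<in> section_ideal" using D(3) by blast
    then have "(g - (\<Sum>d\<in>D. scal (u d) (c d))) \<diamondop> ?F = 0" by (rule section_ideal_kills[OF w])
    then show ?thesis using u by (auto simp: diff_act_diff_left act)
  qed
  have "submod {?F} = MV.span ((\<lambda>d. c d \<diamondop> ?F) ` D)"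
  proof
    show "submod {?F} \<subseteq> MV.span ((\<lambda>d. c d \<diamondop> ?F) ` D)"
    proof
      fix y assume "y \<in> submod {?F}"
      then obtain g where "y = g \<diamondop> ?F" unfolding submod_singleton by blast
      moreover obtain u where "g \<diamondop> ?F = (\<Sum>d\<in>D. scal (u d) (c d \<diamondop> ?F))" using red[of g] by blast
      ultimately show "y \<in> MV.span ((\<lambda>d. c d \<diamondop> ?F) ` D)"
        by (simp add: MV.span_sum MV.span_scale MV.span_base)
    qed
    have "MV.subspace (submod {?F})"
    proof (rule MV.subspaceI)
      show "0 \<in> submod {?F}" "\<And>x y. x \<in> submod {?F} \<Longrightarrow> y \<in> submod {?F} \<Longrightarrow> x + y \<in> submod {?F}"
        using Modules.module.span_zero[OF module_diff_act] Modules.module.span_add[OF module_diff_act] by auto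
      show "scal d x \<in> submod {?F}" if "x \<in> submod {?F}" for d x
        using Modules.module.span_scale[OF module_diff_act that, of "const d"] by (simp add: diff_act_const)
    qed
    then show "MV.span ((\<lambda>d. c d \<diamondop> ?F) ` D) \<subseteq> submod {?F}"
      by (intro MV.span_minimal) (auto simp: submod_singleton)
  qed
  then have "r \<le> MV.dim (submod {?F}) \<longleftrightarrow> card D \<le> MV.dim ((\<lambda>d. c d \<diamondop> ?F) ` D)"
    by (simp add: D(2))
  also have "\<dots> \<longleftrightarrow> (\<forall>u. (\<Sum>d\<in>D. scal (u d) (c d \<diamondop> ?F)) = 0 \<longrightarrow> (\<forall>d\<in>D. u d = 0))"
    by (rule MV.dim_image_ge_card_iff[OF D(1)])
  also have "\<dots> \<longleftrightarrow> (\<forall>g. g \<diamondop> ?F = 0 \<longrightarrow> g \<in> section_ideal)"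
  proof
    assume *: "\<forall>u. (\<Sum>d\<in>D. scal (u d) (c d \<diamondop> ?F)) = 0 \<longrightarrow> (\<forall>d\<in>D. u d = 0)"
    show "\<forall>g. g \<diamondop> ?F = 0 \<longrightarrow> g \<in> section_ideal"
    proof (intro allI impI)
      fix g assume g: "g \<diamondop> ?F = 0"
      obtain u where u: "g - (\<Sum>d\<in>D. scal (u d) (c d)) \<in> section_ideal" "g \<diamondop> ?F = (\<Sum>d\<in>D. scal (u d) (c d \<diamondop> ?F))"
        using red by blast
      have "(\<Sum>d\<in>D. scal (u d) (c d \<diamondop> ?F)) = 0" using u(2) g by simp
      then have "\<forall>d\<in>D. u d = 0" using * by blast
      then show "g \<in> section_ideal" using u(1) by simp
    qed
  next
    assume *: "\<forall>g. g \<diamondop> ?F = 0 \<longrightarrow> g \<in> section_ideal"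
    show "\<forall>u. (\<Sum>d\<in>D. scal (u d) (c d \<diamondop> ?F)) = 0 \<longrightarrow> (\<forall>d\<in>D. u d = 0)"
    proof (intro allI impI)
      fix u assume "(\<Sum>d\<in>D. scal (u d) (c d \<diamondop> ?F)) = 0"
      then have "(\<Sum>d\<in>D. scal (u d) (c d)) \<diamondop> ?F = 0" unfolding act .
      then show "\<forall>d\<in>D. u d = 0" using * by (intro D(4)) blast
    qed
  qed
  finally show ?thesis .
qed

text \<open>Conditions (a) and (b) for the rescaled coefficients.\<close>

definition dualizing :: "(nat \<Rightarrow> 'k) \<Rightarrow> bool" where
  "dualizing w \<longleftrightarrow> balanced w \<and> r \<le> MV.dim (submod {inv_form w s})"

lemma annihilator_inv_form: "dualizing w \<Longrightarrow> g \<diamondop> inv_form w s = 0 \<longleftrightarrow> g \<in> section_ideal"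
  using dim_ge_iff_annihilator section_ideal_kills by (auto simp: dualizing_def)

end

section \<open>Dualizing weights\<close>

context points_socle_degree
begin

lemma section_ideal_scal: "f \<in> section_ideal \<Longrightarrow> scal c f \<in> section_ideal"
  by (simp add: scal_eq_const_mult section_ideal_mult)

lemma section_ideal_sum: "(\<And>i. i \<in> S \<Longrightarrow> f i \<in> section_ideal) \<Longrightarrow> (\<Sum>i\<in>S. f i) \<in> section_ideal"
  by (induction S rule: infinite_finite_induct) (simp_all add: section_ideal_0 section_ideal_add)

lemma ev_mult_homogeneous:
  assumes "\<And>t. t \<noteq> d \<Longrightarrow> ev t h = 0"
  shows "ev (N + d) (f * h) j = ev N f j * ev d h j"
proof (cases "j \<in> {1..r}")
  case True
  have "coeff (rest j h) t = 0" if "t \<noteq> d" for t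
    using fun_cong[OF assms[OF that], of j] True by (simp add: ev_def)
  then have "rest j h = monom (coeff (rest j h) d) d"
    by (intro poly_eqI) auto
  then have "rest j (f * h) = monom (coeff (rest j h) d) d * rest j f"
    by (simp add: line_mult mult.commute)
  then show ?thesis using True by (simp add: ev_def coeff_monom_mult)
qed (auto simp: ev_def)

lemma basis_fun_in_V: "i \<in> {1..r} \<Longrightarrow> basis_fun i \<in> V s"
  by (auto simp: V_s full_def basis_fun_def)

lemma r_pos: "r > 0"
proof (rule ccontr)
  assume "\<not> r > 0"
  then have "full = {0}" unfolding full_def by (auto simp: fun_eq_iff)
  then show False using V_pred_s V_subset_full[of "s - 1"] subspace_V[of "s - 1", THEN FV.subspace_0] by auto
qed

text \<open>The annihilator of \<open>F\<close> is \<open>Q\<close>. A socle element sends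
  \<open>F\<close> to a polynomial with vanishing derivatives, that is, to a constant, nonzero
  outside \<open>Q\<close>. Two nonzero constants are proportional, and the corresponding
  combination of socle elements kills \<open>F\<close>.\<close>

lemma dualizing_imp_simple_socle:
  assumes w: "dualizing w"
  shows simple_socle
  unfolding simple_socle_def
proof (intro ballI)
  fix a a' assume a: "a \<in> socle_reps" and a': "a' \<in> socle_reps"
  let ?F = "inv_form w s"
  have const: "a \<diamondop> ?F = const (lookup (a \<diamondop> ?F) 0)" if "a \<in> socle_reps" for a
  proof (rule eq_const_of_diff_eq_0)
    fix v :: 'v
    have "single v (1::nat) \<noteq> 0" by (metis lookup_single_eq lookup_zero zero_neq_one)
    then have "single (single v 1) 1 \<in> irrelevant"
      by (simp add: irrelevant_def lookup_single when_def)
    then have "single (single v 1) 1 * a \<in> section_ideal" using that by (simp add: socle_reps_def)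
    then show "single (single v 1) 1 \<diamondop> a \<diamondop> ?F = 0"
      using annihilator_inv_form[OF w] by (simp flip: diff_act_mult)
  qed
  let ?c = "lookup (a \<diamondop> ?F) 0" and ?c' = "lookup (a' \<diamondop> ?F) 0"
  have "a \<diamondop> ?F \<noteq> 0" using a annihilator_inv_form[OF w] by (simp add: socle_reps_def)
  then have "?c \<noteq> 0" using const[OF a] by (auto simp: const_def)
  have "(a' - const (?c' / ?c) * a) \<diamondop> ?F = a' \<diamondop> ?F - scal (?c' / ?c) (a \<diamondop> ?F)"
    by (simp add: diff_act_diff_left diff_act_mult diff_act_const)
  also have "\<dots> = const ?c' - scal (?c' / ?c) (const ?c)"
    using const[OF a] const[OF a'] by simp
  also have "\<dots> = 0" using \<open>?c \<noteq> 0\<close> by (simp add: scal_eq_const_mult const_def mult_single)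
  finally show "\<exists>g. a' - g * a \<in> section_ideal"
    using annihilator_inv_form[OF w] by blast
qed

text \<open>Fix a socle element \<open>g0\<close>. Every polynomial of order at least
  \<open>s\<close> is modulo \<open>Q\<close> a scalar times \<open>g0\<close>, and
  \<open>w i\<close> is this scalar for the indicator function of \<open>P_i\<close> placed in
  degree \<open>s\<close>. By linearity \<open>w\<close> computes the scalar of everything with
  values in degree \<open>s\<close> only.\<close>

lemma simple_socle_imp_dualizing:
  assumes simple_socle
  shows "\<exists>w. dualizing w"
proof -
  obtain g0 where g0: "g0 \<in> socle_reps" using socle_reps_nonempty by blast
  then have g0_notin: "g0 \<notin> section_ideal" by (simp add: socle_reps_def)
  \<comment> \<open>Outside \<open>Q\<close> such an \<open>h\<close> is itself in the socle, and
    the multiplier given by simplicity may be replaced by its constant term.\<close>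
  have multiple: "\<exists>c. h - const c * g0 \<in> section_ideal" if h: "ord_ge s h" for h
  proof (cases "h \<in> section_ideal")
    case True
    then show ?thesis by (intro exI[of _ 0]) (simp add: const_def)
  next
    case False
    then have "h \<in> socle_reps" using h by (rule top_degree_socle_rep)
    then obtain g where g: "h - g * g0 \<in> section_ideal" using assms g0 by (auto simp: simple_socle_def)
    have "g * g0 - const (lookup g 0) * g0 \<in> section_ideal" using g0 by (intro socle_rep_mult_iff) simp
    then have "(h - g * g0) + (g * g0 - const (lookup g 0) * g0) \<in> section_ideal" by (rule section_ideal_add[OF g])
    then show ?thesis by (intro exI[of _ "lookup g 0"]) simp
  qed
  have "\<forall>i\<in>{1..r}. \<exists>e. ev s e = basis_fun i \<and> (\<forall>t. t \<noteq> s \<longrightarrow> ev t e = 0) \<and> ord_ge s e"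
  proof
    fix i assume "i \<in> {1..r}"
    then obtain e where "ord_ge s e" "ev s e = basis_fun i" "\<And>t. t \<noteq> s \<Longrightarrow> ev t e = 0"
      using ev_lift[OF basis_fun_in_V[of i]] by blast
    then show "\<exists>e. ev s e = basis_fun i \<and> (\<forall>t. t \<noteq> s \<longrightarrow> ev t e = 0) \<and> ord_ge s e" by blast
  qed
  from bchoice[OF this] obtain e where e: "\<And>i. i \<in> {1..r} \<Longrightarrow> ev s (e i) = basis_fun i"
    "\<And>i t. i \<in> {1..r} \<Longrightarrow> t \<noteq> s \<Longrightarrow> ev t (e i) = 0" "\<And>i. i \<in> {1..r} \<Longrightarrow> ord_ge s (e i)" by blast
  have "\<forall>i\<in>{1..r}. \<exists>c. e i - const c * g0 \<in> section_ideal" using multiple e(3) by blast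
  from bchoice[OF this] obtain w where w: "\<And>i. i \<in> {1..r} \<Longrightarrow> e i - const (w i) * g0 \<in> section_ideal" by blast
  let ?L = "\<lambda>f. \<Sum>i=1..r. w i * ev s f i"
  have hom: "f - const (?L f) * g0 \<in> section_ideal" if f: "\<And>t. t \<noteq> s \<Longrightarrow> ev t f = 0" for f
  proof -
    let ?k = "f - (\<Sum>i=1..r. scal (ev s f i) (e i))"
    have "ev t ?k = 0" for t
    proof (cases "t = s")
      case True
      have "ev s (\<Sum>i=1..r. scal (ev s f i) (e i)) j = ev s f j" for j
      proof -
        have "ev s (\<Sum>i=1..r. scal (ev s f i) (e i)) j = (\<Sum>i=1..r. if i = j then ev s f j else 0)"
          unfolding ev_sum ev_scal sum_fun_apply using e(1) by (intro sum.cong) (auto simp: basis_fun_def)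
        also have "\<dots> = ev s f j" by (simp add: ev_def)
        finally show ?thesis .
      qed
      then show ?thesis using True by (simp add: ev_diff fun_eq_iff)
    next
      case False
      have "ev t (\<Sum>i=1..r. scal (ev s f i) (e i)) = 0"
        unfolding ev_sum ev_scal using e(2) False by (intro sum.neutral) (auto simp: fun_eq_iff)
      then show ?thesis using f[OF False] by (simp add: ev_diff)
    qed
    then have k: "?k \<in> section_ideal" using cone_subset_section by (auto simp: cone_ideal_iff)
    have "const (?L f) * g0 = (\<Sum>i=1..r. scal (ev s f i) (const (w i) * g0))"
      unfolding scal_eq_const_mult[symmetric] scal_sum_left by (simp add: mult.commute)
    then have "f - const (?L f) * g0 = ?k + (\<Sum>i=1..r. scal (ev s f i) (e i) - scal (ev s f i) (const (w i) * g0))"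
      by (simp add: sum_subtractf)
    also have "\<dots> = ?k + (\<Sum>i=1..r. scal (ev s f i) (e i - const (w i) * g0))"
      by (simp add: scal_eq_const_mult right_diff_distrib)
    also have "\<dots> \<in> section_ideal"
      using w by (intro section_ideal_add section_ideal_sum section_ideal_scal k) auto
    finally show ?thesis .
  qed
  have "balanced w"
    unfolding balanced_def inv_form_eq_0_iff
  proof
    fix u assume "u \<in> V (s - 1)"
    then obtain f where f: "ev (s - 1) f = u" "\<And>t. t \<noteq> s - 1 \<Longrightarrow> ev t f = 0" by (rule ev_lift) blast
    \<comment> \<open>Multiplication by \<open>z\<close> moves the values \<open>u\<close> up to
      degree \<open>s\<close>, where \<open>w\<close> reads off the scalar; it is 0 because
      \<open>z * f\<close> lies in \<open>Q\<close>.\<close>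
    have ev_zf: "ev t (z * f) = (if t = s then u else 0)" for t
      using s_pos f by (cases t) (auto simp: ev_z_mult)
    then have "z * f - const (?L (z * f)) * g0 \<in> section_ideal" by (intro hom) simp
    then have "z * f - (z * f - const (?L (z * f)) * g0) \<in> section_ideal"
      by (rule section_ideal_diff[OF z_mult_in_section])
    then have "const (?L (z * f)) * g0 \<in> section_ideal" by simp
    then have "?L (z * f) = 0" using g0_notin section_ideal_const_cancel by blast
    then show "(\<Sum>i=1..r. w i * u i) = 0" by (simp add: ev_zf)
  qed
  moreover have "g \<in> section_ideal" if g: "g \<diamondop> inv_form w s = 0" for g
  proof (rule ccontr)
    assume "g \<notin> section_ideal"
    then obtain h where h: "h * g \<in> socle_reps" using socle_rep_multiple by blast
    \<comment> \<open>The socle element \<open>h * g\<close> generates the socle, so modulo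
      \<open>Q\<close> it divides \<open>g1\<close>. If \<open>g\<close> kills the inverse form, so
      does \<open>g1\<close>; having degree \<open>s\<close>, it then has scalar 0 and lies in
      \<open>Q\<close>, a contradiction.\<close>
    obtain g1 where g1: "g1 \<in> socle_reps" "homogeneous s g1" using socle_reps_nonempty by blast
    then obtain g' where "g1 - g' * (h * g) \<in> section_ideal" using assms h by (auto simp: simple_socle_def)
    then have "(g1 - g' * (h * g)) \<diamondop> inv_form w s = 0" by (rule section_ideal_kills[OF \<open>balanced w\<close>])
    then have "g1 \<diamondop> inv_form w s = 0" using g by (simp add: diff_act_diff_left diff_act_mult diff_act_0_right)
    then have "?L g1 = 0" using lookup_0_inv_form[of g1 w s] by simp
    moreover have "ev t g1 = 0" if "t \<noteq> s" for t
    proof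
      fix i show "ev t g1 i = 0 i"
        using that line_homogeneous[OF g1(2), of "p i"] by (simp add: ev_def) (metis coeff_monom)
    qed
    then have "g1 - const (?L g1) * g0 \<in> section_ideal" by (rule hom)
    ultimately show False using g1(1) by (simp add: const_def socle_reps_def)
  qed
  ultimately show ?thesis unfolding dualizing_def using dim_ge_iff_annihilator by blast
qed

text \<open>
  If \<open>w\<^sub>i = 0\<close>, a form whose values on \<open>X\<close> are the indicator function of \<open>P\<^sub>i\<close> annihilates \<open>F\<close>, hence lies in
  \<open>Q\<close>, and the indicator function is already attained one degree lower.
\<close>

lemma dualizing_nonzero:
  assumes w: "dualizing w" and i: "i \<in> {1..r}"
  shows "w i \<noteq> 0"
proof
  assume wi: "w i = 0"
  have desc: "basis_fun i \<in> V_pred t" if V: "basis_fun i \<in> V t" for t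
  proof -
    obtain f where f: "ev t f = basis_fun i" "\<And>t'. t' \<noteq> t \<Longrightarrow> ev t' f = 0" using V by (rule ev_lift) blast
    have "f \<diamondop> inv_form w s = 0"
    proof (rule diff_pairing_nondegenerate)
      fix g
      have "w j * ev s (g * f) j = 0" if j: "j \<in> {1..r}" for j
      proof (cases "j = i")
        case False
        have "coeff (rest j f) t' = 0" for t'
          using j False fun_cong[OF f(1), of j] fun_cong[OF f(2)[of t'], of j]
          by (cases "t' = t") (auto simp: ev_def basis_fun_def)
        then have "rest j f = 0" by (intro poly_eqI) simp
        then show ?thesis by (simp add: ev_def line_mult)
      qed (simp add: wi)
      then have "(\<Sum>j=1..r. w j * ev s (g * f) j) = 0" by (intro sum.neutral) blast
      then show "lookup (g \<diamondop> f \<diamondop> inv_form w s) 0 = 0"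
        by (simp only: lookup_0_inv_form diff_act_mult[symmetric])
    qed
    then have "f \<in> section_ideal" using annihilator_inv_form[OF w] by blast
    then show ?thesis using f(1) by (metis section_ideal_iff)
  qed
  have "basis_fun i \<notin> V t" for t
  proof (induction t)
    case 0
    have "basis_fun i i \<noteq> 0" by (simp add: basis_fun_def)
    then have "basis_fun i \<noteq> 0" by (intro notI) simp
    then show ?case using desc[of 0] by auto
  next
    case (Suc t)
    then show ?case using desc[of "Suc t"] by auto
  qed
  then show False using basis_fun_in_V[OF i] by blast
qed

text \<open>In the pairing of \<open>g * h\<close> with the inverse form of degree \<open>s\<close>,
  only the constant term of \<open>g\<close> counts. So \<open>h\<close> kills that form exactly if
  the single number on the right vanishes.\<close>

lemma dualizing_top_degree:
  assumes w: "dualizing w" and h: "\<And>t. t \<noteq> s \<Longrightarrow> ev t h = 0"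
  shows "h \<in> section_ideal \<longleftrightarrow> (\<Sum>j=1..r. w j * ev s h j) = 0"
proof
  assume "h \<in> section_ideal"
  then have "h \<diamondop> inv_form w s = 0" using annihilator_inv_form[OF w] by blast
  then show "(\<Sum>j=1..r. w j * ev s h j) = 0" using lookup_0_inv_form[of h w s] by simp
next
  assume *: "(\<Sum>j=1..r. w j * ev s h j) = 0"
  have "h \<diamondop> inv_form w s = 0"
  proof (rule diff_pairing_nondegenerate)
    fix g
    have **: "lookup (g \<diamondop> h \<diamondop> inv_form w s) 0 = (\<Sum>j=1..r. w j * ev (0 + s) (g * h) j)"
      by (simp add: lookup_0_inv_form flip: diff_act_mult)
    have "ev (0 + s) (g * h) j = ev 0 g j * ev s h j" for j
      by (rule ev_mult_homogeneous) (rule h)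
    then have eq: "(\<Sum>j=1..r. w j * ev (0 + s) (g * h) j) = (\<Sum>j=1..r. lookup g 0 * (w j * ev s h j))"
      by (intro sum.cong) (auto simp: ev_def coeff_line_0)
    note ** also note eq
    also have "\<dots> = 0" unfolding sum_distrib_left[symmetric] * by simp
    finally show "lookup (g \<diamondop> h \<diamondop> inv_form w s) 0 = 0" .
  qed
  then show "h \<in> section_ideal" using annihilator_inv_form[OF w] by blast
qed

text \<open>Both functionals have the same kernel, the value vectors of the degree \<open>s\<close>
  elements of \<open>Q\<close>; hence they are proportional.\<close>

lemma dualizing_unique:
  assumes w: "dualizing w" and w': "dualizing w'"
  shows "\<exists>c. c \<noteq> 0 \<and> (\<forall>i\<in>{1..r}. w' i = c * w i)"
proof (intro exI conjI ballI)
  have one: "1 \<in> {1..r}" using r_pos by simp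
  show "w' 1 / w 1 \<noteq> 0" using dualizing_nonzero[OF w one] dualizing_nonzero[OF w' one] by simp
  fix i assume i: "i \<in> {1..r}"
  \<comment> \<open>Chosen in the kernel of \<open>w\<close>; that \<open>w'\<close> kills it too is
    the required proportion.\<close>
  let ?u = "\<lambda>j. w 1 * basis_fun i j - w i * basis_fun 1 j"
  have "?u \<in> V s" using i one by (auto simp: V_s full_def basis_fun_def)
  then obtain h where h: "ev s h = ?u" "\<And>t. t \<noteq> s \<Longrightarrow> ev t h = 0" by (rule ev_lift) blast
  have sum: "(\<Sum>j=1..r. x j * ev s h j) = w 1 * x i - w i * x 1" for x
  proof -
    have "(\<Sum>j=1..r. x j * ev s h j) = (\<Sum>j=1..r. (if j = i then w 1 * x i else 0) - (if j = 1 then w i * x 1 else 0))"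
      unfolding h(1) by (intro sum.cong) (auto simp: basis_fun_def algebra_simps)
    then show ?thesis using i one by (simp add: sum_subtractf)
  qed
  have "h \<in> section_ideal" using dualizing_top_degree[OF w h(2)] unfolding sum by simp
  then have "w 1 * w' i - w i * w' 1 = 0" using dualizing_top_degree[OF w' h(2)] unfolding sum by simp
  then show "w' i = w' 1 / w 1 * w i"
    using dualizing_nonzero[OF w one] by (simp add: field_simps)
qed

section \<open>The inverse system of \<open>I(X)\<close> and admissibility\<close>

lemma z_power_inv_form: "z ^ k \<diamondop> inv_form w (k + N) = inv_form w N"
proof (induction k)
  case (Suc k)
  have "z ^ Suc k \<diamondop> inv_form w (Suc k + N) = z ^ k \<diamondop> z \<diamondop> inv_form w (Suc (k + N))"
    by (simp add: mult.commute flip: diff_act_mult)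
  then show ?case using Suc by (simp add: z_inv_form)
qed (simp add: diff_act_one)

text \<open>\<open>inv_form w (n + s)\<close> is \<open>F_(n+1)\<close>, whence the exponent
  \<open>Suc n\<close>. In the induction step \<open>g\<close> also kills the previous member, so
  \<open>g\<close> is \<open>z ^ Suc n * h\<close> modulo \<open>I(X)\<close>. As
  \<open>z ^ Suc n\<close> takes the current member to \<open>F_1\<close>, \<open>h\<close> kills
  \<open>F_1\<close>, lies in \<open>Q\<close>, and contributes one more factor
  \<open>z\<close>.\<close>

lemma annihilator_inv_form_power:
  assumes w: "dualizing w" and "g \<diamondop> inv_form w (n + s) = 0"
  shows "\<exists>h. g - z ^ Suc n * h \<in> cone_ideal"
  using assms(2)
proof (induction n)
  case 0
  then show ?case using annihilator_inv_form[OF w, of g] by (simp add: section_ideal_def)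
next
  case (Suc n)
  have "g \<diamondop> inv_form w (n + s) = z \<diamondop> g \<diamondop> inv_form w (Suc n + s)"
    by (subst diff_act_commute) (simp add: z_inv_form)
  then obtain h where h: "g - z ^ Suc n * h \<in> cone_ideal" using Suc by (auto simp: diff_act_0_right)
  have "(z ^ Suc n * h) \<diamondop> inv_form w (Suc n + s) = 0"
    using cone_ideal_kills[OF h, of w "Suc n + s"] Suc.prems by (simp add: diff_act_diff_left)
  then have "h \<diamondop> z ^ Suc n \<diamondop> inv_form w (Suc n + s) = 0"
    by (subst diff_act_commute) (simp only: diff_act_mult)
  then have "h \<diamondop> inv_form w s = 0" by (simp only: z_power_inv_form)
  then have "h \<in> section_ideal" using annihilator_inv_form[OF w] by blast
  then obtain h' where h': "h - z * h' \<in> cone_ideal" by (auto simp: section_ideal_def)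
  have "g - z ^ Suc (Suc n) * h' = (g - z ^ Suc n * h) + z ^ Suc n * (h - z * h')"
    by (simp add: algebra_simps)
  then show ?case using cone_ideal_add[OF h cone_ideal_mult[OF h', of "z ^ Suc n"]] by metis
qed

text \<open>Only equal monomials pair nontrivially, so either argument may be cut down to degree
  \<open>N\<close>.\<close>

lemma lookup_0_hom_part_act: "lookup (f \<diamondop> hom_part N G) 0 = lookup (hom_part N f \<diamondop> G) 0"
  unfolding lookup_diff_act by (rule sum.mono_neutral_cong_right)
    (auto simp: lookup_hom_part in_keys_iff when_def split: if_splits)

text \<open>Take for \<open>e\<close> a polynomial with values in degree \<open>s\<close> only,
  namely the indicator function of \<open>P_i\<close>. It isolates the divided power at
  \<open>P_i\<close> in all degrees and for all weights at once.\<close>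

lemma inv_form_basis:
  assumes i: "i \<in> {1..r}"
  shows "\<exists>e. \<forall>w N. e \<diamondop> inv_form w (N + s) = scal (w i) (divpow (p i) N)"
proof -
  obtain e where e: "ev s e = basis_fun i" "\<And>t. t \<noteq> s \<Longrightarrow> ev t e = 0"
    using basis_fun_in_V[OF i] by (rule ev_lift) blast
  have "e \<diamondop> inv_form w (N + s) = scal (w i) (divpow (p i) N)" for w N
  proof (rule diff_eqI)
    fix f
    have *: "lookup (f \<diamondop> e \<diamondop> inv_form w (N + s)) 0 = (\<Sum>j=1..r. w j * ev (N + s) (f * e) j)"
      by (simp add: lookup_0_inv_form flip: diff_act_mult)
    have "ev (N + s) (f * e) j = ev N f j * ev s e j" for j
      by (rule ev_mult_homogeneous) (rule e(2))
    then have eq: "(\<Sum>j=1..r. w j * ev (N + s) (f * e) j) = (\<Sum>j=1..r. if j = i then w i * ev N f i else 0)"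
      unfolding e(1) by (intro sum.cong) (auto simp: basis_fun_def)
    note * also note eq
    also have "\<dots> = lookup (f \<diamondop> scal (w i) (divpow (p i) N)) 0"
      using i by (simp add: diff_act_scal_right lookup_scal lookup_0_diff_act_divpow ev_def)
    finally show "lookup (f \<diamondop> e \<diamondop> inv_form w (N + s)) 0 = lookup (f \<diamondop> scal (w i) (divpow (p i) N)) 0" .
  qed
  then show ?thesis by blast
qed

text \<open>If the values of \<open>f\<close> in degree \<open>N\<close> vanish, its component of
  degree \<open>N\<close> is in \<open>I(X)\<close> and kills \<open>G\<close>. So the pairing with
  \<open>hom_part N G\<close> is a combination of the evaluations at the points.\<close>

lemma perp_hom_part:
  assumes "G \<in> perp cone_ideal"
  shows "\<exists>c. hom_part N G = inv_form c N"
proof -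
  have "\<exists>c. \<forall>f. lookup (f \<diamondop> hom_part N G) 0 = (\<Sum>i\<in>{1..r}. c i * ev N f i)"
  proof (rule functional_in_span[where sc = scal])
    show "lookup ((x - y) \<diamondop> hom_part N G) 0 = lookup (x \<diamondop> hom_part N G) 0 - lookup (y \<diamondop> hom_part N G) 0" for x y
      by (simp add: diff_act_diff_left lookup_minus)
    show "lookup (scal c x \<diamondop> hom_part N G) 0 = c * lookup (x \<diamondop> hom_part N G) 0" for c x
      by (simp add: diff_act_scal_left lookup_scal)
    fix f assume "\<forall>i\<in>{1..r}. ev N f i = 0"
    then have "ev N f = 0" by (auto simp: fun_eq_iff ev_def)
    then have "hom_part N f \<in> cone_ideal" by (simp add: cone_ideal_iff ev_hom_part)
    then have "hom_part N f \<diamondop> G = 0" using assms by (simp add: perp_def)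
    then show "lookup (f \<diamondop> hom_part N G) 0 = 0" by (simp add: lookup_0_hom_part_act)
  qed (simp_all add: ev_diff ev_scal)
  then obtain c where "\<And>f. lookup (f \<diamondop> hom_part N G) 0 = (\<Sum>i=1..r. c i * ev N f i)" by blast
  then have "hom_part N G = inv_form c N" by (intro diff_eqI) (simp add: lookup_0_inv_form)
  then show ?thesis by blast
qed

text \<open>The components of an element of the left side are combinations of divided powers, and
  each divided power comes from some \<open>F_t\<close> by an isolating polynomial, divided by a
  weight that is nonzero.\<close>

lemma perp_cone_ideal:
  assumes w: "dualizing w"
  shows "perp cone_ideal = submod {inv_form w (t + s - 1) | t. t \<ge> 1}" (is "_ = submod ?B")
proof
  interpret D: Modules.module "(\<diamondop>) :: ('v, 'k) mpoly \<Rightarrow> _" by (rule module_diff_act)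
  have "D.subspace (perp cone_ideal)"
  proof (rule D.subspaceI)
    show "c \<diamondop> x \<in> perp cone_ideal" if x: "x \<in> perp cone_ideal" for c x
    proof -
      have "f \<diamondop> c \<diamondop> x = 0" if "f \<in> cone_ideal" for f
        unfolding diff_act_commute[of f c x] using x that by (simp add: perp_def diff_act_0_right)
      then show ?thesis by (simp only: perp_def mem_Collect_eq) blast
    qed
  qed (simp_all add: perp_def diff_act_0_right diff_act_add_right)
  moreover have "?B \<subseteq> perp cone_ideal" by (auto simp: perp_def cone_ideal_kills)
  ultimately show "submod ?B \<subseteq> perp cone_ideal" by (intro D.span_minimal)
  show "perp cone_ideal \<subseteq> submod ?B"
  proof
    fix G assume G: "G \<in> perp cone_ideal"
    have divpow: "divpow (p i) N \<in> submod ?B" if i: "i \<in> {1..r}" for i N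
    proof -
      obtain e where e: "\<And>w N. e \<diamondop> inv_form w (N + s) = scal (w i) (divpow (p i) N)" using inv_form_basis[OF i] by blast
      \<comment> \<open>The witness \<open>t = Suc N\<close> accounts for the shift, since
        \<open>t + s - 1 = N + s\<close>.\<close>
      have "inv_form w (N + s) \<in> ?B" by (intro CollectI exI[of _ "Suc N"]) simp
      then have "(const (1 / w i) * e) \<diamondop> inv_form w (N + s) \<in> submod ?B" by (intro D.span_scale D.span_base)
      then show ?thesis using dualizing_nonzero[OF w i] by (simp add: diff_act_mult e diff_act_const)
    qed
    have inv: "inv_form c N \<in> submod ?B" for c N
      unfolding inv_form_def[of c N]
    proof (rule D.span_sum)
      fix i assume "i \<in> {1..r}"
      then have "const (c i) \<diamondop> divpow (p i) N \<in> submod ?B" by (intro D.span_scale divpow)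
      then show "scal (c i) (divpow (p i) N) \<in> submod ?B" by (simp only: diff_act_const)
    qed
    obtain M where "\<forall>m\<in>keys G. total_deg m \<le> M" using total_deg_bounded by blast
    then have "G = (\<Sum>N\<le>M. hom_part N G)" by (simp add: sum_hom_part)
    also have "\<dots> \<in> submod ?B"
    proof (rule D.span_sum)
      fix N
      obtain c where "hom_part N G = inv_form c N" using perp_hom_part[OF G] by blast
      then show "hom_part N G \<in> submod ?B" using inv by simp
    qed
    finally show "G \<in> submod ?B" .
  qed
qed

text \<open>The annihilator of \<open>F_t\<close> is \<open>I(X) + (z^t)\<close>, and
  \<open>z^t\<close> takes \<open>F_(t+1)\<close> to \<open>F_1\<close>.\<close>

lemma G_admissible_inv_form:
  assumes w: "dualizing w"
  shows "G_admissible z (\<lambda>t. inv_form w (t + s - 1))"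
  unfolding G_admissible_def
proof (intro conjI allI impI)
  have bal: "balanced w" using w by (simp add: dualizing_def)
  show "z \<diamondop> inv_form w (t + s - 1) = inv_form w (t - 1 + s - 1)" if "t > 1" for t
  proof -
    have eq: "Suc (t - 1 + s - 1) = t + s - 1" using that s_pos by simp
    show ?thesis using z_inv_form[of w "t - 1 + s - 1"] by (simp only: eq)
  qed
  show "z \<diamondop> inv_form w (1 + s - 1) = 0" using z_inv_form_s[OF bal] by simp
  fix t :: nat assume t: "t \<ge> 1"
  then obtain n where n: "t = Suc n" by (cases t) auto
  have "{g \<diamondop> inv_form w (Suc n + s) | g. g \<in> Ann (submod {inv_form w (n + s)})} = submod {inv_form w s}"
  proof (intro antisym subsetI)
    fix y assume "y \<in> {g \<diamondop> inv_form w (Suc n + s) | g. g \<in> Ann (submod {inv_form w (n + s)})}"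
    then obtain g where y: "y = g \<diamondop> inv_form w (Suc n + s)" and g: "g \<in> Ann (submod {inv_form w (n + s)})" by blast
    have "inv_form w (n + s) \<in> submod {inv_form w (n + s)}"
      unfolding submod_singleton by (metis diff_act_one rangeI)
    then have "g \<diamondop> inv_form w (n + s) = 0" using g by (simp add: Ann_def)
    then obtain h where h: "g - z ^ Suc n * h \<in> cone_ideal" using annihilator_inv_form_power[OF w] by blast
    have "y = (z ^ Suc n * h) \<diamondop> inv_form w (Suc n + s)"
      using cone_ideal_kills[OF h, of w "Suc n + s"] by (simp add: diff_act_diff_left y)
    also have "\<dots> = h \<diamondop> z ^ Suc n \<diamondop> inv_form w (Suc n + s)"
      by (subst diff_act_commute) (simp only: diff_act_mult)
    also have "\<dots> = h \<diamondop> inv_form w s" by (simp only: z_power_inv_form)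
    finally show "y \<in> submod {inv_form w s}" unfolding submod_singleton by blast
  next
    fix y assume "y \<in> submod {inv_form w s}"
    then obtain h where y: "y = h \<diamondop> inv_form w s" unfolding submod_singleton by blast
    have "(h * z ^ Suc n) \<diamondop> inv_form w (Suc n + s) = y"
      by (simp only: y diff_act_mult z_power_inv_form)
    \<comment> \<open>Here \<open>z ^ n\<close> takes \<open>inv_form w (n + s)\<close> to
      \<open>inv_form w s\<close>, and the remaining factor \<open>z\<close> kills that by condition
      (a).\<close>
    moreover have "(h * z ^ Suc n) \<in> Ann (submod {inv_form w (n + s)})"
    proof -
      have "(h * z ^ Suc n) \<diamondop> g \<diamondop> inv_form w (n + s) = g \<diamondop> h \<diamondop> z \<diamondop> z ^ n \<diamondop> inv_form w (n + s)" for g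
        by (simp add: mult_ac flip: diff_act_mult)
      then show ?thesis
        unfolding submod_singleton Ann_def
        by (auto simp: z_power_inv_form z_inv_form_s[OF bal] diff_act_0_right)
    qed
    ultimately show "y \<in> {g \<diamondop> inv_form w (Suc n + s) | g. g \<in> Ann (submod {inv_form w (n + s)})}" by blast
  qed
  then show "{g \<diamondop> inv_form w (t + 1 + s - 1) | g. g \<in> Ann (submod {inv_form w (t + s - 1)})} = submod {inv_form w (1 + s - 1)}"
    by (simp add: n)
qed

end

section \<open>Rings of fractions\<close>

lemma fraction_eqI:
  assumes A: "cring A" and P: "primeideal P A"
    and x: "x \<in> carrier A" "s \<in> carrier A - P" and y: "y \<in> carrier A" "t \<in> carrier A - P"
    and eq: "x \<otimes>\<^bsub>A\<^esub> t = y \<otimes>\<^bsub>A\<^esub> s"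
  shows "fraction A P x s = fraction A P y t"
proof -
  have "(y, t) \<in> fraction A P x s"
    using x(2) eq by (subst fraction_iff[OF A P x y]) auto
  then show ?thesis using fraction_cong[OF A P x] by simp
qed

lemma cring_localization:
  fixes A (structure)
  assumes A: "cring A" and P: "primeideal P A"
  shows "cring (localization A P)"
proof -
  interpret cring A by (rule A)
  interpret P: primeideal P A by (rule P)
  define B where "B = localization A P"
  have S: "u \<otimes> v \<in> carrier A - P" if "u \<in> carrier A - P" "v \<in> carrier A - P" for u v
    using that P.I_prime[of u v] by auto
  have one: "\<one> \<in> carrier A - P" using P.I_notcarr P.one_imp_carrier by auto
  have carr: "carrier B = {fraction A P x s | x s. x \<in> carrier A \<and> s \<in> carrier A - P}"
    and one_B: "\<one>\<^bsub>B\<^esub> = fraction A P \<one> \<one>" and zero_B: "\<zero>\<^bsub>B\<^esub> = fraction A P \<zero> \<one>"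
    by (simp_all add: localization_def B_def)
  have cases: "\<exists>x s. x \<in> carrier A \<and> s \<in> carrier A - P \<and> \<xi> = fraction A P x s" if "\<xi> \<in> carrier B" for \<xi>
    using that unfolding carr by blast
  note add = localization_add[OF A P, folded B_def] and mult = localization_mult[OF A P, folded B_def]
  have eqI: "fraction A P x s = fraction A P y t"
    if "x \<in> carrier A" "s \<in> carrier A - P" "y \<in> carrier A" "t \<in> carrier A - P" "x \<otimes> t = y \<otimes> s" for x s y t
    using that by (rule fraction_eqI[OF A P])
  have in_carr: "fraction A P x s \<in> carrier B" if "x \<in> carrier A" "s \<in> carrier A - P" for x s
    using that unfolding carr by blast
  show ?thesis
    unfolding B_def[symmetric]
  proof (rule cringI)
    show "abelian_group B"
    proof (rule abelian_groupI)
      fix \<xi> \<eta> assume XY: "\<xi> \<in> carrier B" "\<eta> \<in> carrier B"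
      obtain x s where x: "x \<in> carrier A" "s \<in> carrier A - P" "\<xi> = fraction A P x s" using cases[OF XY(1)] by blast
      obtain y t where y: "y \<in> carrier A" "t \<in> carrier A - P" "\<eta> = fraction A P y t" using cases[OF XY(2)] by blast
      show "\<xi> \<oplus>\<^bsub>B\<^esub> \<eta> \<in> carrier B"
        unfolding x(3) y(3) add[OF x(1,2) y(1,2)] using x(1,2) y(1,2) S[OF x(2) y(2)] by (intro in_carr) auto
      show "\<xi> \<oplus>\<^bsub>B\<^esub> \<eta> = \<eta> \<oplus>\<^bsub>B\<^esub> \<xi>"
        unfolding x(3) y(3) add[OF x(1,2) y(1,2)] add[OF y(1,2) x(1,2)]
        using x(1) y(1) x(2)[THEN DiffD1] y(2)[THEN DiffD1] by (simp add: m_comm a_comm)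
      fix \<zeta> assume \<zeta>: "\<zeta> \<in> carrier B"
      obtain w q where w: "w \<in> carrier A" "q \<in> carrier A - P" "\<zeta> = fraction A P w q" using cases[OF \<zeta>] by blast
      have xy: "x \<otimes> t \<oplus> y \<otimes> s \<in> carrier A" and yw: "y \<otimes> q \<oplus> w \<otimes> t \<in> carrier A"
        using x y w by auto
      show "\<xi> \<oplus>\<^bsub>B\<^esub> \<eta> \<oplus>\<^bsub>B\<^esub> \<zeta> = \<xi> \<oplus>\<^bsub>B\<^esub> (\<eta> \<oplus>\<^bsub>B\<^esub> \<zeta>)"
        unfolding x(3) y(3) w(3) add[OF x(1,2) y(1,2)] add[OF y(1,2) w(1,2)]
          add[OF xy S[OF x(2) y(2)] w(1,2)] add[OF x(1,2) yw S[OF y(2) w(2)]]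
        using x(1) y(1) w(1) x(2)[THEN DiffD1] y(2)[THEN DiffD1] w(2)[THEN DiffD1]
        by (simp add: l_distr r_distr m_ac a_ac)
    next
      show "\<zero>\<^bsub>B\<^esub> \<in> carrier B" unfolding zero_B using one by (intro in_carr) auto
      fix \<xi> assume \<xi>: "\<xi> \<in> carrier B"
      obtain x s where x: "x \<in> carrier A" "s \<in> carrier A - P" "\<xi> = fraction A P x s" using cases[OF \<xi>] by blast
      show "\<zero>\<^bsub>B\<^esub> \<oplus>\<^bsub>B\<^esub> \<xi> = \<xi>"
        unfolding x(3) zero_B add[OF zero_closed one x(1,2)] using x(1) x(2)[THEN DiffD1] by simp
      show "\<exists>\<eta>\<in>carrier B. \<eta> \<oplus>\<^bsub>B\<^esub> \<xi> = \<zero>\<^bsub>B\<^esub>"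
      proof (rule bexI)
        have nx: "\<ominus> x \<in> carrier A" using x by simp
        show "fraction A P (\<ominus> x) s \<in> carrier B" using nx x(2) by (rule in_carr)
        show "fraction A P (\<ominus> x) s \<oplus>\<^bsub>B\<^esub> \<xi> = \<zero>\<^bsub>B\<^esub>"
          unfolding x(3) zero_B add[OF nx x(2) x(1,2)]
        proof (rule eqI)
          show "s \<otimes> s \<in> carrier A - P" by (rule S[OF x(2) x(2)])
          show "\<one> \<in> carrier A - P" by (rule one)
        qed (use x(1,2) in \<open>auto simp: l_minus l_neg\<close>)
      qed
    qed
    show "comm_monoid B"
    proof (rule comm_monoidI)
      fix \<xi> \<eta> assume XY: "\<xi> \<in> carrier B" "\<eta> \<in> carrier B"
      obtain x s where x: "x \<in> carrier A" "s \<in> carrier A - P" "\<xi> = fraction A P x s" using cases[OF XY(1)] by blast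
      obtain y t where y: "y \<in> carrier A" "t \<in> carrier A - P" "\<eta> = fraction A P y t" using cases[OF XY(2)] by blast
      show "\<xi> \<otimes>\<^bsub>B\<^esub> \<eta> \<in> carrier B"
        unfolding x(3) y(3) mult[OF x(1,2) y(1,2)] using x(1,2) y(1,2) S[OF x(2) y(2)] by (intro in_carr) auto
      show "\<xi> \<otimes>\<^bsub>B\<^esub> \<eta> = \<eta> \<otimes>\<^bsub>B\<^esub> \<xi>"
        unfolding x(3) y(3) mult[OF x(1,2) y(1,2)] mult[OF y(1,2) x(1,2)]
        using x(1) y(1) x(2)[THEN DiffD1] y(2)[THEN DiffD1] by (simp add: m_comm)
      fix \<zeta> assume \<zeta>: "\<zeta> \<in> carrier B"
      obtain w q where w: "w \<in> carrier A" "q \<in> carrier A - P" "\<zeta> = fraction A P w q" using cases[OF \<zeta>] by blast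
      have xy: "x \<otimes> y \<in> carrier A" and yw: "y \<otimes> w \<in> carrier A"
        using x y w by auto
      show "\<xi> \<otimes>\<^bsub>B\<^esub> \<eta> \<otimes>\<^bsub>B\<^esub> \<zeta> = \<xi> \<otimes>\<^bsub>B\<^esub> (\<eta> \<otimes>\<^bsub>B\<^esub> \<zeta>)"
        unfolding x(3) y(3) w(3) mult[OF x(1,2) y(1,2)] mult[OF y(1,2) w(1,2)]
          mult[OF xy S[OF x(2) y(2)] w(1,2)] mult[OF x(1,2) yw S[OF y(2) w(2)]]
        using x(1) y(1) w(1) x(2)[THEN DiffD1] y(2)[THEN DiffD1] w(2)[THEN DiffD1] by (simp add: m_assoc)
    next
      show "\<one>\<^bsub>B\<^esub> \<in> carrier B" unfolding one_B using one by (intro in_carr) auto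
      fix \<xi> assume \<xi>: "\<xi> \<in> carrier B"
      obtain x s where x: "x \<in> carrier A" "s \<in> carrier A - P" "\<xi> = fraction A P x s" using cases[OF \<xi>] by blast
      show "\<one>\<^bsub>B\<^esub> \<otimes>\<^bsub>B\<^esub> \<xi> = \<xi>"
        unfolding x(3) one_B mult[OF one_closed one x(1,2)] using x(1) x(2)[THEN DiffD1] by simp
    qed
  next
    fix \<xi> \<eta> \<zeta> assume XYZ: "\<xi> \<in> carrier B" "\<eta> \<in> carrier B" "\<zeta> \<in> carrier B"
    obtain x s where x: "x \<in> carrier A" "s \<in> carrier A - P" "\<xi> = fraction A P x s" using cases[OF XYZ(1)] by blast
    obtain y t where y: "y \<in> carrier A" "t \<in> carrier A - P" "\<eta> = fraction A P y t" using cases[OF XYZ(2)] by blast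
    obtain w q where w: "w \<in> carrier A" "q \<in> carrier A - P" "\<zeta> = fraction A P w q" using cases[OF XYZ(3)] by blast
    have c: "x \<otimes> t \<oplus> y \<otimes> s \<in> carrier A" "x \<otimes> w \<in> carrier A" "y \<otimes> w \<in> carrier A"
      using x y w by auto
    have "(\<xi> \<oplus>\<^bsub>B\<^esub> \<eta>) \<otimes>\<^bsub>B\<^esub> \<zeta> = fraction A P ((x \<otimes> t \<oplus> y \<otimes> s) \<otimes> w) (s \<otimes> t \<otimes> q)"
      unfolding x(3) y(3) w(3) add[OF x(1,2) y(1,2)] mult[OF c(1) S[OF x(2) y(2)] w(1,2)] ..
    \<comment> \<open>The sum of the two products is formed with denominators
      \<open>s \<otimes> q\<close> and \<open>t \<otimes> q\<close>, hence carries an additional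
      factor \<open>q\<close>.\<close>
    also have "\<dots> = fraction A P (x \<otimes> w \<otimes> (t \<otimes> q) \<oplus> y \<otimes> w \<otimes> (s \<otimes> q)) (s \<otimes> q \<otimes> (t \<otimes> q))"
    proof (rule eqI)
      show "s \<otimes> t \<otimes> q \<in> carrier A - P" "s \<otimes> q \<otimes> (t \<otimes> q) \<in> carrier A - P"
        by (rule S[OF S[OF x(2) y(2)] w(2)], rule S[OF S[OF x(2) w(2)] S[OF y(2) w(2)]])
      have sc: "s \<in> carrier A" "t \<in> carrier A" "q \<in> carrier A" using x(2) y(2) w(2) by auto
      then show "(x \<otimes> t \<oplus> y \<otimes> s) \<otimes> w \<in> carrier A"
        "x \<otimes> w \<otimes> (t \<otimes> q) \<oplus> y \<otimes> w \<otimes> (s \<otimes> q) \<in> carrier A"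
        using x(1) y(1) w(1) by simp_all
      show "(x \<otimes> t \<oplus> y \<otimes> s) \<otimes> w \<otimes> (s \<otimes> q \<otimes> (t \<otimes> q)) =
        (x \<otimes> w \<otimes> (t \<otimes> q) \<oplus> y \<otimes> w \<otimes> (s \<otimes> q)) \<otimes> (s \<otimes> t \<otimes> q)"
        using sc x(1) y(1) w(1) by (simp add: l_distr r_distr m_ac)
    qed
    also have "\<dots> = \<xi> \<otimes>\<^bsub>B\<^esub> \<zeta> \<oplus>\<^bsub>B\<^esub> \<eta> \<otimes>\<^bsub>B\<^esub> \<zeta>"
      unfolding x(3) y(3) w(3) mult[OF x(1,2) w(1,2)] mult[OF y(1,2) w(1,2)]
        add[OF c(2) S[OF x(2) w(2)] c(3) S[OF y(2) w(2)]] ..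
    finally show "(\<xi> \<oplus>\<^bsub>B\<^esub> \<eta>) \<otimes>\<^bsub>B\<^esub> \<zeta> = \<xi> \<otimes>\<^bsub>B\<^esub> \<zeta> \<oplus>\<^bsub>B\<^esub> \<eta> \<otimes>\<^bsub>B\<^esub> \<zeta>" .
  qed
qed

lemma (in cring) is_idealI:
  assumes "J \<subseteq> carrier R" "\<zero> \<in> J" "\<And>x y. x \<in> J \<Longrightarrow> y \<in> J \<Longrightarrow> x \<oplus> y \<in> J"
    "\<And>a x. a \<in> carrier R \<Longrightarrow> x \<in> J \<Longrightarrow> a \<otimes> x \<in> J"
  shows "ideal J R"
proof (rule idealI)
  show "ring R" by (rule ring_axioms)
  show "subgroup J (add_monoid R)"
  proof (rule add.subgroupI)
    show "\<ominus> x \<in> J" if "x \<in> J" for x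
    proof -
      have "(\<ominus> \<one>) \<otimes> x \<in> J" using that by (intro assms(4)) auto
      then show ?thesis using that assms(1) by (auto simp: l_minus)
    qed
  qed (use assms in auto)
  show "a \<otimes> x \<in> J" if "a \<in> J" "x \<in> carrier R" for a x
    using that assms m_comm[of a x] by auto
qed (use assms in auto)

lemma (in ideal) unit_imp_carrier:
  assumes "cring R" "u \<in> Units R" "u \<in> I"
  shows "I = carrier R"
proof -
  have "inv u \<otimes> u \<in> I" using assms by (intro I_l_closed) auto
  then show ?thesis using assms(2) by (intro one_imp_carrier) simp
qed

text \<open>Ideals of a ring given by a type class, without the detour through carriers.\<close>

definition type_ideal :: "'a::comm_ring_1 set \<Rightarrow> bool" where
  "type_ideal J \<longleftrightarrow> 0 \<in> J \<and> (\<forall>x\<in>J. \<forall>y\<in>J. x + y \<in> J) \<and> (\<forall>a. \<forall>x\<in>J. a * x \<in> J)"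

lemma type_idealD:
  assumes "type_ideal J"
  shows "0 \<in> J" "x \<in> J \<Longrightarrow> y \<in> J \<Longrightarrow> x + y \<in> J" "x \<in> J \<Longrightarrow> y \<in> J \<Longrightarrow> x - y \<in> J"
    "x \<in> J \<Longrightarrow> a * x \<in> J" "x \<in> J \<Longrightarrow> x * a \<in> J"
proof -
  have *: "\<And>x y. x \<in> J \<Longrightarrow> y \<in> J \<Longrightarrow> x + y \<in> J" "\<And>a x. x \<in> J \<Longrightarrow> a * x \<in> J"
    using assms by (auto simp: type_ideal_def)
  show "0 \<in> J" using assms by (simp add: type_ideal_def)
  show "x \<in> J \<Longrightarrow> y \<in> J \<Longrightarrow> x + y \<in> J" "x \<in> J \<Longrightarrow> a * x \<in> J" using * by auto
  show "x \<in> J \<Longrightarrow> y \<in> J \<Longrightarrow> x - y \<in> J" using *(1)[of x "(- 1) * y"] *(2)[of y "- 1"] by simp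
  show "x \<in> J \<Longrightarrow> x * a \<in> J" using *(2)[of x a] by (simp add: mult.commute)
qed

text \<open>The quotient by \<open>I\<close> is Noetherian, said without the quotient: generation is
  expressed by minimality among ideals, which can be tested on contractions.\<close>

definition fg_modulo :: "'a::comm_ring_1 set \<Rightarrow> bool" where
  "fg_modulo I \<longleftrightarrow> (\<forall>J. type_ideal J \<and> I \<subseteq> J \<longrightarrow>
     (\<exists>S. finite S \<and> S \<subseteq> J \<and> (\<forall>J'. type_ideal J' \<and> I \<union> S \<subseteq> J' \<longrightarrow> J \<subseteq> J')))"

section \<open>Maps from a type class ring to quotients and localizations\<close>

text \<open>The coordinate ring, its localizations and their quotients all receive a map from the
  polynomials. Statements about them become statements about polynomials and a kernel, which avoids
  cosets of fractions of cosets.\<close>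

locale type_hom = cring T for T :: "('t, 'm) ring_scheme" (structure) +
  fixes \<psi> :: "'a::comm_ring_1 \<Rightarrow> 't"
  assumes closed [simp]: "\<psi> x \<in> carrier T"
    and add: "\<psi> (x + y) = \<psi> x \<oplus> \<psi> y"
    and mult: "\<psi> (x * y) = \<psi> x \<otimes> \<psi> y"
    and one: "\<psi> 1 = \<one>"
begin

definition ker :: "'a set" where "ker = {f. \<psi> f = \<zero>}"

lemma zero: "\<psi> 0 = \<zero>"
proof -
  have "\<psi> 0 \<oplus> \<psi> 0 = \<psi> 0 \<oplus> \<zero>" using add[of 0 0] by simp
  then show ?thesis by (simp only: add.l_cancel closed zero_closed)
qed

lemma type_ideal_contraction:
  assumes "ideal J T"
  shows "type_ideal {f. \<psi> f \<in> J}"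
proof -
  interpret J: ideal J T by (rule assms)
  show ?thesis
    by (auto simp: type_ideal_def zero add mult J.I_l_closed J.a_closed additive_subgroup.zero_closed[OF J.additive_subgroup_axioms])
qed

lemma type_ideal_ker: "type_ideal ker"
  using type_ideal_contraction[OF zeroideal] by (simp add: ker_def)

text \<open>The contraction of an ideal is finitely generated over \<open>I\<close>. Since every
  element of \<open>T\<close> is an image up to a unit, the images of these generators generate the
  ideal.\<close>

lemma noetherian:
  assumes I: "I \<subseteq> ker" and fg: "fg_modulo I"
    and frac: "\<And>y. y \<in> carrier T \<Longrightarrow> \<exists>f u. u \<in> Units T \<and> y \<otimes> u = \<psi> f"
  shows "noetherian_ring T"
proof (rule noetherian_ringI)
  fix J assume J: "ideal J T"
  interpret J: ideal J T by (rule J)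
  let ?J = "{f. \<psi> f \<in> J}"
  have "I \<subseteq> ?J" using I additive_subgroup.zero_closed[OF J.additive_subgroup_axioms] by (auto simp: ker_def)
  then obtain S where S: "finite S" "S \<subseteq> ?J" "\<And>J'. type_ideal J' \<Longrightarrow> I \<union> S \<subseteq> J' \<Longrightarrow> ?J \<subseteq> J'"
    using fg type_ideal_contraction[OF J] unfolding fg_modulo_def by metis
  have sub: "\<psi> ` S \<subseteq> carrier T" by auto
  interpret G: ideal "Idl (\<psi> ` S)" T using sub by (rule genideal_ideal)
  have "Idl (\<psi> ` S) \<subseteq> J" using S(2) by (intro genideal_minimal J) auto
  moreover have "J \<subseteq> Idl (\<psi> ` S)"
  proof
    fix y assume y: "y \<in> J"
    then have yc: "y \<in> carrier T" using J.a_Hcarr by blast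
    obtain f u where fu: "u \<in> Units T" "y \<otimes> u = \<psi> f" using frac[OF yc] by blast
    have "\<psi> f \<in> J" using J.I_r_closed[OF y Units_closed[OF fu(1)]] by (simp only: fu(2))
    moreover have "?J \<subseteq> {f. \<psi> f \<in> Idl (\<psi> ` S)}"
    proof (rule S(3)[OF type_ideal_contraction[OF G.is_ideal]])
      show "I \<union> S \<subseteq> {f. \<psi> f \<in> Idl (\<psi> ` S)}"
        using I genideal_self[OF sub] additive_subgroup.zero_closed[OF G.additive_subgroup_axioms]
        by (auto simp: ker_def)
    qed
    ultimately have "y \<otimes> u \<in> Idl (\<psi> ` S)" using fu by auto
    then have "y \<otimes> u \<otimes> inv u \<in> Idl (\<psi> ` S)" using fu(1) by - (rule G.I_r_closed, auto)
    moreover have "y \<otimes> u \<otimes> inv u = y" using yc fu(1) by (simp add: m_assoc Units_closed)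
    ultimately show "y \<in> Idl (\<psi> ` S)" by simp
  qed
  ultimately show "\<exists>A\<subseteq>carrier T. finite A \<and> J = Idl A" using S(1) sub by blast
qed

end

text \<open>
  The localization of \<open>'a\<close> at the maximal ideal \<open>M\<close> and its proper quotients, described by the canonical
  map \<open>\<psi>\<close>: every element is a fraction \<open>\<psi> f / \<psi> s\<close> with \<open>s \<notin> M\<close>.
\<close>

locale fraction_hom = type_hom T \<psi> for T :: "('t, 'm) ring_scheme" (structure) and \<psi> :: "'a::comm_ring_1 \<Rightarrow> 't" +
  fixes M :: "'a set"
  assumes ideal_M: "type_ideal M"
    and unit: "s \<notin> M \<Longrightarrow> \<psi> s \<in> Units T"
    and nonunit: "f \<in> M \<Longrightarrow> \<psi> f \<notin> Units T"
    and frac: "y \<in> carrier T \<Longrightarrow> \<exists>f s. s \<notin> M \<and> y \<otimes> \<psi> s = \<psi> f"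
    and inverse_mod: "s \<notin> M \<Longrightarrow> \<exists>t. s * t - 1 \<in> M"
begin

definition nonunits :: "'t set" where "nonunits = carrier T - Units T"

lemma one_notin_M: "1 \<notin> M"
  using nonunit[of 1] by (auto simp: one)

lemma mult_notin_M: "s \<notin> M \<Longrightarrow> t \<notin> M \<Longrightarrow> s * t \<notin> M"
  using nonunit[of "s * t"] Units_m_closed[OF unit unit, of s t] by (auto simp: mult)

lemma cancel_unit:
  assumes "s \<notin> M" "x \<in> carrier T" "y \<in> carrier T" "x \<otimes> \<psi> s = y \<otimes> \<psi> s"
  shows "x = y"
proof -
  have *: "x = x \<otimes> \<psi> s \<otimes> inv (\<psi> s)" if "x \<in> carrier T" for x
    using that unit[OF assms(1)] by (simp add: m_assoc)
  show ?thesis using *[OF assms(2)] *[OF assms(3)] unfolding assms(4) by (rule trans[OF _ sym])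
qed

lemma ideal_frac_iff:
  assumes J: "ideal J T" and "y \<in> carrier T" "s \<notin> M" "y \<otimes> \<psi> s = \<psi> f"
  shows "y \<in> J \<longleftrightarrow> \<psi> f \<in> J"
proof
  interpret J: ideal J T by (rule J)
  show "y \<in> J \<Longrightarrow> \<psi> f \<in> J" using assms J.I_r_closed[of y "\<psi> s"] by simp
  assume "\<psi> f \<in> J"
  then have "y \<otimes> \<psi> s \<otimes> inv (\<psi> s) \<in> J" using assms unit[OF assms(3)] by - (rule J.I_r_closed, auto)
  moreover have "y \<otimes> \<psi> s \<otimes> inv (\<psi> s) = y" using assms(2) unit[OF assms(3)] by (simp add: m_assoc)
  ultimately show "y \<in> J" by simp
qed

lemma nonunits_iff:
  assumes "y \<in> carrier T" "s \<notin> M" "y \<otimes> \<psi> s = \<psi> f"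
  shows "y \<in> nonunits \<longleftrightarrow> f \<in> M"
proof -
  have "y \<in> Units T \<longleftrightarrow> \<psi> f \<in> Units T"
  proof
    show "\<psi> f \<in> Units T" if "y \<in> Units T"
      using Units_m_closed[OF that unit[OF assms(2)]] by (simp only: assms(3))
    assume u: "\<psi> f \<in> Units T"
    have "y \<otimes> (\<psi> s \<otimes> inv (\<psi> f)) = (y \<otimes> \<psi> s) \<otimes> inv (\<psi> f)" using assms(1) u by (simp add: m_assoc)
    then have "y \<otimes> (\<psi> s \<otimes> inv (\<psi> f)) = \<one>" using assms(3) u by simp
    moreover have c: "\<psi> s \<otimes> inv (\<psi> f) \<in> carrier T" using u by simp
    ultimately show "y \<in> Units T" using assms(1) m_comm[OF assms(1) c] by (auto simp: Units_def)
  qed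
  then show ?thesis using assms unit[of f] nonunit[of f] by (auto simp: nonunits_def)
qed

text \<open>A fraction is a nonunit exactly if its numerator is in \<open>M\<close>, and numerators
  can be computed over a common denominator.\<close>

lemma ideal_nonunits: "ideal nonunits T"
proof (rule is_idealI)
  show "nonunits \<subseteq> carrier T" by (auto simp: nonunits_def)
  show "\<zero> \<in> nonunits" using nonunit[OF type_idealD(1)[OF ideal_M]] unfolding zero nonunits_def by blast
  fix x assume x: "x \<in> nonunits"
  then have xc: "x \<in> carrier T" by (simp add: nonunits_def)
  then obtain f s where f: "s \<notin> M" "x \<otimes> \<psi> s = \<psi> f" using frac by blast
  then have fM: "f \<in> M" using nonunits_iff[OF xc f] x by simp
  show "x \<oplus> y \<in> nonunits" if y: "y \<in> nonunits" for y
  proof -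
    have yc: "y \<in> carrier T" using y by (simp add: nonunits_def)
    then obtain g t where g: "t \<notin> M" "y \<otimes> \<psi> t = \<psi> g" using frac by blast
    then have gM: "g \<in> M" using nonunits_iff[OF yc g] y by simp
    have "(x \<oplus> y) \<otimes> \<psi> (s * t) = (x \<otimes> \<psi> s) \<otimes> \<psi> t \<oplus> (y \<otimes> \<psi> t) \<otimes> \<psi> s"
      using xc yc m_comm[of "\<psi> t" "\<psi> s"] by (simp add: mult l_distr m_assoc)
    also have "\<dots> = \<psi> (f * t + g * s)" unfolding f(2) g(2) add mult ..
    finally have eq: "(x \<oplus> y) \<otimes> \<psi> (s * t) = \<psi> (f * t + g * s)" .
    have "f * t + g * s \<in> M" by (intro type_idealD(2)[OF ideal_M] type_idealD(5)[OF ideal_M] fM gM)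
    then show ?thesis using nonunits_iff[OF _ mult_notin_M[OF f(1) g(1)] eq] xc yc by simp
  qed
  show "a \<otimes> x \<in> nonunits" if a: "a \<in> carrier T" for a
  proof -
    obtain g t where g: "t \<notin> M" "a \<otimes> \<psi> t = \<psi> g" using frac[OF a] by blast
    have "(a \<otimes> x) \<otimes> \<psi> (t * s) = (a \<otimes> \<psi> t) \<otimes> (x \<otimes> \<psi> s)" using xc a by (simp add: mult m_ac)
    also have "\<dots> = \<psi> (g * f)" unfolding f(2) g(2) mult ..
    finally have eq: "(a \<otimes> x) \<otimes> \<psi> (t * s) = \<psi> (g * f)" .
    have "g * f \<in> M" by (rule type_idealD(4)[OF ideal_M fM])
    then show ?thesis using nonunits_iff[OF _ mult_notin_M[OF g(1) f(1)] eq] xc a by simp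
  qed
qed

lemma proper_ideal_subset: 
  assumes "ideal J T" "J \<noteq> carrier T"
  shows "J \<subseteq> nonunits"
proof
  fix x assume x: "x \<in> J"
  have "x \<notin> Units T" using ideal.unit_imp_carrier[OF assms(1) cring_axioms _ x] assms(2) by blast
  then show "x \<in> nonunits" using ideal.Icarr[OF assms(1) x] by (simp add: nonunits_def)
qed

lemma nonunits_neq_carrier: "carrier T \<noteq> nonunits"
proof -
  have "\<one> \<in> carrier T" "\<one> \<notin> nonunits" by (simp_all add: nonunits_def)
  then show ?thesis by blast
qed

lemma maximalideal_iff: "maximalideal J T \<longleftrightarrow> J = nonunits"
proof
  assume "maximalideal J T"
  then interpret J: maximalideal J T .
  have "J \<subseteq> nonunits" using J.I_notcarr by (intro proper_ideal_subset J.is_ideal) simp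
  moreover have "nonunits \<subseteq> carrier T" by (auto simp: nonunits_def)
  ultimately have "nonunits = J \<or> nonunits = carrier T" by (rule J.I_maximal[OF ideal_nonunits])
  then show "J = nonunits" using nonunits_neq_carrier by blast
next
  assume J: "J = nonunits"
  show "maximalideal J T"
    unfolding J
  proof (rule maximalidealI[OF ideal_nonunits nonunits_neq_carrier])
    fix J' assume "ideal J' T" "nonunits \<subseteq> J'" "J' \<subseteq> carrier T"
    then show "J' = nonunits \<or> J' = carrier T" using proper_ideal_subset[of J'] by blast
  qed
qed

lemma local_ring: "local_ring T"
  unfolding local_ring_def maximalideal_iff using cring_axioms by simp

lemma max_ideal: "max_ideal T = nonunits"
  unfolding max_ideal_def maximalideal_iff by simp

lemma noetherian_fraction:
  assumes "I \<subseteq> ker" "fg_modulo I"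
  shows "noetherian_ring T"
  using assms
proof (rule noetherian)
  fix y assume y: "y \<in> carrier T"
  obtain f s where "s \<notin> M" "y \<otimes> \<psi> s = \<psi> f" using frac[OF y] by blast
  then show "\<exists>f u. u \<in> Units T \<and> y \<otimes> u = \<psi> f" using unit[of s] by blast
qed

section \<open>Gorenstein rings of dimension zero through representatives\<close>

definition socle_reps :: "'a set" where
  "socle_reps = {a. a \<notin> ker \<and> (\<forall>x\<in>M. x * a \<in> ker)}"

lemma psi_in_nonunits: "x \<in> M \<Longrightarrow> \<psi> x \<in> nonunits"
  using nonunit by (simp add: nonunits_def)

lemma socle_iff:
  assumes "y \<in> carrier T" "s \<notin> M" "y \<otimes> \<psi> s = \<psi> a"
  shows "y \<in> socle T \<longleftrightarrow> (\<forall>x\<in>M. x * a \<in> ker)"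
proof
  assume y: "y \<in> socle T"
  show "\<forall>x\<in>M. x * a \<in> ker"
  proof
    fix x assume "x \<in> M"
    then have "y \<otimes> \<psi> x = \<zero>" using y psi_in_nonunits by (simp add: socle_def max_ideal)
    then have "(y \<otimes> \<psi> x) \<otimes> \<psi> s = \<zero>" by simp
    also have "(y \<otimes> \<psi> x) \<otimes> \<psi> s = \<psi> x \<otimes> (y \<otimes> \<psi> s)" using assms(1) by (simp add: m_ac)
    finally show "x * a \<in> ker" using assms by (simp add: ker_def mult)
  qed
next
  assume a: "\<forall>x\<in>M. x * a \<in> ker"
  have "y \<otimes> x = \<zero>" if x: "x \<in> nonunits" for x
  proof -
    have xc: "x \<in> carrier T" using x by (simp add: nonunits_def)
    obtain f t where f: "t \<notin> M" "x \<otimes> \<psi> t = \<psi> f" using frac[OF xc] by blast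
    then have "f \<in> M" using nonunits_iff[OF xc f] x by simp
    then have "\<psi> f \<otimes> \<psi> a = \<zero>" using a by (simp add: ker_def mult)
    have "(y \<otimes> x) \<otimes> \<psi> (t * s) = (x \<otimes> \<psi> t) \<otimes> (y \<otimes> \<psi> s)" using assms(1) xc by (simp add: mult m_ac)
    also have "\<dots> = \<zero> \<otimes> \<psi> (t * s)" using assms f \<open>\<psi> f \<otimes> \<psi> a = \<zero>\<close> by simp
    finally have "(y \<otimes> x) \<otimes> \<psi> (t * s) = \<zero> \<otimes> \<psi> (t * s)" .
    then show ?thesis using assms(1) xc by - (rule cancel_unit[OF mult_notin_M[OF f(1) assms(2)]], auto)
  qed
  then show "y \<in> socle T" using assms by (simp add: socle_def max_ideal)
qed

lemma psi_socle_iff: "\<psi> a \<in> socle T \<longleftrightarrow> (\<forall>x\<in>M. x * a \<in> ker)"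
  by (rule socle_iff[OF _ one_notin_M]) (simp_all add: one)

lemma zero_frac_iff:
  assumes "y \<in> carrier T" "s \<notin> M" "y \<otimes> \<psi> s = \<psi> a"
  shows "y = \<zero> \<longleftrightarrow> a \<in> ker"
  using ideal_frac_iff[OF zeroideal assms] by (simp add: ker_def)

text \<open>Nilpotence of \<open>M\<close> forces every prime to be the maximal ideal. A nonzero
  ideal inside the socle contains the image of one representative, of which all others are
  multiples.\<close>

lemma zero_dim_gorensteinI:
  assumes noeth: "noetherian_ring T"
    and nil: "\<And>f. f \<in> M \<Longrightarrow> \<exists>n. f ^ n \<in> ker"
    and ex: "socle_reps \<noteq> {}"
    and simple: "\<And>a a'. a \<in> socle_reps \<Longrightarrow> a' \<in> socle_reps \<Longrightarrow> \<exists>g. a' - g * a \<in> ker"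
  shows "zero_dim_gorenstein T"
  unfolding zero_dim_gorenstein_def
proof (intro conjI allI impI)
  show "noetherian_ring T" by (rule noeth)
  show "local_ring T" by (rule local_ring)
  show "P = max_ideal T" if "primeideal P T" for P
  proof -
    interpret P: primeideal P T by (rule that)
    have "P \<subseteq> nonunits" using P.I_notcarr by (intro proper_ideal_subset P.is_ideal) auto
    moreover have "nonunits \<subseteq> P"
    proof
      fix y assume y: "y \<in> nonunits"
      then have yc: "y \<in> carrier T" by (simp add: nonunits_def)
      obtain f s where f: "s \<notin> M" "y \<otimes> \<psi> s = \<psi> f" using frac[OF yc] by blast
      then have "f \<in> M" using nonunits_iff[OF yc f] y by simp
      then obtain n where "f ^ n \<in> ker" using nil by blast
      then have "\<psi> (f ^ n) \<in> P"
        using additive_subgroup.zero_closed[OF P.additive_subgroup_axioms] by (simp add: ker_def)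
      then have "\<psi> f \<in> P"
      proof (induction n)
        case 0
        then show ?case using P.I_notcarr P.one_imp_carrier by (simp add: one)
      next
        case (Suc n)
        then show ?case using P.I_prime[of "\<psi> f" "\<psi> (f ^ n)"] by (auto simp: mult)
      qed
      then show "y \<in> P" using ideal_frac_iff[OF P.is_ideal yc f] by simp
    qed
    ultimately show ?thesis by (simp add: max_ideal)
  qed
  obtain a where a: "a \<in> socle_reps" using ex by blast
  then have "\<psi> a \<in> socle T" "\<psi> a \<noteq> \<zero>" by (auto simp: psi_socle_iff socle_reps_def ker_def)
  then show "socle T \<noteq> {\<zero>}" by blast
  fix J assume J: "ideal J T \<and> J \<subseteq> socle T"
  then interpret J: ideal J T by simp
  show "J = {\<zero>} \<or> J = socle T"
  proof (cases "J = {\<zero>}")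
    case False
    then obtain y where y: "y \<in> J" "y \<noteq> \<zero>"
      using additive_subgroup.zero_closed[OF J.additive_subgroup_axioms] by blast
    then have yc: "y \<in> carrier T" using J.Icarr by blast
    obtain a s where a: "s \<notin> M" "y \<otimes> \<psi> s = \<psi> a" using frac[OF yc] by blast
    have "\<psi> a \<in> J" using ideal_frac_iff[OF J.is_ideal yc a] y by simp
    then have a_rep: "a \<in> socle_reps"
      using J psi_socle_iff[of a] zero_frac_iff[OF yc a] y by (auto simp: socle_reps_def)
    have "socle T \<subseteq> J"
    proof
      fix y' assume y': "y' \<in> socle T"
      then have yc': "y' \<in> carrier T" by (simp add: socle_def)
      obtain a' s' where a': "s' \<notin> M" "y' \<otimes> \<psi> s' = \<psi> a'" using frac[OF yc'] by blast
      have "\<psi> a' \<in> J"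
      proof (cases "a' \<in> ker")
        case True
        then show ?thesis using additive_subgroup.zero_closed[OF J.additive_subgroup_axioms] by (simp add: ker_def)
      next
        case False
        then have "a' \<in> socle_reps" using socle_iff[OF yc' a'] y' by (simp add: socle_reps_def)
        then obtain g where "a' - g * a \<in> ker" using simple[OF a_rep] by blast
        then have "\<psi> (a' - g * a) = \<zero>" by (simp add: ker_def)
        then have "\<psi> a' = \<psi> (g * a)" using add[of "a' - g * a" "g * a"] by simp
        then show ?thesis using \<open>\<psi> a \<in> J\<close> by (simp add: mult J.I_l_closed)
      qed
      then show "y' \<in> J" using ideal_frac_iff[OF J.is_ideal yc' a'] by simp
    qed
    then show ?thesis using J by blast
  qed simp
qed

lemma zero_dim_gorensteinD:
  assumes T: "zero_dim_gorenstein T"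
  shows "socle_reps \<noteq> {}"
    and "a \<in> socle_reps \<Longrightarrow> a' \<in> socle_reps \<Longrightarrow> \<exists>g. a' - g * a \<in> ker"
proof -
  have "\<psi> 0 \<in> socle T" unfolding psi_socle_iff using type_idealD(1)[OF type_ideal_ker] by simp
  then have "\<zero> \<in> socle T" by (simp add: zero)
  then obtain y where y: "y \<in> socle T" "y \<noteq> \<zero>" using T by (auto simp: zero_dim_gorenstein_def)
  then have yc: "y \<in> carrier T" by (simp add: socle_def)
  obtain f s where f: "s \<notin> M" "y \<otimes> \<psi> s = \<psi> f" using frac[OF yc] by blast
  have "f \<in> socle_reps" using socle_iff[OF yc f] zero_frac_iff[OF yc f] y by (simp add: socle_reps_def)
  then show "socle_reps \<noteq> {}" by blast
  assume a: "a \<in> socle_reps" and a': "a' \<in> socle_reps"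
  have as: "\<psi> a \<in> socle T" and a's: "\<psi> a' \<in> socle T" using a a' by (auto simp: psi_socle_iff socle_reps_def)
  have J: "ideal (PIdl (\<psi> a)) T" by (rule cgenideal_ideal) simp
  have "PIdl (\<psi> a) \<subseteq> socle T"
    using as by (auto simp: cgenideal_def socle_def m_assoc max_ideal nonunits_def)
  moreover have "\<psi> a \<in> PIdl (\<psi> a)" by (rule cgenideal_self) simp
  then have "PIdl (\<psi> a) \<noteq> {\<zero>}" using a by (auto simp: socle_reps_def ker_def)
  ultimately have "PIdl (\<psi> a) = socle T" using T J by (auto simp: zero_dim_gorenstein_def)
  then obtain x where x: "x \<in> carrier T" "\<psi> a' = x \<otimes> \<psi> a" using a's by (auto simp: cgenideal_def)
  obtain g s where g: "s \<notin> M" "x \<otimes> \<psi> s = \<psi> g" using frac[OF x(1)] by blast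
  have "\<psi> (s * a') = \<psi> s \<otimes> (x \<otimes> \<psi> a)" by (simp add: mult x(2))
  also have "\<dots> = (x \<otimes> \<psi> s) \<otimes> \<psi> a" using x(1) by (simp add: m_ac)
  also have "\<dots> = \<psi> (g * a)" by (simp add: g(2) mult)
  finally have "\<psi> (s * a') = \<psi> (g * a)" .
  then have "\<psi> (s * a' - g * a) \<oplus> \<psi> (g * a) = \<zero> \<oplus> \<psi> (g * a)" using add[of "s * a' - g * a" "g * a"] by simp
  then have k: "s * a' - g * a \<in> ker" unfolding ker_def by (simp only: add.r_cancel closed zero_closed mem_Collect_eq)
  \<comment> \<open>The multiplier found so far is the fraction \<open>g / s\<close>. Because
    \<open>s * t - 1\<close> lies in \<open>M\<close> and kills the socle element \<open>a'\<close>,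
    the factor \<open>t\<close> serves as the inverse of \<open>s\<close> on it.\<close>
  obtain t where "s * t - 1 \<in> M" using inverse_mod[OF g(1)] by blast
  then have k': "(s * t - 1) * a' \<in> ker" using a' by (simp add: socle_reps_def)
  have "t * (s * a' - g * a) - (s * t - 1) * a' \<in> ker"
    by (rule type_idealD(3)[OF type_ideal_ker type_idealD(4)[OF type_ideal_ker k] k'])
  also have "t * (s * a' - g * a) - (s * t - 1) * a' = a' - (t * g) * a" by (simp add: algebra_simps)
  finally show "\<exists>g. a' - g * a \<in> ker" by blast
qed

end

section \<open>Quotients and localizations\<close>

lemma ideal_of_type_ideal:
  assumes "type_ideal J"
  shows "ideal J (ring_of_type_algebra :: 'a::comm_ring_1 ring)"
proof -
  interpret cring "ring_of_type_algebra :: 'a ring" by (rule cring_from_type_algebra)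
  show ?thesis
    using type_idealD[OF assms] by (intro is_idealI) (simp_all add: ring_of_type_algebra_def)
qed

lemma (in ideal) coset_eq_zero_iff:
  assumes "x \<in> carrier R"
  shows "I +> x = \<zero>\<^bsub>R Quot I\<^esub> \<longleftrightarrow> x \<in> I"
  using assms rcos_const_imp_mem[of x] a_rcos_const[of x] by (auto simp: FactRing_def)

lemma (in ideal) carrier_quotient: "carrier (R Quot I) = (+>) I ` carrier R"
  by (auto simp: FactRing_def A_RCOSETS_def')

lemma type_hom_quotient:
  fixes I :: "'a::comm_ring_1 set"
  assumes "type_ideal I"
  defines "R \<equiv> ring_of_type_algebra :: 'a ring"
  shows "type_hom (R Quot I) (\<lambda>f. I +>\<^bsub>R\<^esub> f)" "carrier (R Quot I) = range (\<lambda>f. I +>\<^bsub>R\<^esub> f)"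
    "I +>\<^bsub>R\<^esub> f = \<zero>\<^bsub>R Quot I\<^esub> \<longleftrightarrow> f \<in> I"
proof -
  interpret R: cring R unfolding R_def by (rule cring_from_type_algebra)
  interpret I: ideal I R unfolding R_def by (rule ideal_of_type_ideal[OF assms(1)])
  interpret A: cring "R Quot I" by (rule I.quotient_is_cring[OF R.cring_axioms])
  note hom = I.rcos_ring_hom
  have carr: "x \<in> carrier R" for x by (simp add: R_def ring_of_type_algebra_def)
  have ops: "x \<oplus>\<^bsub>R\<^esub> y = x + y" "x \<otimes>\<^bsub>R\<^esub> y = x * y" "\<one>\<^bsub>R\<^esub> = 1" for x y
    by (simp_all add: R_def ring_of_type_algebra_def)
  show "type_hom (R Quot I) (\<lambda>f. I +>\<^bsub>R\<^esub> f)"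
  proof unfold_locales
    fix x y
    show "I +>\<^bsub>R\<^esub> x \<in> carrier (R Quot I)" by (rule ring_hom_closed[OF hom carr])
    show "I +>\<^bsub>R\<^esub> (x + y) = (I +>\<^bsub>R\<^esub> x) \<oplus>\<^bsub>R Quot I\<^esub> (I +>\<^bsub>R\<^esub> y)"
      using ring_hom_add[OF hom carr carr, of x y] by (simp add: ops)
    show "I +>\<^bsub>R\<^esub> (x * y) = (I +>\<^bsub>R\<^esub> x) \<otimes>\<^bsub>R Quot I\<^esub> (I +>\<^bsub>R\<^esub> y)"
      using ring_hom_mult[OF hom carr carr, of x y] by (simp add: ops)
    show "I +>\<^bsub>R\<^esub> 1 = \<one>\<^bsub>R Quot I\<^esub>"
      using ring_hom_one[OF hom] by (simp add: ops)
  qed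
  show "carrier (R Quot I) = range (\<lambda>f. I +>\<^bsub>R\<^esub> f)"
    using I.carrier_quotient carr by auto
  show "I +>\<^bsub>R\<^esub> f = \<zero>\<^bsub>R Quot I\<^esub> \<longleftrightarrow> f \<in> I" by (rule I.coset_eq_zero_iff[OF carr])
qed

context fraction_hom
begin

lemma fraction_hom_quotient:
  assumes J: "ideal J T" and proper: "J \<noteq> carrier T"
  shows "fraction_hom (T Quot J) (\<lambda>f. J +> \<psi> f) M"
    and "type_hom.ker (T Quot J) (\<lambda>f. J +> \<psi> f) = {f. \<psi> f \<in> J}"
proof -
  interpret J: ideal J T by (rule J)
  interpret A: cring "T Quot J" by (rule J.quotient_is_cring[OF cring_axioms])
  note hom = J.rcos_ring_hom
  interpret Q: type_hom "T Quot J" "\<lambda>f. J +> \<psi> f"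
  proof unfold_locales
    fix x y
    show "J +> \<psi> x \<in> carrier (T Quot J)" by (rule ring_hom_closed[OF hom closed])
    show "J +> \<psi> (x + y) = (J +> \<psi> x) \<oplus>\<^bsub>T Quot J\<^esub> (J +> \<psi> y)"
      using ring_hom_add[OF hom closed closed, of x y] by (simp add: add)
    show "J +> \<psi> (x * y) = (J +> \<psi> x) \<otimes>\<^bsub>T Quot J\<^esub> (J +> \<psi> y)"
      using ring_hom_mult[OF hom closed closed, of x y] by (simp add: mult)
    show "J +> \<psi> 1 = \<one>\<^bsub>T Quot J\<^esub>"
      using ring_hom_one[OF hom] by (simp add: one)
  qed
  show "Q.ker = {f. \<psi> f \<in> J}"
    unfolding Q.ker_def using J.coset_eq_zero_iff[OF closed] by simp
  have JN: "J \<subseteq> nonunits" using J proper by (rule proper_ideal_subset)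
  show "fraction_hom (T Quot J) (\<lambda>f. J +> \<psi> f) M"
  proof unfold_locales
    show "type_ideal M" by (rule ideal_M)
    show "\<exists>t. s * t - 1 \<in> M" if "s \<notin> M" for s using that by (rule inverse_mod)
    show "J +> \<psi> s \<in> Units (T Quot J)" if "s \<notin> M" for s
    proof -
      have u: "\<psi> s \<in> Units T" using that by (rule unit)
      have c: "inv (\<psi> s) \<in> carrier T" using u by simp
      have "(J +> \<psi> s) \<otimes>\<^bsub>T Quot J\<^esub> (J +> inv (\<psi> s)) = J +> (\<psi> s \<otimes> inv (\<psi> s))"
        by (rule ring_hom_mult[OF hom closed c, symmetric])
      then have "(J +> \<psi> s) \<otimes>\<^bsub>T Quot J\<^esub> (J +> inv (\<psi> s)) = \<one>\<^bsub>T Quot J\<^esub>"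
        using u ring_hom_one[OF hom] by simp
      then show ?thesis
        using A.m_comm[OF Q.closed ring_hom_closed[OF hom c], of s] ring_hom_closed[OF hom c]
        unfolding Units_def by auto
    qed
    show "J +> \<psi> f \<notin> Units (T Quot J)" if f: "f \<in> M" for f
    proof
      assume "J +> \<psi> f \<in> Units (T Quot J)"
      then obtain Y where Y: "Y \<in> carrier (T Quot J)" "(J +> \<psi> f) \<otimes>\<^bsub>T Quot J\<^esub> Y = \<one>\<^bsub>T Quot J\<^esub>"
        unfolding Units_def by auto
      then obtain y where y: "y \<in> carrier T" "Y = J +> y" using J.carrier_quotient by auto
      have "J +> (\<psi> f \<otimes> y) = J +> \<one>"
        using Y y ring_hom_mult[OF hom closed y(1), of f] ring_hom_one[OF hom] by simp
      \<comment> \<open>If the coset were a unit, 1 would be the sum of an element of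
        \<open>J\<close> and a multiple of \<open>\<psi> f\<close>, both of them nonunits.\<close>
      moreover have "\<one> \<in> J +> \<one>" by (rule J.a_rcos_self) simp
      ultimately have "\<one> \<in> J +> (\<psi> f \<otimes> y)" by simp
      then obtain j where j: "j \<in> J" "\<one> = j \<oplus> \<psi> f \<otimes> y"
        by (auto simp: a_r_coset_def')
      interpret N: ideal nonunits T by (rule ideal_nonunits)
      have "j \<oplus> \<psi> f \<otimes> y \<in> nonunits"
        using j JN psi_in_nonunits[OF f] y by (auto intro!: N.a_closed N.I_r_closed)
      then have "\<one> \<in> nonunits" unfolding j(2)[symmetric] .
      then show False by (simp add: nonunits_def)
    qed
    show "\<exists>f s. s \<notin> M \<and> Y \<otimes>\<^bsub>T Quot J\<^esub> (J +> \<psi> s) = J +> \<psi> f" if Y: "Y \<in> carrier (T Quot J)" for Y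
    proof -
      obtain y where y: "y \<in> carrier T" "Y = J +> y" using Y J.carrier_quotient by auto
      obtain f s where f: "s \<notin> M" "y \<otimes> \<psi> s = \<psi> f" using frac[OF y(1)] by blast
      have "Y \<otimes>\<^bsub>T Quot J\<^esub> (J +> \<psi> s) = J +> \<psi> f"
        using ring_hom_mult[OF hom y(1) closed, of s] f(2) y(2) by simp
      then show ?thesis using f(1) by blast
    qed
  qed
qed

text \<open>The denominator \<open>s\<close> stays: the contraction of a principal ideal is a
  saturation and can exceed the ideal generated by \<open>u\<close> and the kernel.\<close>

lemma psi_in_principal_iff: "\<psi> h \<in> Idl {\<psi> u} \<longleftrightarrow> (\<exists>s e. s \<notin> M \<and> s * h - u * e \<in> ker)"
proof -
  have eq: "Idl {\<psi> u} = PIdl (\<psi> u)" by (simp add: cgenideal_eq_genideal)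
  have J: "ideal (PIdl (\<psi> u)) T" by (rule cgenideal_ideal) simp
  have psi_eq: "\<psi> x = \<psi> y \<longleftrightarrow> x - y \<in> ker" for x y
  proof
    assume "\<psi> x = \<psi> y"
    then have "\<psi> (x - y) \<oplus> \<psi> y = \<zero> \<oplus> \<psi> y" using add[of "x - y" y] by simp
    then show "x - y \<in> ker" unfolding ker_def by (simp only: add.r_cancel closed zero_closed mem_Collect_eq)
  next
    assume "x - y \<in> ker"
    then show "\<psi> x = \<psi> y" using add[of "x - y" y] by (simp add: ker_def)
  qed
  show ?thesis unfolding eq
  proof
    assume "\<psi> h \<in> PIdl (\<psi> u)"
    then obtain y where y: "y \<in> carrier T" "\<psi> h = y \<otimes> \<psi> u" by (auto simp: cgenideal_def)
    obtain e s where e: "s \<notin> M" "y \<otimes> \<psi> s = \<psi> e" using frac[OF y(1)] by blast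
    have "\<psi> (s * h) = \<psi> u \<otimes> (y \<otimes> \<psi> s)" using y(1) by (simp add: mult y(2) m_ac)
    then have "\<psi> (s * h) = \<psi> (u * e)" by (simp add: e(2) mult)
    then show "\<exists>s e. s \<notin> M \<and> s * h - u * e \<in> ker" using psi_eq e(1) by blast
  next
    assume "\<exists>s e. s \<notin> M \<and> s * h - u * e \<in> ker"
    then obtain s e where s: "s \<notin> M" "s * h - u * e \<in> ker" by blast
    then have "\<psi> (s * h) = \<psi> (u * e)" by (simp only: psi_eq)
    also have "\<dots> = \<psi> e \<otimes> \<psi> u" by (simp add: mult m_comm)
    finally have "\<psi> (s * h) \<in> PIdl (\<psi> u)" by (auto simp: cgenideal_def)
    moreover have "\<psi> h \<otimes> \<psi> s = \<psi> (s * h)" by (simp add: mult m_comm)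
    ultimately show "\<psi> h \<in> PIdl (\<psi> u)" using ideal_frac_iff[OF J closed s(1)] by blast
  qed
qed

lemma Idl_empty: "Idl {} = {\<zero>}"
proof
  show "Idl {} \<subseteq> {\<zero>}" by (rule genideal_minimal[OF zeroideal]) simp
  interpret G: ideal "Idl {}" T by (rule genideal_ideal) simp
  show "{\<zero>} \<subseteq> Idl {}" using additive_subgroup.zero_closed[OF G.additive_subgroup_axioms] by simp
qed

text \<open>A regular sequence of length one. \<open>K\<close> is the contraction of the ideal
  generated by \<open>\<psi> u\<close>, so the conditions on the quotient are conditions on
  representatives.\<close>

lemma gorenstein_localI:
  assumes noeth: "noetherian_ring T"
    and u: "u \<in> M" and regular: "\<And>f. u * f \<in> ker \<Longrightarrow> f \<in> ker"
    and K: "K = {h. \<exists>s e. s \<notin> M \<and> s * h - u * e \<in> ker}"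
    and I: "I \<subseteq> ker" "fg_modulo I"
    and nil: "\<And>f. f \<in> M \<Longrightarrow> \<exists>n. f ^ n \<in> K"
    and ex: "\<exists>a. a \<notin> K \<and> (\<forall>x\<in>M. x * a \<in> K)"
    and simple: "\<And>a a'. a \<notin> K \<Longrightarrow> a' \<notin> K \<Longrightarrow> (\<forall>x\<in>M. x * a \<in> K) \<Longrightarrow> (\<forall>x\<in>M. x * a' \<in> K) \<Longrightarrow> \<exists>g. a' - g * a \<in> K"
  shows "gorenstein_local T"
proof -
  have J: "ideal (Idl {\<psi> u}) T" by (rule genideal_ideal) simp
  have "Idl {\<psi> u} \<subseteq> nonunits"
    using psi_in_nonunits[OF u] by (intro genideal_minimal ideal_nonunits) simp
  then have proper: "Idl {\<psi> u} \<noteq> carrier T" using nonunits_neq_carrier by (auto simp: nonunits_def)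
  have reg: "regular_sequence T [\<psi> u]"
    unfolding regular_sequence_def
  proof (intro conjI allI impI ballI)
    show "set [\<psi> u] \<subseteq> carrier T" "Idl (set [\<psi> u]) \<noteq> carrier T" using proper by simp_all
    fix i y assume i: "i < length [\<psi> u]" and y: "y \<in> carrier T" "y \<otimes> [\<psi> u] ! i \<in> Idl (set (take i [\<psi> u]))"
    have "i = 0" using i by simp
    then have yz: "y \<otimes> \<psi> u = \<zero>" using y(2) by (simp add: Idl_empty)
    obtain f s where f: "s \<notin> M" "y \<otimes> \<psi> s = \<psi> f" using frac[OF y(1)] by blast
    have "\<psi> (u * f) = \<psi> s \<otimes> (y \<otimes> \<psi> u)" using y(1) by (simp add: mult m_ac flip: f(2))
    then have "u * f \<in> ker" by (simp add: yz ker_def)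
    then have "y = \<zero>" using zero_frac_iff[OF y(1) f] regular by blast
    then show "y \<in> Idl (set (take i [\<psi> u]))" using \<open>i = 0\<close> by (simp add: Idl_empty)
  qed
  interpret Q: fraction_hom "T Quot (Idl {\<psi> u})" "\<lambda>f. Idl {\<psi> u} +> \<psi> f" M
    by (rule fraction_hom_quotient[OF J proper])
  have kerQ: "Q.ker = K"
    unfolding fraction_hom_quotient(2)[OF J proper] psi_in_principal_iff K ..
  have "I \<subseteq> Q.ker"
  proof
    fix x assume "x \<in> I"
    then have "\<psi> x = \<zero>" using I by (auto simp: ker_def)
    then show "x \<in> Q.ker"
      unfolding fraction_hom_quotient(2)[OF J proper]
      using additive_subgroup.zero_closed[OF ideal.axioms(1)[OF J]] by simp
  qed
  then have nQ: "noetherian_ring (T Quot (Idl {\<psi> u}))" using I(2) by (rule Q.noetherian_fraction)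
  have "zero_dim_gorenstein (T Quot (Idl {\<psi> u}))"
    using nQ
  proof (rule Q.zero_dim_gorensteinI)
    show "\<exists>n. f ^ n \<in> Q.ker" if "f \<in> M" for f using nil[OF that] by (simp add: kerQ)
    show "Q.socle_reps \<noteq> {}" using ex by (auto simp: Q.socle_reps_def kerQ)
    show "\<exists>g. a' - g * a \<in> Q.ker" if "a \<in> Q.socle_reps" "a' \<in> Q.socle_reps" for a a'
      using that simple[of a a'] by (simp add: Q.socle_reps_def kerQ)
  qed
  then show ?thesis
    unfolding gorenstein_local_def using noeth local_ring reg by (intro conjI exI[of _ "[\<psi> u]"]) simp_all
qed

end

lemma (in type_hom) fraction_hom_localization:
  assumes surj: "carrier T = range \<psi>" and P: "primeideal P T"
    and M: "M = {f. \<psi> f \<in> P}" and inv_mod: "\<And>s. s \<notin> M \<Longrightarrow> \<exists>t. s * t - 1 \<in> M"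
  shows "fraction_hom (localization T P) (\<lambda>f. fraction T P (\<psi> f) \<one>) M"
    and "type_hom.ker (localization T P) (\<lambda>f. fraction T P (\<psi> f) \<one>) = {f. \<exists>s. s \<notin> M \<and> s * f \<in> ker}"
proof -
  define B where "B = localization T P"
  define \<phi> where "\<phi> f = fraction T P (\<psi> f) \<one>" for f
  interpret P: primeideal P T by (rule P)
  interpret B: cring B unfolding B_def by (rule cring_localization[OF cring_axioms P])
  note fmult = localization_mult[OF cring_axioms P, folded B_def]
  note fadd = localization_add[OF cring_axioms P, folded B_def]
  note feqI = fraction_eqI[OF cring_axioms P]
  have one': "\<one> \<in> carrier T - P" using P.I_notcarr P.one_imp_carrier by auto
  have carr: "carrier B = {fraction T P x s | x s. x \<in> carrier T \<and> s \<in> carrier T - P}"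
    and one_B: "\<one>\<^bsub>B\<^esub> = fraction T P \<one> \<one>" and zero_B: "\<zero>\<^bsub>B\<^esub> = fraction T P \<zero> \<one>"
    by (simp_all add: localization_def B_def)
  have notM: "\<psi> s \<in> carrier T - P" if "s \<notin> M" for s using that by (simp add: M)
  interpret H: type_hom B \<phi>
  proof unfold_locales
    fix x y
    show "\<phi> x \<in> carrier B" unfolding carr \<phi>_def using one' closed by blast
    show "\<phi> (x + y) = \<phi> x \<oplus>\<^bsub>B\<^esub> \<phi> y" unfolding \<phi>_def fadd[OF closed one' closed one'] by (simp add: add)
    show "\<phi> (x * y) = \<phi> x \<otimes>\<^bsub>B\<^esub> \<phi> y" unfolding \<phi>_def fmult[OF closed one' closed one'] by (simp add: mult)
    show "\<phi> 1 = \<one>\<^bsub>B\<^esub>" by (simp add: \<phi>_def one one_B)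
  qed
  have feq: "fraction T P x s = fraction T P y t \<longleftrightarrow> (\<exists>u\<in>carrier T - P. u \<otimes> (x \<otimes> t) = u \<otimes> (y \<otimes> s))"
    if "x \<in> carrier T" "s \<in> carrier T - P" "y \<in> carrier T" "t \<in> carrier T - P" for x s y t
    using fraction_iff[OF cring_axioms P that] fraction_cong[OF cring_axioms P that(1,2)]
      fraction_self[OF cring_axioms P that(3,4)] by blast
  have "fraction_hom B \<phi> M"
  proof unfold_locales
    show "type_ideal M" unfolding M by (rule type_ideal_contraction) (rule P.is_ideal)
    show "\<exists>t. s * t - 1 \<in> M" if "s \<notin> M" for s using that by (rule inv_mod)
    show "\<phi> s \<in> Units B" if s: "s \<notin> M" for s
    proof -
      have inB: "fraction T P \<one> (\<psi> s) \<in> carrier B" unfolding carr using notM[OF s] by blast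
      have "\<phi> s \<otimes>\<^bsub>B\<^esub> fraction T P \<one> (\<psi> s) = fraction T P (\<psi> s \<otimes> \<one>) (\<one> \<otimes> \<psi> s)"
        unfolding \<phi>_def by (rule fmult[OF closed one' one_closed notM[OF s]])
      also have "\<dots> = \<one>\<^bsub>B\<^esub>" unfolding one_B using notM[OF s] one' by (intro feqI) auto
      finally show ?thesis
        using B.m_comm[OF H.closed inB, of s] inB unfolding Units_def by auto
    qed
    show "\<phi> f \<notin> Units B" if f: "f \<in> M" for f
    proof
      assume "\<phi> f \<in> Units B"
      then obtain Y where "Y \<in> carrier B" "\<phi> f \<otimes>\<^bsub>B\<^esub> Y = \<one>\<^bsub>B\<^esub>" unfolding Units_def by auto
      then obtain x t where x: "x \<in> carrier T" "t \<in> carrier T - P" "\<phi> f \<otimes>\<^bsub>B\<^esub> fraction T P x t = \<one>\<^bsub>B\<^esub>"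
        unfolding carr by blast
      have "fraction T P (\<psi> f \<otimes> x) (\<one> \<otimes> t) = fraction T P \<one> \<one>"
        using x(3) unfolding \<phi>_def fmult[OF closed one' x(1,2)] one_B .
      then obtain w where w: "w \<in> carrier T - P" "w \<otimes> ((\<psi> f \<otimes> x) \<otimes> \<one>) = w \<otimes> (\<one> \<otimes> (\<one> \<otimes> t))"
        using feq[of "\<psi> f \<otimes> x" "\<one> \<otimes> t" \<one> \<one>] x(1,2) one' by auto
      have "(\<psi> f \<otimes> x) \<otimes> \<one> \<in> P" using f x(1) by (auto simp: M intro!: P.I_r_closed)
      then have "w \<otimes> ((\<psi> f \<otimes> x) \<otimes> \<one>) \<in> P" using DiffD1[OF w(1)] by (rule P.I_l_closed)
      then have "w \<otimes> t \<in> P" unfolding w(2) using x(2) by simp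
      then show False using P.I_prime[of w t] w(1) x(2) by blast
    qed
    show "\<exists>f s. s \<notin> M \<and> Y \<otimes>\<^bsub>B\<^esub> \<phi> s = \<phi> f" if "Y \<in> carrier B" for Y
    proof -
      obtain x t where x: "x \<in> carrier T" "t \<in> carrier T - P" "Y = fraction T P x t"
        using \<open>Y \<in> carrier B\<close> unfolding carr by blast
      obtain f s where fs: "x = \<psi> f" "t = \<psi> s" using x(1,2) surj by blast
      have sM: "s \<notin> M" using x(2) by (simp add: M fs)
      have "Y \<otimes>\<^bsub>B\<^esub> \<phi> s = fraction T P (x \<otimes> \<psi> s) (t \<otimes> \<one>)"
        unfolding x(3) \<phi>_def by (rule fmult[OF x(1,2) closed one'])
      also have "\<dots> = \<phi> f"
        unfolding \<phi>_def using x(1,2) one' by (intro feqI) (auto simp: fs m_comm)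
      finally show ?thesis using sM by blast
    qed
  qed
  then show "fraction_hom (localization T P) (\<lambda>f. fraction T P (\<psi> f) \<one>) M"
    unfolding B_def \<phi>_def .
  have "H.ker = {f. \<exists>s. s \<notin> M \<and> s * f \<in> ker}"
  proof (rule Set.set_eqI)
    fix f
    have "f \<in> H.ker \<longleftrightarrow> (\<exists>w\<in>carrier T - P. w \<otimes> (\<psi> f \<otimes> \<one>) = w \<otimes> (\<zero> \<otimes> \<one>))"
      unfolding H.ker_def \<phi>_def zero_B using feq[OF closed one' zero_closed one', of f] by simp
    also have "\<dots> \<longleftrightarrow> (\<exists>s. s \<notin> M \<and> s * f \<in> ker)"
    proof
      assume "\<exists>w\<in>carrier T - P. w \<otimes> (\<psi> f \<otimes> \<one>) = w \<otimes> (\<zero> \<otimes> \<one>)"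
      then obtain w where w: "w \<in> carrier T - P" "w \<otimes> \<psi> f = \<zero>" by auto
      obtain s where "w = \<psi> s" using w(1) surj by blast
      then show "\<exists>s. s \<notin> M \<and> s * f \<in> ker" using w by (auto simp: M ker_def mult)
    next
      assume "\<exists>s. s \<notin> M \<and> s * f \<in> ker"
      then obtain s where "s \<notin> M" "\<psi> s \<otimes> \<psi> f = \<zero>" by (auto simp: ker_def mult)
      then show "\<exists>w\<in>carrier T - P. w \<otimes> (\<psi> f \<otimes> \<one>) = w \<otimes> (\<zero> \<otimes> \<one>)"
        using notM[of s] by (intro bexI[of _ "\<psi> s"]) auto
    qed
    finally show "f \<in> H.ker \<longleftrightarrow> f \<in> {f. \<exists>s. s \<notin> M \<and> s * f \<in> ker}" by simp
  qed
  then show "type_hom.ker (localization T P) (\<lambda>f. fraction T P (\<psi> f) \<one>) = {f. \<exists>s. s \<notin> M \<and> s * f \<in> ker}"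
    unfolding B_def \<phi>_def .
qed

section \<open>The homogeneous coordinate ring of the points\<close>

locale closed_points = points_socle_degree p b r s
  for p :: "nat \<Rightarrow> 'v::finite \<Rightarrow> 'k::{alg_closed_field, field_char_0}" and b r s
begin

abbreviation mpoly_ring :: "('v, 'k) mpoly ring" where "mpoly_ring \<equiv> ring_of_type_algebra"

abbreviation coord_ring :: "('v, 'k) mpoly set ring" where "coord_ring \<equiv> mpoly_ring Quot cone_ideal"

abbreviation proj :: "('v, 'k) mpoly \<Rightarrow> ('v, 'k) mpoly set" where
  "proj f \<equiv> cone_ideal +>\<^bsub>mpoly_ring\<^esub> f"

lemma type_ideal_cone: "type_ideal cone_ideal"
  by (simp add: type_ideal_def cone_ideal_0 cone_ideal_add cone_ideal_mult)

sublocale A: type_hom coord_ring proj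
  by (rule type_hom_quotient(1)[OF type_ideal_cone])

lemma carrier_coord_ring: "carrier coord_ring = range proj"
  by (rule type_hom_quotient(2)[OF type_ideal_cone])

lemma proj_eq_zero_iff: "proj f = \<zero>\<^bsub>coord_ring\<^esub> \<longleftrightarrow> f \<in> cone_ideal"
  by (rule type_hom_quotient(3)[OF type_ideal_cone])

lemma ker_proj: "A.ker = cone_ideal"
  unfolding A.ker_def using proj_eq_zero_iff by blast

lemma proj_eq_imp: 
  assumes "proj f = proj g"
  shows "f - g \<in> cone_ideal"
proof -
  have "proj (f - g) \<oplus>\<^bsub>coord_ring\<^esub> proj g = \<zero>\<^bsub>coord_ring\<^esub> \<oplus>\<^bsub>coord_ring\<^esub> proj g"
    using A.add[of "f - g" g] assms by simp
  then have "proj (f - g) = \<zero>\<^bsub>coord_ring\<^esub>"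
    by (simp only: A.add.r_cancel A.closed A.zero_closed)
  then show ?thesis by (simp only: proj_eq_zero_iff)
qed

lemma rest_surj:
  assumes "i \<in> {1..r}"
  obtains g where "rest i g = q"
proof -
  have "rest i (\<Sum>n\<le>degree q. scal (coeff q n) (z ^ n)) = (\<Sum>n\<le>degree q. monom (coeff q n) n)"
    using assms by (simp add: line_sum line_scal rest_z_power smult_monom)
  also have "\<dots> = q" by (rule poly_as_sum_of_monoms)
  finally show ?thesis by (rule that)
qed

text \<open>
  The elements of an ideal that vanish on the first \<open>k\<close> lines restrict to an ideal of the univariate
  polynomials on the next line, which is principal. So \<open>r\<close> generators suffice modulo \<open>I(X)\<close>.
\<close>

lemma fg_modulo_cone_ideal: "fg_modulo cone_ideal"
  unfolding fg_modulo_def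
proof (intro allI impI)
  fix J :: "('v, 'k) mpoly set" assume "type_ideal J \<and> cone_ideal \<subseteq> J"
  then have J: "type_ideal J" "cone_ideal \<subseteq> J" by auto
  define J' where "J' k = {f\<in>J. \<forall>i\<in>{1..k}. rest i f = 0}" for k
  have J'_reduce: "f - g * h \<in> J' k" if "f \<in> J' k" "h \<in> J' k" for f g h k
    using that type_idealD(3)[OF J(1)] type_idealD(4)[OF J(1)] by (simp add: J'_def line_diff line_mult)
  have "\<exists>h. h \<in> J' k \<and> (\<forall>f\<in>J' k. rest (Suc k) h dvd rest (Suc k) f)" if k: "k < r" for k
  proof (cases "\<exists>f\<in>J' k. rest (Suc k) f \<noteq> 0")
    case False
    then show ?thesis using type_idealD(1)[OF J(1)] by (intro exI[of _ 0]) (auto simp: J'_def)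
  next
    case True
    have ki: "Suc k \<in> {1..r}" using k by simp
    \<comment> \<open>Least degree, so that remainders of division by \<open>h\<close> must vanish
      on this line.\<close>
    define P where "P d \<longleftrightarrow> (\<exists>f\<in>J' k. rest (Suc k) f \<noteq> 0 \<and> degree (rest (Suc k) f) = d)" for d
    have "\<exists>d. P d" using True by (auto simp: P_def)
    then have "P (LEAST d. P d)" by (rule LeastI_ex)
    then obtain h where h: "h \<in> J' k" "rest (Suc k) h \<noteq> 0" "degree (rest (Suc k) h) = (LEAST d. P d)"
      by (auto simp: P_def)
    have "rest (Suc k) h dvd rest (Suc k) f" if f: "f \<in> J' k" for f
    proof -
      obtain g where g: "rest (Suc k) g = rest (Suc k) f div rest (Suc k) h" using rest_surj[OF ki] by blast
      have m: "rest (Suc k) (f - g * h) = rest (Suc k) f mod rest (Suc k) h"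
        by (simp add: line_diff line_mult g minus_div_mult_eq_mod)
      have "rest (Suc k) f mod rest (Suc k) h = 0"
      proof (rule ccontr)
        assume nz: "rest (Suc k) f mod rest (Suc k) h \<noteq> 0"
        then have "P (degree (rest (Suc k) f mod rest (Suc k) h))"
          unfolding P_def using J'_reduce[OF f h(1)] m by metis
        then have "degree (rest (Suc k) h) \<le> degree (rest (Suc k) f mod rest (Suc k) h)"
          unfolding h(3) by (rule Least_le)
        moreover have "degree (rest (Suc k) f mod rest (Suc k) h) < degree (rest (Suc k) h)"
          using degree_mod_less[OF h(2)] nz by blast
        ultimately show False by simp
      qed
      then show ?thesis by (simp add: mod_eq_0_iff_dvd)
    qed
    then show ?thesis using h(1) by blast
  qed
  then have "\<forall>k\<in>{..<r}. \<exists>h. h \<in> J' k \<and> (\<forall>f\<in>J' k. rest (Suc k) h dvd rest (Suc k) f)" by simp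
  from bchoice[OF this] obtain h where h: "\<And>k. k < r \<Longrightarrow> h k \<in> J' k"
    "\<And>k f. k < r \<Longrightarrow> f \<in> J' k \<Longrightarrow> rest (Suc k) (h k) dvd rest (Suc k) f" by blast
  show "\<exists>S. finite S \<and> S \<subseteq> J \<and> (\<forall>J'. type_ideal J' \<and> cone_ideal \<union> S \<subseteq> J' \<longrightarrow> J \<subseteq> J')"
  proof (intro exI conjI allI impI)
    show "finite (h ` {..<r})" by simp
    show "h ` {..<r} \<subseteq> J" using h(1) by (auto simp: J'_def)
    fix L assume "type_ideal L \<and> cone_ideal \<union> h ` {..<r} \<subseteq> L"
    then have L: "type_ideal L" "cone_ideal \<subseteq> L" "\<And>k. k < r \<Longrightarrow> h k \<in> L" by auto
    \<comment> \<open>Downward induction on the number of lines, starting with all \<open>r\<close>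
      of them, where only elements of \<open>I(X)\<close> are left.\<close>
    have "J' (r - n) \<subseteq> L" if "n \<le> r" for n
      using that
    proof (induction n)
      case 0
      show ?case using L(2) by (auto simp: J'_def cone_ideal_def)
    next
      case (Suc n)
      define k where "k = r - Suc n"
      have k: "k < r" "r - n = Suc k" using Suc.prems by (simp_all add: k_def)
      show ?case
        unfolding k_def[symmetric]
      proof
        fix f assume f: "f \<in> J' k"
        obtain q where q: "rest (Suc k) f = rest (Suc k) (h k) * q" using h(2)[OF k(1) f] by (rule dvdE)
        have "Suc k \<in> {1..r}" using k(1) by simp
        then obtain g where g: "rest (Suc k) g = q" by (rule rest_surj)
        have "f - g * h k \<in> J' k" using f h(1)[OF k(1)] by (rule J'_reduce)
        moreover have "rest (Suc k) (f - g * h k) = 0" by (simp add: line_diff line_mult q g)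
        ultimately have "f - g * h k \<in> J' (Suc k)" by (auto simp: J'_def le_Suc_eq)
        then have "f - g * h k \<in> L" using Suc.IH Suc.prems k(2) by auto
        then have "(f - g * h k) + g * h k \<in> L"
          by (rule type_idealD(2)[OF L(1)]) (rule type_idealD(4)[OF L(1) L(3)[OF k(1)]])
        then show "f \<in> L" by simp
      qed
    qed
    from this[of r] have "J' 0 \<subseteq> L" by simp
    then show "J \<subseteq> L" by (simp add: J'_def)
  qed
qed

lemma noetherian_coord_ring: "noetherian_ring coord_ring"
proof (rule A.noetherian[OF _ fg_modulo_cone_ideal])
  show "cone_ideal \<subseteq> A.ker" by (simp add: ker_proj)
  fix y assume "y \<in> carrier coord_ring"
  then obtain f where "y = proj f" using carrier_coord_ring by blast
  then show "\<exists>f u. u \<in> Units coord_ring \<and> y \<otimes>\<^bsub>coord_ring\<^esub> u = proj f"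
    by (intro exI[of _ f] exI[of _ "\<one>\<^bsub>coord_ring\<^esub>"]) simp
qed

section \<open>The maximal ideals of the coordinate ring\<close>

text \<open>The ideal of the point \<open>c * p_i\<close> of affine space. For \<open>c = 0\<close>
  this is the vertex, common to all lines.\<close>

definition point_ideal :: "nat \<Rightarrow> 'k \<Rightarrow> ('v, 'k) mpoly set" where
  "point_ideal i c = {f. poly (rest i f) c = 0}"

lemma type_ideal_point_ideal: "type_ideal (point_ideal i c)"
  by (simp add: type_ideal_def point_ideal_def line_add line_mult)

lemma point_ideal_prime: "f * g \<in> point_ideal i c \<longleftrightarrow> f \<in> point_ideal i c \<or> g \<in> point_ideal i c"
  by (simp add: point_ideal_def line_mult)

lemma one_notin_point_ideal: "1 \<notin> point_ideal i c"
  by (simp add: point_ideal_def)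

lemma point_ideal_inverse:
  assumes "f \<notin> point_ideal i c"
  shows "\<exists>t. f * t - 1 \<in> point_ideal i c"
  using assms by (intro exI[of _ "const (1 / poly (rest i f) c)"])
    (simp add: point_ideal_def line_diff line_mult line_const)

lemma cone_subset_point_ideal: "i \<in> {1..r} \<Longrightarrow> cone_ideal \<subseteq> point_ideal i c"
  by (auto simp: cone_ideal_def point_ideal_def)

lemma point_ideal_0: "i \<in> {1..r} \<Longrightarrow> point_ideal i 0 = irrelevant"
  by (simp add: point_ideal_def irrelevant_def poly_0_coeff_0 coeff_line_0)

lemma proj_image_ideal: "type_ideal J \<Longrightarrow> ideal (proj ` J) coord_ring"
  by (rule ring.ring_ideal_imp_quot_ideal[OF ring_from_type_algebra ideal_of_type_ideal[OF type_ideal_cone] ideal_of_type_ideal])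

text \<open>A prime ideal above \<open>I(X)\<close> contains the ideal of one of the lines. Its
  image in the univariate polynomials is a nonzero proper prime ideal, generated by a linear
  polynomial as the field is algebraically closed.\<close>

lemma maximal_ideal_is_point_ideal:
  assumes P: "maximalideal P coord_ring"
  shows "\<exists>i\<in>{1..r}. \<exists>c. {f. proj f \<in> P} = point_ideal i c"
proof -
  interpret P: maximalideal P coord_ring by (rule P)
  define M where "M = {f. proj f \<in> P}"
  have tM: "type_ideal M" unfolding M_def by (rule A.type_ideal_contraction[OF P.is_ideal])
  have cone: "cone_ideal \<subseteq> M"
  proof
    fix x assume "x \<in> cone_ideal"
    then have "proj x = \<zero>\<^bsub>coord_ring\<^esub>" by (simp only: proj_eq_zero_iff)
    then show "x \<in> M" unfolding M_def using additive_subgroup.zero_closed[OF P.additive_subgroup_axioms] by simp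
  qed
  have prime: "f \<in> M \<or> g \<in> M" if "f * g \<in> M" for f g
    using that primeideal.I_prime[OF A.maximalideal_prime[OF P] A.closed A.closed, of f g] by (simp add: M_def A.mult)
  have one: "1 \<notin> M" using P.I_notcarr P.one_imp_carrier unfolding M_def by (simp only: mem_Collect_eq A.one) blast
  have const: "const c \<notin> M" if "c \<noteq> 0" for c
  proof
    assume "const c \<in> M"
    then have "const (1 / c) * const c \<in> M" by (rule type_idealD(4)[OF tM])
    then show False using one that by (simp add: const_def mult_single)
  qed
  have maximal: "J = M \<or> J = UNIV" if J: "type_ideal J" "M \<subseteq> J" for J
  proof -
    have "P \<subseteq> proj ` J"
    proof
      fix y assume y: "y \<in> P"
      then obtain f where "y = proj f" using P.Icarr carrier_coord_ring by blast
      then show "y \<in> proj ` J" using y J(2) by (auto simp: M_def)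
    qed
    moreover have "proj ` J \<subseteq> carrier coord_ring" unfolding carrier_coord_ring by blast
    ultimately have "proj ` J = P \<or> proj ` J = carrier coord_ring"
      by (rule P.I_maximal[OF proj_image_ideal[OF J(1)]])
    then show ?thesis
    proof
      assume "proj ` J = P"
      then have "J \<subseteq> M" by (auto simp: M_def)
      then show ?thesis using J(2) by blast
    next
      assume "proj ` J = carrier coord_ring"
      then have "proj 1 \<in> proj ` J" using A.closed[of 1] by simp
      then obtain f where f: "proj 1 = proj f" "f \<in> J" by (rule imageE)
      have "1 - f \<in> J" using proj_eq_imp[OF f(1)] cone J(2) by blast
      then have "(1 - f) + f \<in> J" using f(2) by (rule type_idealD(2)[OF J(1)])
      then have "1 \<in> J" by simp
      then have "x \<in> J" for x using type_idealD(4)[OF J(1), of 1 x] by simp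
      then show ?thesis by blast
    qed
  qed
  \<comment> \<open>Otherwise each line has a polynomial vanishing on it and lying outside
    \<open>M\<close>; their product is in \<open>I(X)\<close>, hence in \<open>M\<close>, which
    contradicts primality.\<close>
  have "\<exists>i\<in>{1..r}. \<forall>f. rest i f = 0 \<longrightarrow> f \<in> M"
  proof (rule ccontr)
    assume "\<not> ?thesis"
    then have "\<forall>i\<in>{1..r}. \<exists>f. rest i f = 0 \<and> f \<notin> M" by blast
    from bchoice[OF this] obtain f where f: "\<And>i. i \<in> {1..r} \<Longrightarrow> rest i (f i) = 0 \<and> f i \<notin> M" by blast
    have "(\<Prod>i\<in>{1..r}. f i) \<in> cone_ideal"
      unfolding cone_ideal_def
    proof (intro CollectI ballI)
      fix i assume i: "i \<in> {1..r}"
      then have "\<exists>j\<in>{1..r}. rest i (f j) = 0" using f by blast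
      then show "rest i (\<Prod>j\<in>{1..r}. f j) = 0"
        unfolding line_prod by (rule prod_zero[OF finite_atLeastAtMost])
    qed
    moreover have "(\<Prod>i\<in>S. f i) \<notin> M" if "S \<subseteq> {1..r}" for S
      using finite_subset[OF that finite_atLeastAtMost] that
    proof (induction S rule: finite_induct)
      case (insert x F)
      then show ?case using prime[of "f x" "prod f F"] f[of x] by auto
    qed (simp add: one)
    ultimately show False using cone by blast
  qed
  then obtain i where i: "i \<in> {1..r}" and ker_i: "\<And>f. rest i f = 0 \<Longrightarrow> f \<in> M" by blast
  \<comment> \<open>If all of \<open>M\<close> vanished on the line, \<open>M\<close> would be
    contained in the ideal of the vertex, hence equal to it; but that ideal contains
    \<open>z\<close>, which does not vanish on the line.\<close>
  have ex: "\<exists>f\<in>M. rest i f \<noteq> 0"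
  proof (rule ccontr)
    assume "\<not> ?thesis"
    then have M0: "rest i f = 0" if "f \<in> M" for f using that by blast
    then have "M \<subseteq> point_ideal i 0" by (auto simp: point_ideal_def)
    then have "point_ideal i 0 = M \<or> point_ideal i 0 = UNIV" by (rule maximal[OF type_ideal_point_ideal])
    then have "point_ideal i 0 = M" using one_notin_point_ideal[of i 0] by auto
    then have "z \<in> M" using i by (auto simp: point_ideal_def rest_z)
    then show False using M0[of z] i by (simp add: rest_z)
  qed
  define D where "D d \<longleftrightarrow> (\<exists>f\<in>M. rest i f \<noteq> 0 \<and> degree (rest i f) = d)" for d
  have "\<exists>d. D d" using ex by (auto simp: D_def)
  then have "D (LEAST d. D d)" by (rule LeastI_ex)
  then obtain h where h: "h \<in> M" "rest i h \<noteq> 0" "degree (rest i h) = (LEAST d. D d)" by (auto simp: D_def)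
  have "degree (rest i h) > 0"
  proof (rule ccontr)
    assume "\<not> degree (rest i h) > 0"
    then have "degree (rest i h) = 0" by simp
    then obtain c where c: "rest i h = [:c:]" by (rule degree_eq_zeroE)
    then have "h - const c \<in> M" by (intro ker_i) (simp add: line_diff line_const)
    then have "h - (h - const c) \<in> M" by (rule type_idealD(3)[OF tM h(1)])
    then show False using const[of c] c h(2) by simp
  qed
  then obtain c where "poly (rest i h) c = 0" using alg_closed_imp_poly_has_root by blast
  then have "[:- c, 1:] dvd rest i h" by (simp only: poly_eq_0_iff_dvd)
  then obtain q where q: "rest i h = [:- c, 1:] * q" by (rule dvdE)
  have rest_zc: "rest i (z - const c) = [:- c, 1:]" using i by (simp add: line_diff line_const rest_z)
  have zc: "z - const c \<in> M"
  proof -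
    obtain g where g: "rest i g = q" using i by (rule rest_surj)
    have "h - (z - const c) * g \<in> M" by (intro ker_i) (simp add: line_diff[of _ h] line_mult rest_zc q g)
    then have "h - (h - (z - const c) * g) \<in> M" by (rule type_idealD(3)[OF tM h(1)])
    then have "(z - const c) * g \<in> M" by simp
    \<comment> \<open>The restriction of \<open>g\<close> has degree one less than the minimum
      attained by \<open>h\<close>.\<close>
    moreover have "g \<notin> M"
    proof
      assume "g \<in> M"
      have "q \<noteq> 0" using h(2) q by auto
      then have "D (degree q)" unfolding D_def using \<open>g \<in> M\<close> g by blast
      then have "degree (rest i h) \<le> degree q" unfolding h(3) by (rule Least_le)
      moreover have "degree (rest i h) = Suc (degree q)" unfolding q using \<open>q \<noteq> 0\<close> by (subst degree_mult_eq) auto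
      ultimately show False by simp
    qed
    ultimately show ?thesis using prime by blast
  qed
  have sub: "point_ideal i c \<subseteq> M"
  proof
    fix f assume "f \<in> point_ideal i c"
    then have "[:- c, 1:] dvd rest i f" by (simp only: point_ideal_def mem_Collect_eq poly_eq_0_iff_dvd)
    then obtain q where q: "rest i f = [:- c, 1:] * q" by (rule dvdE)
    obtain g where g: "rest i g = q" using i by (rule rest_surj)
    have "f - (z - const c) * g \<in> M" by (intro ker_i) (simp add: line_diff[of _ f] line_mult rest_zc q g)
    then have "(f - (z - const c) * g) + (z - const c) * g \<in> M"
      by (rule type_idealD(2)[OF tM]) (rule type_idealD(5)[OF tM zc])
    then show "f \<in> M" by simp
  qed
  have "M \<subseteq> point_ideal i c"
  proof (rule ccontr)
    assume "\<not> ?thesis"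
    then obtain f where f: "f \<in> M" "poly (rest i f) c \<noteq> 0" by (auto simp: point_ideal_def)
    let ?v = "poly (rest i f) c"
    have "f - const ?v \<in> point_ideal i c" by (simp add: point_ideal_def line_diff line_const)
    then have "f - const ?v \<in> M" using sub by blast
    then have "f - (f - const ?v) \<in> M" by (rule type_idealD(3)[OF tM f(1)])
    then show False using const f(2) by simp
  qed
  then show ?thesis using sub i unfolding M_def by blast
qed

lemma fraction_hom_at:
  assumes P: "maximalideal P coord_ring" and M: "{f. proj f \<in> P} = point_ideal i c"
  shows "fraction_hom (localization coord_ring P) (\<lambda>f. fraction coord_ring P (proj f) \<one>\<^bsub>coord_ring\<^esub>) (point_ideal i c)"
    and "type_hom.ker (localization coord_ring P) (\<lambda>f. fraction coord_ring P (proj f) \<one>\<^bsub>coord_ring\<^esub>) =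
      {f. \<exists>t. t \<notin> point_ideal i c \<and> t * f \<in> cone_ideal}"
proof -
  note hom = A.fraction_hom_localization[OF carrier_coord_ring A.maximalideal_prime[OF P] M[symmetric]]
  show "fraction_hom (localization coord_ring P) (\<lambda>f. fraction coord_ring P (proj f) \<one>\<^bsub>coord_ring\<^esub>) (point_ideal i c)"
    by (rule hom(1)) (rule point_ideal_inverse)
  have "type_hom.ker (localization coord_ring P) (\<lambda>f. fraction coord_ring P (proj f) \<one>\<^bsub>coord_ring\<^esub>) =
      {f. \<exists>t. t \<notin> point_ideal i c \<and> t * f \<in> A.ker}"
    by (rule hom(2)) (rule point_ideal_inverse)
  then show "type_hom.ker (localization coord_ring P) (\<lambda>f. fraction coord_ring P (proj f) \<one>\<^bsub>coord_ring\<^esub>) =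
      {f. \<exists>t. t \<notin> point_ideal i c \<and> t * f \<in> cone_ideal}"
    by (simp only: ker_proj)
qed

text \<open>At the vertex divide by \<open>z\<close>: the contraction is \<open>Q\<close>, and the
  quotient inherits the socle of \<open>R/Q\<close>. At the point with parameter
  \<open>c \<noteq> 0\<close> divide by \<open>z - const c\<close>: the contraction is the ideal of
  the point itself, so the quotient is a field.\<close>

lemma simple_socle_imp_gorenstein:
  assumes simple_socle
  shows "gorenstein_ring coord_ring"
  unfolding gorenstein_ring_def
proof (intro conjI allI impI)
  show "noetherian_ring coord_ring" by (rule noetherian_coord_ring)
  show "cring coord_ring" by (rule A.cring_axioms)
  fix P assume P: "maximalideal P coord_ring"
  obtain i c where i: "i \<in> {1..r}" and M: "{f. proj f \<in> P} = point_ideal i c"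
    using maximal_ideal_is_point_ideal[OF P] by blast
  interpret F: fraction_hom "localization coord_ring P" "\<lambda>f. fraction coord_ring P (proj f) \<one>\<^bsub>coord_ring\<^esub>" "point_ideal i c"
    by (rule fraction_hom_at(1)[OF P M])
  have kerF: "F.ker = {f. \<exists>t. t \<notin> point_ideal i c \<and> t * f \<in> cone_ideal}"
    by (rule fraction_hom_at(2)[OF P M])
  have sub: "cone_ideal \<subseteq> F.ker"
  proof
    fix f assume "f \<in> cone_ideal"
    then have "1 \<notin> point_ideal i c \<and> 1 * f \<in> cone_ideal" using one_notin_point_ideal[of i c] by simp
    then show "f \<in> F.ker" unfolding kerF by blast
  qed
  have noeth: "noetherian_ring (localization coord_ring P)"
    by (rule F.noetherian_fraction[OF sub fg_modulo_cone_ideal])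
  show "gorenstein_local (localization coord_ring P)"
  proof (cases "c = 0")
    case True
    have M0: "point_ideal i c = irrelevant" using point_ideal_0[OF i] True by simp
    \<comment> \<open>A denominator at the vertex has a nonzero constant term, so it vanishes
      identically on no line and can be cancelled modulo \<open>I(X)\<close>.\<close>
    have ker: "F.ker = cone_ideal"
    proof
      show "F.ker \<subseteq> cone_ideal"
      proof
        fix f assume "f \<in> F.ker"
        then obtain t where t: "lookup t 0 \<noteq> 0" "t * f \<in> cone_ideal" unfolding kerF M0 by (auto simp: irrelevant_def)
        have "rest j t \<noteq> 0" for j
        proof
          assume "rest j t = 0"
          then show False using t(1) coeff_line_0[of "p j" t] by simp
        qed
        then show "f \<in> cone_ideal" using cone_ideal_cancel[OF t(2)] by blast
      qed
    qed (rule sub)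
    have K: "section_ideal = {h. \<exists>t e. t \<notin> irrelevant \<and> t * h - z * e \<in> F.ker}"
    proof (intro antisym subsetI)
      fix h assume "h \<in> section_ideal"
      then obtain e where "1 * h - z * e \<in> cone_ideal" by (auto simp: section_ideal_def)
      moreover have "1 \<notin> irrelevant" by (simp add: irrelevant_def)
      ultimately show "h \<in> {h. \<exists>t e. t \<notin> irrelevant \<and> t * h - z * e \<in> F.ker}" unfolding ker by blast
    next
      fix h assume "h \<in> {h. \<exists>t e. t \<notin> irrelevant \<and> t * h - z * e \<in> F.ker}"
      then obtain t e where t: "t \<notin> irrelevant" "t * h - z * e \<in> cone_ideal" unfolding ker by blast
      then have "t * h \<in> section_ideal" by (auto simp: section_ideal_def)
      then show "h \<in> section_ideal" using t(1) by - (rule section_ideal_saturated[of t], auto simp: irrelevant_def)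
    qed
    show ?thesis
    proof (rule F.gorenstein_localI[OF noeth _ _ _ sub fg_modulo_cone_ideal, where u = z and K = section_ideal])
      show "z \<in> point_ideal i c" using i True by (simp add: point_ideal_def rest_z)
      show "f \<in> F.ker" if "z * f \<in> F.ker" for f using that unfolding ker by (rule cone_ideal_cancel_z)
      show "section_ideal = {h. \<exists>t e. t \<notin> point_ideal i c \<and> t * h - z * e \<in> F.ker}" unfolding M0 by (rule K)
      show "\<exists>n. f ^ n \<in> section_ideal" if "f \<in> point_ideal i c" for f
      proof -
        have "f \<in> irrelevant" using that unfolding M0 .
        then have "f ^ Suc s \<in> section_ideal" by (rule ord_gt_s_in_section[OF ord_ge_power[OF ord_ge_irrelevant]])
        then show ?thesis by blast
      qed
      show "\<exists>a. a \<notin> section_ideal \<and> (\<forall>x\<in>point_ideal i c. x * a \<in> section_ideal)"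
        using socle_reps_nonempty unfolding M0 socle_reps_def by blast
      show "\<exists>g. a' - g * a \<in> section_ideal"
        if "a \<notin> section_ideal" "a' \<notin> section_ideal" "\<forall>x\<in>point_ideal i c. x * a \<in> section_ideal"
          "\<forall>x\<in>point_ideal i c. x * a' \<in> section_ideal" for a a'
      proof -
        have "a \<in> socle_reps" "a' \<in> socle_reps" using that unfolding M0 socle_reps_def by simp_all
        then show ?thesis using assms unfolding simple_socle_def by blast
      qed
    qed
  next
    case False
    let ?M = "point_ideal i c" and ?u = "z - const c"
    have rest_u: "rest j ?u = [:- c, 1:]" if "j \<in> {1..r}" for j
      using that by (simp add: line_diff line_const rest_z)
    have u: "?u \<in> ?M" using i by (simp add: point_ideal_def rest_u)
    have K: "?M = {h. \<exists>t e. t \<notin> ?M \<and> t * h - ?u * e \<in> F.ker}"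
    proof (intro antisym subsetI)
      fix h assume "h \<in> ?M"
      then have "[:- c, 1:] dvd rest i h" by (simp only: point_ideal_def mem_Collect_eq poly_eq_0_iff_dvd)
      then obtain q where q: "rest i h = [:- c, 1:] * q" by (rule dvdE)
      obtain g where g: "rest i g = q" using i by (rule rest_surj)
      \<comment> \<open>Away from the vertex the separator \<open>e\<close> is a legitimate
        denominator, with value \<open>c ^ (r - 1)\<close>. It vanishes on the other lines, so only
        divisibility by \<open>z - c\<close> on the line \<open>i\<close> has to be
        arranged.\<close>
      obtain e where e: "rest i e = monom 1 (r - 1)" "\<And>j. j \<in> {1..r} \<Longrightarrow> j \<noteq> i \<Longrightarrow> rest j e = 0"
        using separator[OF i] by blast
      have "rest j (e * h - ?u * (e * g)) = 0" if j: "j \<in> {1..r}" for j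
      proof (cases "j = i")
        case True
        have "rest i (e * h) = rest i (?u * (e * g))"
          unfolding line_mult rest_u[OF i] q g by (rule mult.left_commute)
        then show ?thesis unfolding True line_diff[of _ "e * h"] by simp
      qed (simp add: line_diff[of _ "e * h"] line_mult e(2)[OF j])
      then have "e * h - ?u * (e * g) \<in> F.ker" using sub by (auto simp: cone_ideal_def)
      moreover have "e \<notin> ?M" using False by (simp add: point_ideal_def e(1) poly_monom)
      ultimately show "h \<in> {h. \<exists>t e. t \<notin> ?M \<and> t * h - ?u * e \<in> F.ker}" by blast
    next
      fix h assume "h \<in> {h. \<exists>t e. t \<notin> ?M \<and> t * h - ?u * e \<in> F.ker}"
      then obtain t e t' where t: "t \<notin> ?M" "t' \<notin> ?M" "t' * (t * h - ?u * e) \<in> cone_ideal"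
        unfolding kerF by blast
      then have "t' * (t * h - ?u * e) \<in> ?M" using cone_subset_point_ideal[OF i] by blast
      then have "t * h - ?u * e \<in> ?M" using t(2) point_ideal_prime by blast
      then have "(t * h - ?u * e) + ?u * e \<in> ?M"
        by (rule type_idealD(2)[OF type_ideal_point_ideal]) (rule type_idealD(5)[OF type_ideal_point_ideal u])
      then have "t * h \<in> ?M" by simp
      then show "h \<in> ?M" using t(1) point_ideal_prime by blast
    qed
    show ?thesis
    proof (rule F.gorenstein_localI[OF noeth u _ K sub fg_modulo_cone_ideal])
      show "f \<in> F.ker" if f: "?u * f \<in> F.ker" for f
      proof -
        obtain t where t: "t \<notin> ?M" "t * (?u * f) \<in> cone_ideal" using f unfolding kerF by blast
        have "?u * (t * f) \<in> cone_ideal" using t(2) unfolding mult.left_commute[of ?u t f] .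
        then have "t * f \<in> cone_ideal" by (rule cone_ideal_cancel) (simp add: rest_u)
        then show ?thesis unfolding kerF using t(1) by blast
      qed
      show "\<exists>n. f ^ n \<in> ?M" if "f \<in> ?M" for f using that by (intro exI[of _ 1]) simp
      show "\<exists>a. a \<notin> ?M \<and> (\<forall>x\<in>?M. x * a \<in> ?M)"
        using one_notin_point_ideal[of i c] by (intro exI[of _ 1]) simp
      show "\<exists>g. a' - g * a \<in> ?M" if a: "a \<notin> ?M" for a a'
      proof -
        obtain t where "a * t - 1 \<in> ?M" using point_ideal_inverse[OF a] by blast
        then have "(- a') * (a * t - 1) \<in> ?M" by (rule type_idealD(4)[OF type_ideal_point_ideal])
        also have "(- a') * (a * t - 1) = a' - (a' * t) * a" by (simp add: algebra_simps)
        finally show ?thesis by blast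
      qed
    qed
  qed
qed

end

context closed_points
begin

section \<open>The local ring at the vertex\<close>

lemma type_ideal_irrelevant: "type_ideal irrelevant"
proof -
  have "1 \<in> {1..r}" using r_pos by simp
  then show ?thesis using type_ideal_point_ideal[of 1 0] by (simp only: point_ideal_0)
qed

lemma cone_subset_irrelevant: "cone_ideal \<subseteq> irrelevant"
proof -
  have "1 \<in> {1..r}" using r_pos by simp
  then show ?thesis using cone_subset_point_ideal[of 1 0] by (simp only: point_ideal_0)
qed

lemma proj_in_irrelevant_iff: "{f. proj f \<in> proj ` irrelevant} = irrelevant"
proof (intro Set.equalityI subsetI)
  fix f assume "f \<in> {f. proj f \<in> proj ` irrelevant}"
  then have "proj f \<in> proj ` irrelevant" by (rule CollectD)
  then obtain g where g: "proj f = proj g" "g \<in> irrelevant" by (rule imageE)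
  have "f - g \<in> irrelevant" using proj_eq_imp[OF g(1)] cone_subset_irrelevant by blast
  then have "(f - g) + g \<in> irrelevant" using g(2) by (rule type_idealD(2)[OF type_ideal_irrelevant])
  then show "f \<in> irrelevant" by simp
qed blast

lemma maximalideal_irrelevant: "maximalideal (proj ` irrelevant) coord_ring"
proof (rule maximalidealI)
  show "ideal (proj ` irrelevant) coord_ring" by (rule proj_image_ideal[OF type_ideal_irrelevant])
  show "carrier coord_ring \<noteq> proj ` irrelevant"
  proof
    assume "carrier coord_ring = proj ` irrelevant"
    then have "proj 1 \<in> proj ` irrelevant" using A.closed[of 1] by simp
    then have "1 \<in> irrelevant" using proj_in_irrelevant_iff by blast
    then show False by (simp add: irrelevant_def)
  qed
  fix J assume J: "ideal J coord_ring" "proj ` irrelevant \<subseteq> J" "J \<subseteq> carrier coord_ring"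
  have tJ: "type_ideal {f. proj f \<in> J}" by (rule A.type_ideal_contraction[OF J(1)])
  show "J = proj ` irrelevant \<or> J = carrier coord_ring"
  proof (cases "J \<subseteq> proj ` irrelevant")
    case False
    then obtain y where y: "y \<in> J" "y \<notin> proj ` irrelevant" by (meson subsetI)
    have "y \<in> range proj" using subsetD[OF J(3) y(1)] by (simp only: carrier_coord_ring)
    then obtain f where "y = proj f" by (rule rangeE)
    then have f: "proj f \<in> J" "proj f \<notin> proj ` irrelevant" using y by simp_all
    let ?c = "lookup f 0"
    have "f \<notin> irrelevant" using f(2) by blast
    then have c: "?c \<noteq> 0" by (simp add: irrelevant_def)
    have "proj (f - const ?c) \<in> J" by (rule subsetD[OF J(2) imageI[OF const_irrelevant]])
    then have "f - const ?c \<in> {f. proj f \<in> J}" by simp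
    moreover have "f \<in> {f. proj f \<in> J}" using f(1) by simp
    ultimately have "f - (f - const ?c) \<in> {f. proj f \<in> J}" by (rule type_idealD(3)[OF tJ, rotated])
    then have "const (1 / ?c) * (f - (f - const ?c)) \<in> {f. proj f \<in> J}" by (rule type_idealD(4)[OF tJ])
    moreover have "const (1 / ?c) * (f - (f - const ?c)) = 1" using c by (simp add: const_def mult_single)
    ultimately have "proj 1 \<in> J" by simp
    then have "J = carrier coord_ring" using ideal.one_imp_carrier[OF J(1)] by (simp only: A.one)
    then show ?thesis ..
  qed (use J(2) in blast)
qed

text \<open>The relation \<open>f y = z a\<close> modulo \<open>I(X)\<close> carries socle elements modulo \<open>z\<close> to socle elements modulo \<open>f\<close>.\<close>

lemma socle_transfer:
  assumes f: "f \<in> irrelevant" and reg: "\<And>g. f * g \<in> cone_ideal \<Longrightarrow> g \<in> cone_ideal"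
    and K: "K = {h. \<exists>t e. t \<notin> irrelevant \<and> t * h - f * e \<in> cone_ideal}" and y: "y \<in> socle_reps"
  shows "\<exists>a. f * y - z * a \<in> cone_ideal \<and> a \<notin> K \<and> (\<forall>x\<in>irrelevant. x * a \<in> K)"
proof -
  have bQ: "y \<notin> section_ideal" and soc: "\<And>x. x \<in> irrelevant \<Longrightarrow> x * y \<in> section_ideal"
    using y by (auto simp: socle_reps_def)
  obtain a where a: "f * y - z * a \<in> cone_ideal" using soc[OF f] by (auto simp: section_ideal_def)
  have "x * a \<in> K" if x: "x \<in> irrelevant" for x
  proof -
    obtain e where e: "x * y - z * e \<in> cone_ideal" using soc[OF x] by (auto simp: section_ideal_def)
    have "f * (x * y - z * e) - x * (f * y - z * a) \<in> cone_ideal"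
      by (rule cone_ideal_diff[OF cone_ideal_mult[OF e] cone_ideal_mult[OF a]])
    also have "f * (x * y - z * e) - x * (f * y - z * a) = z * (x * a - f * e)" by (simp add: algebra_simps)
    finally have "x * a - f * e \<in> cone_ideal" by (rule cone_ideal_cancel_z)
    then have "1 \<notin> irrelevant \<and> 1 * (x * a) - f * e \<in> cone_ideal" by (simp add: irrelevant_def)
    then show ?thesis unfolding K by blast
  qed
  moreover have "a \<notin> K"
  proof
    assume "a \<in> K"
    then obtain t e where t: "t \<notin> irrelevant" "t * a - f * e \<in> cone_ideal" unfolding K by blast
    have "z * (t * a - f * e) + t * (f * y - z * a) \<in> cone_ideal"
      by (rule cone_ideal_add[OF cone_ideal_mult[OF t(2)] cone_ideal_mult[OF a]])
    also have "z * (t * a - f * e) + t * (f * y - z * a) = f * (t * y - z * e)" by (simp add: algebra_simps)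
    finally have "t * y - z * e \<in> cone_ideal" by (rule reg)
    then have "t * y \<in> section_ideal" by (auto simp: section_ideal_def)
    moreover have "lookup t 0 \<noteq> 0" using t(1) by (simp add: irrelevant_def)
    ultimately have "y \<in> section_ideal" by (rule section_ideal_saturated)
    then show False using bQ by contradiction
  qed
  ultimately show ?thesis using a by blast
qed

text \<open>The regular sequence is arbitrary, but its length must be one. It is replaced by the
  numerator \<open>f\<close> of its only member, and simplicity of the socle modulo \<open>f\<close>
  is carried to the socle modulo \<open>z\<close>.\<close>

lemma gorenstein_imp_simple_socle:
  assumes "gorenstein_ring coord_ring"
  shows simple_socle
proof -
  define P where "P = proj ` irrelevant"
  define B where "B = localization coord_ring P"
  define \<phi> where "\<phi> f = fraction coord_ring P (proj f) \<one>\<^bsub>coord_ring\<^esub>" for f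
  have P: "maximalideal P coord_ring" unfolding P_def by (rule maximalideal_irrelevant)
  have one_r: "1 \<in> {1..r}" using r_pos by simp
  have M: "{f. proj f \<in> P} = point_ideal 1 0"
    unfolding P_def proj_in_irrelevant_iff point_ideal_0[OF one_r] ..
  have gl: "gorenstein_local B" using assms P by (simp add: gorenstein_ring_def B_def)
  interpret F: fraction_hom B \<phi> irrelevant
    using fraction_hom_at(1)[OF P M] unfolding point_ideal_0[OF one_r] B_def \<phi>_def .
  have kerF: "F.ker = cone_ideal"
  proof -
    have "F.ker = {f. \<exists>t. t \<notin> irrelevant \<and> t * f \<in> cone_ideal}"
      using fraction_hom_at(2)[OF P M] unfolding point_ideal_0[OF one_r] B_def \<phi>_def .
    also have "\<dots> = cone_ideal"
    proof (intro Set.equalityI subsetI)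
      fix f assume "f \<in> {f. \<exists>t. t \<notin> irrelevant \<and> t * f \<in> cone_ideal}"
      then obtain t where t: "lookup t 0 \<noteq> 0" "t * f \<in> cone_ideal" by (auto simp: irrelevant_def)
      have "rest j t \<noteq> 0" for j
      proof
        assume "rest j t = 0"
        then show False using t(1) coeff_line_0[of "p j" t] by simp
      qed
      then show "f \<in> cone_ideal" using cone_ideal_cancel[OF t(2)] by blast
    next
      fix f assume "f \<in> cone_ideal"
      then have "1 \<notin> irrelevant \<and> 1 * f \<in> cone_ideal" by (simp add: irrelevant_def)
      then show "f \<in> {f. \<exists>t. t \<notin> irrelevant \<and> t * f \<in> cone_ideal}" by blast
    qed
    finally show ?thesis .
  qed
  obtain xs where reg: "regular_sequence B xs" and zd: "zero_dim_gorenstein (B Quot (Idl\<^bsub>B\<^esub> (set xs)))"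
    using gl by (auto simp: gorenstein_local_def)
  note reg' = reg[unfolded regular_sequence_def]
  have xs: "set xs \<subseteq> carrier B" using reg' by (rule conjunct1)
  have proper: "Idl\<^bsub>B\<^esub> (set xs) \<noteq> carrier B" using reg' by (rule conjunct2[THEN conjunct1])
  have regular: "y \<in> Idl\<^bsub>B\<^esub> (set (take i xs))"
    if "i < length xs" "y \<in> carrier B" "y \<otimes>\<^bsub>B\<^esub> xs ! i \<in> Idl\<^bsub>B\<^esub> (set (take i xs))" for i y
    using reg'[THEN conjunct2, THEN conjunct2] that by (simp only:)
  have J: "ideal (Idl\<^bsub>B\<^esub> (set xs)) B" using xs by (rule F.genideal_ideal)
  have sub: "set xs \<subseteq> F.nonunits" using F.genideal_self[OF xs] F.proper_ideal_subset[OF J proper] by blast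
  interpret T: fraction_hom "B Quot (Idl\<^bsub>B\<^esub> (set xs))" "\<lambda>f. Idl\<^bsub>B\<^esub> (set xs) +>\<^bsub>B\<^esub> \<phi> f" irrelevant
    by (rule F.fraction_hom_quotient(1)[OF J proper])
  have kerT: "T.ker = {f. \<phi> f \<in> Idl\<^bsub>B\<^esub> (set xs)}" by (rule F.fraction_hom_quotient(2)[OF J proper])
  have "z \<in> point_ideal 1 0" using one_r by (simp add: point_ideal_def rest_z)
  then have z_irr: "z \<in> irrelevant" by (simp only: point_ideal_0[OF one_r])
  show ?thesis
  proof (cases xs)
    \<comment> \<open>Without division a socle element would be annihilated by \<open>z\<close>,
      which is a non-zero-divisor.\<close>
    case Nil
    have "T.ker = cone_ideal"
      unfolding kerT kerF[symmetric] F.ker_def by (simp add: Nil F.Idl_empty)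
    moreover obtain a where "a \<in> T.socle_reps" using T.zero_dim_gorensteinD(1)[OF zd] by blast
    ultimately have "a \<notin> cone_ideal" "z * a \<in> cone_ideal" using z_irr by (auto simp: T.socle_reps_def)
    then show ?thesis using cone_ideal_cancel_z by blast
  next
    case (Cons x ys)
    have x: "x \<in> carrier B" "x \<in> F.nonunits" using xs sub Cons by auto
    obtain f t0 where f: "t0 \<notin> irrelevant" "x \<otimes>\<^bsub>B\<^esub> \<phi> t0 = \<phi> f" using F.frac[OF x(1)] by blast
    have f_irr: "f \<in> irrelevant" using F.nonunits_iff[OF x(1) f] x(2) by simp
    have Idl_x: "Idl\<^bsub>B\<^esub> {x} = Idl\<^bsub>B\<^esub> {\<phi> f}"
    proof (intro Set.equalityI)
      have I1: "ideal (Idl\<^bsub>B\<^esub> {\<phi> f}) B" by (rule F.genideal_ideal) simp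
      have I2: "ideal (Idl\<^bsub>B\<^esub> {x}) B" using x(1) by (intro F.genideal_ideal) simp
      have "\<phi> f \<in> Idl\<^bsub>B\<^esub> {\<phi> f}" by (rule F.genideal_self') simp
      then have "x \<in> Idl\<^bsub>B\<^esub> {\<phi> f}" using F.ideal_frac_iff[OF I1 x(1) f] by simp
      then show "Idl\<^bsub>B\<^esub> {x} \<subseteq> Idl\<^bsub>B\<^esub> {\<phi> f}" by (intro F.genideal_minimal[OF I1]) simp
      have "x \<in> Idl\<^bsub>B\<^esub> {x}" by (rule F.genideal_self'[OF x(1)])
      then have "\<phi> f \<in> Idl\<^bsub>B\<^esub> {x}" using F.ideal_frac_iff[OF I2 x(1) f] by simp
      then show "Idl\<^bsub>B\<^esub> {\<phi> f} \<subseteq> Idl\<^bsub>B\<^esub> {x}" by (intro F.genideal_minimal[OF I2]) simp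
    qed
    have f_reg: "g \<in> cone_ideal" if g: "f * g \<in> cone_ideal" for g
    proof -
      have gx: "\<phi> g \<otimes>\<^bsub>B\<^esub> x \<in> carrier B" using x(1) by simp
      have "(\<phi> g \<otimes>\<^bsub>B\<^esub> x) \<otimes>\<^bsub>B\<^esub> \<phi> t0 = \<phi> g \<otimes>\<^bsub>B\<^esub> (x \<otimes>\<^bsub>B\<^esub> \<phi> t0)" using x(1) by (simp add: F.m_assoc)
      also have "\<dots> = \<phi> (g * f)" by (simp add: f(2) F.mult)
      finally have "\<phi> g \<otimes>\<^bsub>B\<^esub> x = \<zero>\<^bsub>B\<^esub> \<longleftrightarrow> g * f \<in> F.ker" by (rule F.zero_frac_iff[OF gx f(1)])
      then have "\<phi> g \<otimes>\<^bsub>B\<^esub> x = \<zero>\<^bsub>B\<^esub>" using g by (simp add: kerF mult.commute)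
      then have "\<phi> g \<in> Idl\<^bsub>B\<^esub> (set (take 0 xs))"
        using regular[of 0 "\<phi> g"] by (simp add: Cons F.Idl_empty)
      then have "g \<in> F.ker" by (simp add: F.Idl_empty F.ker_def)
      then show ?thesis by (simp add: kerF)
    qed
    define K where "K = {h. \<exists>t e. t \<notin> irrelevant \<and> t * h - f * e \<in> cone_ideal}"
    have K_iff: "\<phi> h \<in> Idl\<^bsub>B\<^esub> {x} \<longleftrightarrow> h \<in> K" for h
      unfolding Idl_x F.psi_in_principal_iff kerF K_def by simp
    have transfer: "\<exists>a. f * y - z * a \<in> cone_ideal \<and> a \<notin> K \<and> (\<forall>x\<in>irrelevant. x * a \<in> K)"
      if "y \<in> socle_reps" for y
      by (rule socle_transfer[OF f_irr _ K_def that]) (rule f_reg)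
    \<comment> \<open>Transfer yields \<open>a\<close> outside the ideal of \<open>x\<close> that
      every nonunit multiplies into that ideal; so a second member \<open>y\<close> cannot be
      regular.\<close>
    have "ys = []"
    proof (rule ccontr)
      assume "ys \<noteq> []"
      then obtain y ys' where ys: "ys = y # ys'" by (cases ys) auto
      have y: "y \<in> carrier B" "y \<in> F.nonunits" using xs sub Cons ys by auto
      obtain g t where g: "t \<notin> irrelevant" "y \<otimes>\<^bsub>B\<^esub> \<phi> t = \<phi> g" using F.frac[OF y(1)] by blast
      have g_irr: "g \<in> irrelevant" using F.nonunits_iff[OF y(1) g] y(2) by simp
      obtain b0 where "b0 \<in> socle_reps" using socle_reps_nonempty by blast
      then obtain a where a: "a \<notin> K" "\<And>x. x \<in> irrelevant \<Longrightarrow> x * a \<in> K" using transfer[of b0] by blast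
      have ay: "\<phi> a \<otimes>\<^bsub>B\<^esub> y \<in> carrier B" using y(1) by simp
      have "(\<phi> a \<otimes>\<^bsub>B\<^esub> y) \<otimes>\<^bsub>B\<^esub> \<phi> t = \<phi> a \<otimes>\<^bsub>B\<^esub> (y \<otimes>\<^bsub>B\<^esub> \<phi> t)" using y(1) by (simp add: F.m_assoc)
      also have "\<dots> = \<phi> (g * a)" by (simp add: g(2) F.mult F.m_comm)
      finally have eq: "(\<phi> a \<otimes>\<^bsub>B\<^esub> y) \<otimes>\<^bsub>B\<^esub> \<phi> t = \<phi> (g * a)" .
      have I2: "ideal (Idl\<^bsub>B\<^esub> {x}) B" using x(1) by (intro F.genideal_ideal) simp
      have "\<phi> a \<otimes>\<^bsub>B\<^esub> y \<in> Idl\<^bsub>B\<^esub> {x}"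
        using F.ideal_frac_iff[OF I2 ay g(1) eq] K_iff[of "g * a"] a(2)[OF g_irr] by simp
      then have "\<phi> a \<in> Idl\<^bsub>B\<^esub> {x}" using regular[of 1 "\<phi> a"] by (simp add: Cons ys)
      then show False using K_iff a(1) by blast
    qed
    then have xs_eq: "set xs = {x}" using Cons by simp
    have kerT_K: "T.ker = K" using kerT unfolding xs_eq K_iff by simp
    show simple_socle
      unfolding simple_socle_def
    proof (intro ballI)
      fix b1 b2 assume b: "b1 \<in> socle_reps" "b2 \<in> socle_reps"
      obtain a1 where a1: "f * b1 - z * a1 \<in> cone_ideal" "a1 \<notin> K" "\<forall>x\<in>irrelevant. x * a1 \<in> K" using transfer[OF b(1)] by blast
      obtain a2 where a2: "f * b2 - z * a2 \<in> cone_ideal" "a2 \<notin> K" "\<forall>x\<in>irrelevant. x * a2 \<in> K" using transfer[OF b(2)] by blast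
      have "a1 \<in> T.socle_reps" "a2 \<in> T.socle_reps" using a1 a2 by (simp_all add: T.socle_reps_def kerT_K)
      then obtain g where "a2 - g * a1 \<in> K" using T.zero_dim_gorensteinD(2)[OF zd] unfolding kerT_K by blast
      then obtain t e where t: "t \<notin> irrelevant" "t * (a2 - g * a1) - f * e \<in> cone_ideal" unfolding K_def by blast
      \<comment> \<open>In this combination the terms with \<open>z * a1\<close> and
        \<open>z * a2\<close> cancel and a multiple of the regular element \<open>f\<close> remains.
        Cancelling \<open>f\<close> turns the relation of \<open>a1\<close>, \<open>a2\<close>
        modulo \<open>f\<close> into one of \<open>b1\<close>, \<open>b2\<close> modulo
        \<open>z\<close>.\<close>
      have "z * (t * (a2 - g * a1) - f * e) + t * ((f * b2 - z * a2) - g * (f * b1 - z * a1)) \<in> cone_ideal"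
        by (rule cone_ideal_add[OF cone_ideal_mult[OF t(2)] cone_ideal_mult[OF cone_ideal_diff[OF a2(1) cone_ideal_mult[OF a1(1)]]]])
      also have "z * (t * (a2 - g * a1) - f * e) + t * ((f * b2 - z * a2) - g * (f * b1 - z * a1)) =
        f * (t * (b2 - g * b1) - z * e)" by (simp add: algebra_simps)
      finally have "t * (b2 - g * b1) - z * e \<in> cone_ideal" by (rule f_reg)
      then have "t * (b2 - g * b1) \<in> section_ideal" by (auto simp: section_ideal_def)
      moreover have "lookup t 0 \<noteq> 0" using t(1) by (simp add: irrelevant_def)
      ultimately have "b2 - g * b1 \<in> section_ideal" by (rule section_ideal_saturated)
      then show "\<exists>g. b2 - g * b1 \<in> section_ideal" by blast
    qed
  qed
qed

theorem gorenstein_iff_dualizing: "gorenstein_ring coord_ring \<longleftrightarrow> (\<exists>w. dualizing w)"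
  using gorenstein_imp_simple_socle simple_socle_imp_gorenstein simple_socle_imp_dualizing
    dualizing_imp_simple_socle by blast

end

section \<open>Vanishing ideal and Hilbert function\<close>

lemma proj_point_scale:
  fixes q :: "'v \<Rightarrow> 'k::field"
  assumes "c \<noteq> 0"
  shows "proj_point (\<lambda>v. c * q v) = proj_point q"
proof (intro Set.equalityI subsetI)
  fix x assume "x \<in> proj_point (\<lambda>v. c * q v)"
  then obtain d where "d \<noteq> 0" "x = (\<lambda>v. d * (c * q v))" by (auto simp: proj_point_def)
  then have "d * c \<noteq> 0 \<and> x = (\<lambda>v. (d * c) * q v)" using assms by (simp add: mult.assoc)
  then show "x \<in> proj_point q" unfolding proj_point_def by blast
next
  fix x assume "x \<in> proj_point q"
  then obtain d where "d \<noteq> 0" "x = (\<lambda>v. d * q v)" by (auto simp: proj_point_def)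
  then have "d / c \<noteq> 0 \<and> x = (\<lambda>v. (d / c) * (c * q v))" using assms by simp
  then show "x \<in> proj_point (\<lambda>v. c * q v)" unfolding proj_point_def by blast
qed

lemma submod_scal:
  fixes G :: "('v::finite, 'k::field) mpoly"
  assumes "c \<noteq> 0"
  shows "submod {scal c G} = submod {G}"
proof -
  have "range (\<lambda>g. g \<diamondop> scal c G) = range (\<lambda>g. g \<diamondop> G)"
  proof (intro Set.equalityI image_subsetI)
    fix g
    have "g \<diamondop> scal c G = scal c g \<diamondop> G" by (simp add: diff_act_scal_left diff_act_scal_right)
    then show "g \<diamondop> scal c G \<in> range (\<lambda>g. g \<diamondop> G)" by simp
    have "g \<diamondop> G = scal (1 / c) g \<diamondop> scal c G"
      using assms by (simp add: diff_act_scal_left diff_act_scal_right)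
    then show "g \<diamondop> G \<in> range (\<lambda>g. g \<diamondop> scal c G)" by simp
  qed
  then show ?thesis by (simp only: Modules.module.span_singleton[OF module_diff_act])
qed

context points
begin

definition pts :: "('v \<Rightarrow> 'k) set set" where
  "pts = (\<lambda>i. proj_point (p i)) ` {1..r}"

lemma vanishes_on_iff: "vanishes_on f pts \<longleftrightarrow> (\<forall>i\<in>{1..r}. \<forall>c. c \<noteq> 0 \<longrightarrow> poly (rest i f) c = 0)"
  by (auto simp: vanishes_on_def pts_def proj_point_def poly_line)

lemma vanishes_on_homogeneous_iff:
  assumes "homogeneous d f"
  shows "vanishes_on f pts \<longleftrightarrow> f \<in> cone_ideal"
proof
  assume v: "vanishes_on f pts"
  show "f \<in> cone_ideal"
    unfolding cone_ideal_def
  proof (intro CollectI ballI)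
    fix i assume "i \<in> {1..r}"
    then have "poly (rest i f) 1 = 0" using v by (simp add: vanishes_on_iff)
    moreover have eq: "rest i f = monom (coeff (rest i f) d) d" by (rule line_homogeneous[OF assms])
    have "poly (monom (coeff (rest i f) d) d) 1 = coeff (rest i f) d" by (simp add: poly_monom)
    then have "poly (rest i f) 1 = coeff (rest i f) d" by (simp only: eq[symmetric])
    ultimately have "coeff (rest i f) d = 0" by simp
    then show "rest i f = 0" using eq by simp
  qed
qed (simp add: vanishes_on_iff cone_ideal_def)

text \<open>\<open>cone_ideal\<close> is homogeneous, because the restriction of a component to a
  line through the origin is a single term of the restriction of the polynomial. A form vanishes on
  a line if it vanishes at one nonzero point.\<close>

lemma vanishing_ideal_eq: "vanishing_ideal pts = cone_ideal"
proof
  interpret R: Modules.module "(*) :: ('v, 'k) mpoly \<Rightarrow> _" by (rule module_mult)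
  have "R.subspace cone_ideal"
    by (rule R.subspaceI) (auto intro: cone_ideal_0 cone_ideal_add cone_ideal_mult)
  then show "vanishing_ideal pts \<subseteq> cone_ideal"
    unfolding vanishing_ideal_def using vanishes_on_homogeneous_iff by (intro R.span_minimal) auto
  show "cone_ideal \<subseteq> vanishing_ideal pts"
  proof
    fix f assume f: "f \<in> cone_ideal"
    obtain N where "\<forall>m\<in>keys f. total_deg m \<le> N" using total_deg_bounded by blast
    then have "f = (\<Sum>d\<le>N. hom_part d f)" by (simp add: sum_hom_part)
    also have "\<dots> \<in> vanishing_ideal pts"
      unfolding vanishing_ideal_def
    proof (intro R.span_sum R.span_base CollectI conjI)
      fix d
      show "\<exists>e. homogeneous e (hom_part d f)" using homogeneous_hom_part by blast
      have "hom_part d f \<in> cone_ideal" using f by (simp add: cone_ideal_iff ev_hom_part)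
      then show "vanishes_on (hom_part d f) pts" by (simp only: vanishes_on_homogeneous_iff[OF homogeneous_hom_part])
    qed
    finally show "f \<in> vanishing_ideal pts" .
  qed
qed

lemma HF_eq_dim: "HF pts t = int (FV.dim (V t))"
  unfolding HF_def vanishing_ideal_eq by (rule dim_homogeneous_diff)

lemma V_eq_iff_dim: "V t = full \<longleftrightarrow> FV.dim (V t) = r"
proof
  assume "FV.dim (V t) = r"
  then show "V t = full"
    by - (rule FV.subspace_dim_eq[OF subspace_V V_subset_full eq_refl[OF full_eq_span]], simp_all add: dim_full)
qed (simp add: dim_full)

lemma r_pos_of_nondegenerate: "\<not> in_hyperplane pts \<Longrightarrow> r > 0"
proof (rule ccontr)
  assume *: "\<not> in_hyperplane pts" "\<not> r > 0"
  then have "vanishes_on (linear_form (\<lambda>_. 1)) pts" unfolding vanishes_on_iff by auto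
  moreover have "(\<lambda>_. 1 :: 'k) \<noteq> (\<lambda>_. 0)" by (simp add: fun_eq_iff)
  ultimately show False using *(1) unfolding in_hyperplane_def by blast
qed

text \<open>Otherwise every coordinate would be constant on the chart, so \<open>x_v - k z\<close>
  would vanish on \<open>X\<close> for some \<open>k\<close> and be zero by nondegeneracy. But two
  different coordinates cannot both be multiples of \<open>z\<close>.\<close>

lemma V_0_neq_full:
  assumes nondeg: "\<not> in_hyperplane pts" and card: "CARD('v) \<ge> 2"
  shows "V 0 \<noteq> full"
proof
  assume full: "V 0 = full"
  have *: "\<exists>k. \<forall>w. (if w = v then 1 else 0) = k * b w" for v
  proof -
    have "ev 1 (single (single v 1) 1) \<in> V 0" using V_subset_full[of 1] full by (auto simp: V_def)
    then obtain f where f: "ev 1 (single (single v 1) 1) = ev 0 f" by (auto simp: V_def)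
    let ?k = "lookup f 0" and ?c = "\<lambda>w. (if w = v then 1 else 0) - lookup f 0 * b w"
    have pv: "p i v = ?k" if "i \<in> {1..r}" for i
      using fun_cong[OF f, of i] that by (simp add: ev_def line_single coeff_line_0)
    have "(\<Sum>w\<in>UNIV. ?c w * p i w) = 0" if i: "i \<in> {1..r}" for i
    proof -
      have "(\<Sum>w\<in>UNIV. ?c w * p i w) = (\<Sum>w\<in>UNIV. (if w = v then p i v else 0) - ?k * (b w * p i w))"
        by (intro sum.cong) (auto simp: algebra_simps)
      also have "\<dots> = p i v - ?k * (\<Sum>w\<in>UNIV. b w * p i w)"
        by (simp add: sum_subtractf sum_distrib_left)
      also have "\<dots> = 0" by (simp add: on_chart[OF i] pv[OF i])
      finally show ?thesis .
    qed
    then have "vanishes_on (linear_form ?c) pts" by (simp add: vanishes_on_iff line_linear_form)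
    then have "?c = (\<lambda>_. 0)" using nondeg unfolding in_hyperplane_def by blast
    then have "(if w = v then 1 else 0) = ?k * b w" for w using fun_cong[of ?c "\<lambda>_. 0" w] by simp
    then show ?thesis by blast
  qed
  have "\<exists>v w :: 'v. v \<noteq> w"
  proof (rule ccontr)
    assume "\<not> ?thesis"
    then have "(UNIV :: 'v set) = {undefined}" by auto
    then have "CARD('v) = card {undefined :: 'v}" by simp
    then show False using card by simp
  qed
  then obtain v w :: 'v where vw: "v \<noteq> w" by blast
  obtain k where k: "\<And>u. (if u = v then 1 else 0) = k * b u" using * by blast
  obtain l where l: "\<And>u. (if u = w then 1 else 0) = l * b u" using * by blast
  have "k \<noteq> 0" using k[of v] by auto
  then have "b w = 0" using k[of w] vw by auto
  then show False using l[of w] by simp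
qed

text \<open>The Hilbert function is the dimension of an increasing filtration that becomes
  stationary at \<open>k^r\<close>, so its last jump occurs where the filtration first fills
  \<open>k^r\<close>.\<close>

lemma socle_degree_properties:
  assumes nondeg: "\<not> in_hyperplane pts" and card: "CARD('v) \<ge> 2"
  defines "s \<equiv> socle_degree pts"
  shows "s > 0" "V s = full" "V (s - 1) \<noteq> full"
proof -
  let ?P = "\<lambda>t. HF_diff pts t \<noteq> 0"
  have rp: "r > 0" by (rule r_pos_of_nondegenerate[OF nondeg])
  \<comment> \<open>\<open>GREATEST\<close> is meaningful only with a bound; the filtration is
    constant from \<open>r - 1\<close> on.\<close>
  have bound: "t \<le> r" if "?P t" for t
  proof (rule ccontr)
    assume "\<not> t \<le> r"
    then have "r - 1 \<le> t" "r - 1 \<le> t - 1" "t \<noteq> 0" by simp_all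
    moreover have "V u = full" if "r - 1 \<le> u" for u
      using V_mono'[OF that] unfolding V_eq_full_large by (rule antisym[OF V_subset_full])
    ultimately show False using \<open>?P t\<close> by (simp add: HF_diff_def HF_eq_dim)
  qed
  have "\<exists>t. ?P t"
  proof (rule ccontr)
    assume "\<nexists>t. ?P t"
    then have none: "HF_diff pts t = 0" for t by blast
    have "FV.dim (V t) = 0" for t
    proof (induction t)
      case 0
      then show ?case using none[of 0] by (simp add: HF_diff_def HF_eq_dim)
    next
      case (Suc t)
      then show ?case using none[of "Suc t"] by (simp add: HF_diff_def HF_eq_dim)
    qed
    from this[of "r - 1"] show False unfolding V_eq_full_large dim_full using rp by simp
  qed
  then obtain t0 where t0: "?P t0" ..
  have Ps: "?P s" unfolding s_def socle_degree_def using t0 bound by (rule GreatestI_nat)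
  have above: "HF_diff pts t = 0" if "t > s" for t
  proof (rule ccontr)
    assume "HF_diff pts t \<noteq> 0"
    then have "t \<le> s" unfolding s_def socle_degree_def by (rule Greatest_le_nat) (rule bound)
    then show False using that by simp
  qed
  have const: "FV.dim (V (s + n)) = FV.dim (V s)" for n
  proof (induction n)
    case (Suc n)
    have "HF_diff pts (Suc (s + n)) = 0" by (rule above) simp
    then have "FV.dim (V (Suc (s + n))) = FV.dim (V (s + n))" by (simp add: HF_diff_def HF_eq_dim)
    then show ?case using Suc by simp
  qed simp
  have "V (r - 1) \<subseteq> V (s + (r - 1))" by (rule V_mono') simp
  then have "V (s + (r - 1)) = full" unfolding V_eq_full_large by (rule antisym[OF V_subset_full])
  then have "FV.dim (V s) = r" using const[of "r - 1"] dim_full by simp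
  then show Vs: "V s = full" by (simp add: V_eq_iff_dim)
  show s0: "s > 0"
  proof (rule ccontr)
    assume "\<not> s > 0"
    then show False using Vs V_0_neq_full[OF nondeg card] by simp
  qed
  show "V (s - 1) \<noteq> full"
    using Ps s0 Vs by (auto simp: HF_diff_def HF_eq_dim)
qed

end

section \<open>Passage from the given coordinates to the chart\<close>

lemma (in points_socle_degree) dualizing_cong:
  assumes "\<And>i. i \<in> {1..r} \<Longrightarrow> w i = w' i"
  shows "dualizing w \<longleftrightarrow> dualizing w'"
proof -
  have "inv_form w N = inv_form w' N" for N
    unfolding inv_form_def using assms by (intro sum.cong) auto
  then show ?thesis by (simp add: dualizing_def balanced_def)
qed

theorem mainTheorem2:
  fixes a :: "nat \<Rightarrow> 'v::finite \<Rightarrow> 'k::{alg_closed_field, field_char_0}"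
    and b :: "'v \<Rightarrow> 'k"
    and n r s :: nat
    and pts :: "('v \<Rightarrow> 'k) set set"
    and L :: "nat \<Rightarrow> ('v, 'k) mpoly"
    and z :: "('v, 'k) mpoly"
    and zP :: "nat \<Rightarrow> 'k"
    and F :: "(nat \<Rightarrow> 'k) \<Rightarrow> ('v, 'k) mpoly"
    and Ft :: "(nat \<Rightarrow> 'k) \<Rightarrow> nat \<Rightarrow> ('v, 'k) mpoly"
    and cond2 :: "(nat \<Rightarrow> 'k) \<Rightarrow> bool"
  assumes n: "n \<ge> 1"
    and card_vars: "CARD('v) = n + 1"
    and nonzero: "\<forall>i\<in>{1..r}. a i \<noteq> (\<lambda>_. 0)"
    and distinct: "inj_on (\<lambda>i. proj_point (a i)) {1..r}"
    and pts: "pts = (\<lambda>i. proj_point (a i)) ` {1..r}"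
    and nondeg: "\<not> in_hyperplane pts"
    and s: "s = socle_degree pts"
    and L: "\<forall>i. L i = linear_form (a i)"
    and z: "z = linear_form b"
    and zP: "\<forall>i. zP i = (\<Sum>v\<in>UNIV. b v * a i v)"
    and zP_nonzero: "\<forall>i\<in>{1..r}. zP i \<noteq> 0"
    and F: "\<forall>\<alpha>. F \<alpha> = (\<Sum>i=1..r. scal (\<alpha> i / zP i) (L i ^ s))"
    and cond2: "\<forall>\<alpha>. cond2 \<alpha> \<longleftrightarrow>
      (\<Sum>i=1..r. scal (\<alpha> i) (L i ^ (s - 1))) = 0 \<and> kdim (submod {F \<alpha>}) \<ge> r"
    and Ft: "\<forall>\<alpha> t. Ft \<alpha> t =
      scal (1 / fact (t + s - 1)) (\<Sum>i=1..r. scal (\<alpha> i / zP i ^ t) (L i ^ (t + s - 1)))"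
  shows "(arith_gorenstein pts \<longleftrightarrow> (\<exists>\<alpha>. cond2 \<alpha>)) \<and>
    (arith_gorenstein pts \<longrightarrow>
      (\<forall>\<alpha>. cond2 \<alpha> \<longrightarrow> (\<forall>i\<in>{1..r}. \<alpha> i \<noteq> 0)) \<and>
      (\<forall>\<alpha> \<beta>. cond2 \<alpha> \<and> cond2 \<beta> \<longrightarrow> (\<exists>c. c \<noteq> 0 \<and> (\<forall>i\<in>{1..r}. \<beta> i = c * \<alpha> i))) \<and>
      (\<forall>\<alpha>. cond2 \<alpha> \<longrightarrow>
        perp (vanishing_ideal pts) = submod {Ft \<alpha> t | t. t \<ge> 1} \<and>
        Ft \<alpha> 1 = scal (1 / fact s) (F \<alpha>) \<and>
        G_admissible z (Ft \<alpha>)))"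
proof -
  define p where "p i = (\<lambda>v. 1 / zP i * a i v)" for i
  have a_eq: "a i = (\<lambda>v. zP i * p i v)" if "i \<in> {1..r}" for i
    using bspec[OF zP_nonzero that] by (simp add: p_def)
  have proj_p: "proj_point (a i) = proj_point (p i)" if "i \<in> {1..r}" for i
    unfolding p_def using bspec[OF zP_nonzero that] by (intro proj_point_scale[symmetric]) simp
  interpret X: points p b r
  proof
    fix i assume i: "i \<in> {1..r}"
    have "(\<Sum>v\<in>UNIV. b v * p i v) = 1 / zP i * (\<Sum>v\<in>UNIV. b v * a i v)"
      unfolding p_def sum_distrib_left by (intro sum.cong) simp_all
    also have "\<dots> = 1 / zP i * zP i" using zP by simp
    also have "\<dots> = 1" using bspec[OF zP_nonzero i] by simp
    finally show "(\<Sum>v\<in>UNIV. b v * p i v) = 1" .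
  next
    show "inj_on p {1..r}"
    proof (rule inj_onI)
      fix i j assume ij: "i \<in> {1..r}" "j \<in> {1..r}" "p i = p j"
      then have "proj_point (a i) = proj_point (a j)" by (simp only: proj_p)
      then show "i = j" using ij(1,2) by (rule inj_onD[OF distinct])
    qed
  qed
  have pts_eq: "pts = X.pts" unfolding pts X.pts_def using proj_p by (intro image_cong refl)
  have card: "CARD('v) \<ge> 2" using n card_vars by simp
  note sd = X.socle_degree_properties[OF nondeg[unfolded pts_eq] card, folded pts_eq, folded s]
  interpret X: closed_points p b r s
    by unfold_locales (rule sd)+
  \<comment> \<open>The form \<open>L i\<close> is \<open>zP i\<close> times the linear form of
    \<open>p i\<close>. The \<open>(t + s - 1)\<close>-th power divided by \<open>zP i ^ t\<close>
    leaves the exponent \<open>s - 1\<close>, whatever \<open>t\<close> is.\<close>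
  define w where "w \<alpha> i = \<alpha> i * zP i ^ (s - 1)" for \<alpha> i
  have L_power: "L i ^ N = scal (zP i ^ N * fact N) (divpow (p i) N)" if "i \<in> {1..r}" for i N
  proof -
    have "L i = scal (zP i) (linear_form (p i))"
      using L a_eq[OF that] linear_form_scale[of "zP i" "p i"] by simp
    then show ?thesis by (simp add: scal_power divpow_def)
  qed
  have form: "(\<Sum>i=1..r. scal (\<alpha> i / zP i ^ t) (L i ^ (t + s - 1))) =
      scal (fact (t + s - 1)) (X.inv_form (w \<alpha>) (t + s - 1))" for \<alpha> t
    unfolding X.inv_form_def scal_sum_right
  proof (intro sum.cong refl)
    fix i assume i: "i \<in> {1..r}"
    have e: "t + s - 1 = t + (s - 1)" using sd(1) by simp
    have "\<alpha> i / zP i ^ t * (zP i ^ (t + s - 1) * fact (t + s - 1)) = fact (t + s - 1) * w \<alpha> i"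
      unfolding e power_add w_def using bspec[OF zP_nonzero i] by simp
    then show "scal (\<alpha> i / zP i ^ t) (L i ^ (t + s - 1)) =
        scal (fact (t + s - 1)) (scal (w \<alpha> i) (divpow (p i) (t + s - 1)))"
      by (simp only: L_power[OF i] scal_simps)
  qed
  have Ft_eq: "Ft \<alpha> = (\<lambda>t. X.inv_form (w \<alpha>) (t + s - 1))" for \<alpha>
  proof
    fix t
    have "Ft \<alpha> t = scal (1 / fact (t + s - 1)) (scal (fact (t + s - 1)) (X.inv_form (w \<alpha>) (t + s - 1)))"
      using Ft by (simp only: form)
    then show "Ft \<alpha> t = X.inv_form (w \<alpha>) (t + s - 1)" by simp
  qed
  have F_eq: "F \<alpha> = scal (fact s) (X.inv_form (w \<alpha>) s)" for \<alpha>
    using form[of \<alpha> 1] F by simp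
  have cond2_iff: "cond2 \<alpha> \<longleftrightarrow> X.dualizing (w \<alpha>)" for \<alpha>
  proof -
    \<comment> \<open>Condition (a) concerns the member with index 0 of the same family.\<close>
    have "(\<Sum>i=1..r. scal (\<alpha> i) (L i ^ (s - 1))) = scal (fact (s - 1)) (X.inv_form (w \<alpha>) (s - 1))"
      using form[of \<alpha> 0] by simp
    then have "(\<Sum>i=1..r. scal (\<alpha> i) (L i ^ (s - 1))) = 0 \<longleftrightarrow> X.inv_form (w \<alpha>) (s - 1) = 0"
      by simp
    moreover have "submod {F \<alpha>} = submod {X.inv_form (w \<alpha>) s}"
      unfolding F_eq by (rule submod_scal) simp
    ultimately show ?thesis using cond2 by (simp only: X.dualizing_def X.balanced_def)
  qed
  have ex: "(\<exists>\<alpha>. cond2 \<alpha>) \<longleftrightarrow> (\<exists>u. X.dualizing u)"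
  proof
    assume "\<exists>u. X.dualizing u"
    then obtain u where u: "X.dualizing u" ..
    \<comment> \<open>Only indices of points are compared, since \<open>zP\<close> may vanish
      elsewhere.\<close>
    have "w (\<lambda>i. u i / zP i ^ (s - 1)) i = u i" if "i \<in> {1..r}" for i
      using bspec[OF zP_nonzero that] by (simp add: w_def)
    then have "X.dualizing (w (\<lambda>i. u i / zP i ^ (s - 1))) \<longleftrightarrow> X.dualizing u" by (rule X.dualizing_cong)
    then show "\<exists>\<alpha>. cond2 \<alpha>" unfolding cond2_iff using u by blast
  qed (use cond2_iff in blast)
  have gor: "arith_gorenstein pts \<longleftrightarrow> (\<exists>u. X.dualizing u)"
    unfolding arith_gorenstein_def pts_eq X.vanishing_ideal_eq by (rule X.gorenstein_iff_dualizing)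
  show ?thesis
  proof (intro conjI impI allI ballI)
    show "arith_gorenstein pts \<longleftrightarrow> (\<exists>\<alpha>. cond2 \<alpha>)" unfolding gor ex ..
    show "\<alpha> i \<noteq> 0" if "cond2 \<alpha>" "i \<in> {1..r}" for \<alpha> i
      using X.dualizing_nonzero[OF that(1)[unfolded cond2_iff] that(2)] by (simp add: w_def)
    show "\<exists>c. c \<noteq> 0 \<and> (\<forall>i\<in>{1..r}. \<beta> i = c * \<alpha> i)" if cc: "cond2 \<alpha> \<and> cond2 \<beta>" for \<alpha> \<beta>
    proof -
      obtain c where c: "c \<noteq> 0" "\<And>i. i \<in> {1..r} \<Longrightarrow> w \<beta> i = c * w \<alpha> i"
        using X.dualizing_unique[of "w \<alpha>" "w \<beta>"] cc unfolding cond2_iff by blast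
      have "\<beta> i = c * \<alpha> i" if "i \<in> {1..r}" for i
        using c(2)[OF that] bspec[OF zP_nonzero that] by (simp add: w_def)
      then show ?thesis using c(1) by blast
    qed
    fix \<alpha> assume \<alpha>: "cond2 \<alpha>"
    then have dual: "X.dualizing (w \<alpha>)" by (simp only: cond2_iff)
    show "perp (vanishing_ideal pts) = submod {Ft \<alpha> t | t. t \<ge> 1}"
      unfolding pts_eq X.vanishing_ideal_eq Ft_eq by (rule X.perp_cone_ideal[OF dual])
    show "Ft \<alpha> 1 = scal (1 / fact s) (F \<alpha>)" by (simp add: Ft_eq F_eq)
    show "G_admissible z (Ft \<alpha>)" unfolding z Ft_eq by (rule X.G_admissible_inv_form[OF dual])
  qed
qed

end
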